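(* Let $\mathbb{K}$ be $\mathbb{R}$ or $\mathbb{Q}_p$, and let $S$ be a bounded symmetric Borel subset of $\mathbb{K}^m$ whose closure does not contain the origin. Then for every symmetric Borel probability measure $\mu$ on $\mathbb{K}^m$ with support contained in $S$, $$\bar{\alpha}\big(\mathrm{Cay}(\mathbb{K}^m,S)\big)\leq-\frac{\inf_{u\in\mathbb{K}^m}\widehat{\mu}(u)}{1-\inf_{u\in\mathbb{K}^m}\widehat{\mu}(u)}.$$
   Context: $\mathbb{K}^m$ carries the Euclidean norm ($\mathbb{K}=\mathbb{R}$) or the supremum of $p$-adic absolute values of coordinates ($\mathbb{K}=\mathbb{Q}_p$); $B_r$ is the ball of radius $r$ about $0$ and $|\cdot|$ is Haar measure. $\mathrm{Cay}(\mathbb{K}^m,S)$ has vertex set $\mathbb{K}^m$, with $x,y$ adjacent iff $x-y\in S$; an independent set is a Borel set containing no two adjacent vertices; the upper density of Borel $I$ is $\overline{d}(I)=\limsup_{r\to\infty}|I\cap B_r|/|B_r|$; and $\bar\alpha$ is the supremum of upper densities of independent sets. $\mu$ symmetric means $\mu(-E)=\mu(E)$. The Fourier transform is $\widehat{\mu}(u)=\int\overline{\psi}(x\cdot u)\,d\mu(x)$ with $\psi(x)=\exp(2\pi ix)$ on $\mathbb{R}$, and on $\mathbb{Q}_p$, $\psi(x)=\exp(2\pi i r_x/p^{n_x})$, where $n_x$ is the least non-negative integer with $p^{n_x}x\in\mathbb{Z}_p$ and $r_x\equiv p^{n_x}x\pmod{p^{n_x}}$ is an integer. *)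

theory Defs
  imports "HOL-Probability.Probability" "Berlekamp_Zassenhaus.Finite_Field"
begin

section \<open>The p-adic absolute value on the rationals\<close>

definition padic_abs :: "nat \<Rightarrow> rat \<Rightarrow> real" where
  "padic_abs p q = (if q = 0 then 0 else
     real p powi (int (multiplicity (int p) (snd (quotient_of q)))
                - int (multiplicity (int p) (fst (quotient_of q)))))"

lemma padic_abs_zero [simp]: "padic_abs p 0 = 0"
  by (simp add: padic_abs_def)

lemma padic_abs_frac:
  assumes p: "prime p" and a: "a \<noteq> 0" and b: "b \<noteq> 0"
  shows "padic_abs p (of_int a / of_int b) =
           real p powi (int (multiplicity (int p) b) - int (multiplicity (int p) a))"
proof -
  let ?q = "of_int a / of_int b :: rat"
  obtain n d where nd: "quotient_of ?q = (n, d)" by force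
  have d0: "d > 0" using nd by (rule quotient_of_denom_pos)
  have q: "?q = of_int n / of_int d" using nd by (rule quotient_of_div)
  have n0: "n \<noteq> 0" using q a b by auto
  have "of_int (a * d) = (of_int (n * b) :: rat)"
    using q a b d0 by (simp add: field_simps)
  then have eq: "a * d = n * b" by (simp only: of_int_eq_iff)
  have pe: "prime_elem (int p)" using p by simp
  have "multiplicity (int p) (a * d) = multiplicity (int p) a + multiplicity (int p) d"
    using pe a d0 by (intro prime_elem_multiplicity_mult_distrib) auto
  moreover have "multiplicity (int p) (n * b) = multiplicity (int p) n + multiplicity (int p) b"
    using pe n0 b by (intro prime_elem_multiplicity_mult_distrib) auto
  ultimately have "int (multiplicity (int p) d) - int (multiplicity (int p) n)
      = int (multiplicity (int p) b) - int (multiplicity (int p) a)"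
    using eq by simp
  then show ?thesis using a b nd by (simp add: padic_abs_def)
qed

lemma rat_frac: obtains a b :: int where "(x::rat) = of_int a / of_int b" "b \<noteq> 0"
proof -
  obtain a b where ab: "quotient_of x = (a, b)" by force
  show thesis
    using that[of a b] quotient_of_div[OF ab] quotient_of_denom_pos[OF ab] by simp
qed

context
  fixes p :: nat
  assumes p: "prime p"
begin

lemma p_real_gt1: "real p > 1"
  using prime_gt_1_nat[OF p] by simp

lemma padic_abs_nonneg: "padic_abs p x \<ge> 0"
  using p_real_gt1 by (simp add: padic_abs_def)

lemma padic_abs_eq_0: "padic_abs p x = 0 \<longleftrightarrow> x = 0"
  using p_real_gt1 by (simp add: padic_abs_def)

lemma padic_abs_1: "padic_abs p 1 = 1"
  using padic_abs_frac[OF p, of 1 1] by simp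

lemma padic_abs_int:
  assumes "a \<noteq> 0"
  shows "padic_abs p (of_int a) = real p powi (- int (multiplicity (int p) a))"
  using padic_abs_frac[OF p, of a 1] assms by simp

lemma padic_abs_int_le1: "padic_abs p (of_int a) \<le> 1"
proof (cases "a = 0")
  case False
  then show ?thesis using p_real_gt1
    by (simp add: padic_abs_int power_int_minus inverse_le_1_iff)
qed simp

lemma padic_abs_mult: "padic_abs p (x * y) = padic_abs p x * padic_abs p y"
proof (cases "x = 0 \<or> y = 0")
  case False
  obtain a b where x: "x = of_int a / of_int b" "b \<noteq> 0" by (rule rat_frac)
  obtain c d where y: "y = of_int c / of_int d" "d \<noteq> 0" by (rule rat_frac)
  have nz: "a \<noteq> 0" "c \<noteq> 0" using False x y by auto
  have pe: "prime_elem (int p)" using p by simp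
  have xy: "x * y = of_int (a * c) / of_int (b * d)" by (simp add: x y)
  have "padic_abs p (x * y) = real p powi
     ((int (multiplicity (int p) b) - int (multiplicity (int p) a)) +
      (int (multiplicity (int p) d) - int (multiplicity (int p) c)))"
    unfolding xy using nz x y
    by (subst padic_abs_frac[OF p])
       (simp_all add: prime_elem_multiplicity_mult_distrib[OF pe] algebra_simps)
  also have "\<dots> = padic_abs p x * padic_abs p y"
    unfolding x y using nz x y p_real_gt1
    by (subst (1 2) padic_abs_frac[OF p]) (simp_all add: power_int_add)
  finally show ?thesis .
qed auto

lemma padic_abs_minus: "padic_abs p (- x) = padic_abs p x"
proof -
  have "padic_abs p (-1) = 1"
    using padic_abs_mult[of "-1" "-1"] padic_abs_nonneg[of "-1"]
    by (simp add: padic_abs_1 square_eq_1_iff)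
  then show ?thesis using padic_abs_mult[of "-1" x] by simp
qed

lemma padic_abs_minus_commute: "padic_abs p (x - y) = padic_abs p (y - x)"
  using padic_abs_minus[of "x - y"] by simp

lemma padic_abs_add_le_max: "padic_abs p (x + y) \<le> max (padic_abs p x) (padic_abs p y)"
proof (cases "x = 0 \<or> y = 0 \<or> x + y = 0")
  case True
  then show ?thesis using padic_abs_nonneg by (auto simp: max_def)
next
  case False
  obtain a b where x: "x = of_int a / of_int b" "b \<noteq> 0" by (rule rat_frac)
  obtain c d where y: "y = of_int c / of_int d" "d \<noteq> 0" by (rule rat_frac)
  let ?m = "multiplicity (int p)"
  have x': "x = of_int (a * d) / of_int (b * d)" using x y by simp
  have y': "y = of_int (c * b) / of_int (b * d)" using x y by simp
  have xy: "x + y = of_int (a * d + c * b) / of_int (b * d)"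
    unfolding x' y' by (simp add: add_divide_distrib)
  have nz: "a * d \<noteq> 0" "c * b \<noteq> 0" "a * d + c * b \<noteq> 0" "b * d \<noteq> 0"
    using False x y xy
    by (auto simp del: of_int_add of_int_mult)
  have "int p ^ min (?m (a * d)) (?m (c * b)) dvd a * d + c * b"
    by (intro dvd_add) (simp_all add: multiplicity_dvd')
  then have le: "min (?m (a * d)) (?m (c * b)) \<le> ?m (a * d + c * b)"
    using nz p by (intro multiplicity_geI) (auto simp: prime_gt_1_nat not_prime_unit)
  have mono: "real p powi i \<le> real p powi j" if "i \<le> j" for i j
    using p_real_gt1 that by (intro power_int_increasing) auto
  show ?thesis
    unfolding xy unfolding x' y' using nz le
    by (subst (1 2 3) padic_abs_frac[OF p]) (auto simp: le_max_iff_disj min_def intro!: mono split: if_splits)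
qed

lemma padic_abs_triangle: "padic_abs p (x + y) \<le> padic_abs p x + padic_abs p y"
  using padic_abs_add_le_max[of x y] padic_abs_nonneg[of x] padic_abs_nonneg[of y] by linarith

lemma padic_abs_triangle_rev: "\<bar>padic_abs p x - padic_abs p y\<bar> \<le> padic_abs p (x - y)"
  using padic_abs_triangle[of "x - y" y] padic_abs_triangle[of "y - x" x]
    padic_abs_minus_commute[of x y] by simp

lemma padic_abs_inverse: "padic_abs p (inverse x) = inverse (padic_abs p x)"
proof (cases "x = 0")
  case False
  then have "padic_abs p x * padic_abs p (inverse x) = 1"
    by (simp flip: padic_abs_mult add: padic_abs_1)
  then show ?thesis by (metis inverse_unique)
qed simp

end


section \<open>Cauchy sequences and null sequences\<close>

definition padic_cauchy :: "nat \<Rightarrow> (nat \<Rightarrow> rat) \<Rightarrow> bool" where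
  "padic_cauchy p X \<longleftrightarrow> (\<forall>e>0. \<exists>k. \<forall>m\<ge>k. \<forall>n\<ge>k. padic_abs p (X m - X n) < e)"

definition padic_null :: "nat \<Rightarrow> (nat \<Rightarrow> rat) \<Rightarrow> bool" where
  "padic_null p X \<longleftrightarrow> (\<lambda>n. padic_abs p (X n)) \<longlonglongrightarrow> 0"

definition padic_rel :: "nat \<Rightarrow> (nat \<Rightarrow> rat) \<Rightarrow> (nat \<Rightarrow> rat) \<Rightarrow> bool" where
  "padic_rel p X Y \<longleftrightarrow> padic_cauchy p X \<and> padic_cauchy p Y \<and> padic_null p (\<lambda>n. X n - Y n)"

context
  fixes p :: nat
  assumes p: "prime p"
begin

lemma padic_null_bound:
  assumes "\<And>n. padic_abs p (X n) \<le> f n" "f \<longlonglongrightarrow> 0"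
  shows "padic_null p X"
  unfolding padic_null_def
  by (rule tendsto_sandwich[OF _ _ tendsto_const assms(2)]) (auto simp: assms padic_abs_nonneg[OF p])

lemma padic_null_zero: "padic_null p (\<lambda>n. 0)"
  by (simp add: padic_null_def)

lemma padic_null_add: "padic_null p X \<Longrightarrow> padic_null p Y \<Longrightarrow> padic_null p (\<lambda>n. X n + Y n)"
  using tendsto_add[of "\<lambda>n. padic_abs p (X n)" 0 sequentially "\<lambda>n. padic_abs p (Y n)" 0]
  by (intro padic_null_bound[OF padic_abs_triangle[OF p]]) (simp add: padic_null_def)

lemma padic_null_minus: "padic_null p (\<lambda>n. - X n) \<longleftrightarrow> padic_null p X"
  by (simp add: padic_null_def padic_abs_minus[OF p])

lemma padic_null_commute: "padic_null p (\<lambda>n. X n - Y n) \<longleftrightarrow> padic_null p (\<lambda>n. Y n - X n)"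
  by (simp add: padic_null_def padic_abs_minus_commute[OF p])

lemma padic_null_cong_diff:
  assumes "padic_null p (\<lambda>n. X n - Y n)"
  shows "padic_null p X \<longleftrightarrow> padic_null p Y"
  using padic_null_add[of "\<lambda>n. X n - Y n" Y] padic_null_add[of "\<lambda>n. Y n - X n" X]
    assms padic_null_commute[of X Y] by auto

lemma padic_cauchyD:
  assumes "padic_cauchy p X" "e > 0"
  obtains k where "\<And>m n. m \<ge> k \<Longrightarrow> n \<ge> k \<Longrightarrow> padic_abs p (X m - X n) < e"
  using assms unfolding padic_cauchy_def by blast

lemma padic_cauchy_const: "padic_cauchy p (\<lambda>n. c)"
  by (simp add: padic_cauchy_def)

lemma padic_cauchy_add:
  assumes X: "padic_cauchy p X" and Y: "padic_cauchy p Y"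
  shows "padic_cauchy p (\<lambda>n. X n + Y n)"
  unfolding padic_cauchy_def
proof (intro allI impI)
  fix e :: real assume e: "e > 0"
  obtain k where k: "\<And>m n. m \<ge> k \<Longrightarrow> n \<ge> k \<Longrightarrow> padic_abs p (X m - X n) < e"
    using padic_cauchyD[OF X e] by blast
  obtain l where l: "\<And>m n. m \<ge> l \<Longrightarrow> n \<ge> l \<Longrightarrow> padic_abs p (Y m - Y n) < e"
    using padic_cauchyD[OF Y e] by blast
  have "padic_abs p (X m + Y m - (X n + Y n)) < e" if "m \<ge> max k l" "n \<ge> max k l" for m n
    using padic_abs_add_le_max[OF p, of "X m - X n" "Y m - Y n"] k[of m n] l[of m n] that
    by (simp add: algebra_simps)
  then show "\<exists>k. \<forall>m\<ge>k. \<forall>n\<ge>k. padic_abs p (X m + Y m - (X n + Y n)) < e" by blast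
qed

lemma padic_cauchy_minus: "padic_cauchy p X \<Longrightarrow> padic_cauchy p (\<lambda>n. - X n)"
  unfolding padic_cauchy_def
  by (simp add: padic_abs_minus_commute[OF p])

lemma padic_cauchy_abs_Cauchy:
  assumes "padic_cauchy p X" shows "Cauchy (\<lambda>n. padic_abs p (X n))"
proof (rule metric_CauchyI)
  fix e :: real assume "e > 0"
  then obtain k where k: "\<And>m n. m \<ge> k \<Longrightarrow> n \<ge> k \<Longrightarrow> padic_abs p (X m - X n) < e"
    using padic_cauchyD[OF assms] by blast
  have "dist (padic_abs p (X m)) (padic_abs p (X n)) < e" if "m \<ge> k" "n \<ge> k" for m n
    using padic_abs_triangle_rev[OF p, of "X m" "X n"] k[OF that] by (simp add: dist_real_def)
  then show "\<exists>M. \<forall>m\<ge>M. \<forall>n\<ge>M. dist (padic_abs p (X m)) (padic_abs p (X n)) < e" by blast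
qed

lemma padic_cauchy_abs_convergent:
  "padic_cauchy p X \<Longrightarrow> convergent (\<lambda>n. padic_abs p (X n))"
  using padic_cauchy_abs_Cauchy Cauchy_convergent_iff by blast

lemma padic_cauchy_bounded:
  assumes "padic_cauchy p X"
  obtains B where "B > 0" "\<And>n. padic_abs p (X n) \<le> B"
proof -
  have "Bseq (\<lambda>n. padic_abs p (X n))"
    using assms by (intro convergent_imp_Bseq padic_cauchy_abs_convergent)
  then obtain B where "B > 0" "\<And>n. norm (padic_abs p (X n)) \<le> B"
    by (auto elim: BseqE)
  with that show ?thesis by (metis abs_le_D1 real_norm_def)
qed

lemma padic_null_mult:
  assumes X: "padic_null p X" and Y: "padic_cauchy p Y"
  shows "padic_null p (\<lambda>n. X n * Y n)"
proof -
  obtain B where B: "B > 0" "\<And>n. padic_abs p (Y n) \<le> B"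
    using padic_cauchy_bounded[OF Y] by blast
  show ?thesis
  proof (rule padic_null_bound)
    show "padic_abs p (X n * Y n) \<le> padic_abs p (X n) * B" for n
      by (simp add: padic_abs_mult[OF p] mult_left_mono B padic_abs_nonneg[OF p])
    show "(\<lambda>n. padic_abs p (X n) * B) \<longlonglongrightarrow> 0"
      using X tendsto_mult_right[of "\<lambda>n. padic_abs p (X n)" 0 sequentially B]
      by (simp add: padic_null_def)
  qed
qed

lemma padic_cauchy_mult:
  assumes X: "padic_cauchy p X" and Y: "padic_cauchy p Y"
  shows "padic_cauchy p (\<lambda>n. X n * Y n)"
  unfolding padic_cauchy_def
proof (intro allI impI)
  fix e :: real assume e: "e > 0"
  obtain A where A: "A > 0" "\<And>n. padic_abs p (X n) \<le> A" using padic_cauchy_bounded[OF X] by blast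
  obtain B where B: "B > 0" "\<And>n. padic_abs p (Y n) \<le> B" using padic_cauchy_bounded[OF Y] by blast
  obtain k where k: "\<And>m n. m \<ge> k \<Longrightarrow> n \<ge> k \<Longrightarrow> padic_abs p (X m - X n) < e / B"
    using padic_cauchyD[OF X, of "e / B"] e B by auto
  obtain l where l: "\<And>m n. m \<ge> l \<Longrightarrow> n \<ge> l \<Longrightarrow> padic_abs p (Y m - Y n) < e / A"
    using padic_cauchyD[OF Y, of "e / A"] e A by auto
  have "padic_abs p (X m * Y m - X n * Y n) < e" if mn: "m \<ge> max k l" "n \<ge> max k l" for m n
  proof -
    have eq: "X m * Y m - X n * Y n = X m * (Y m - Y n) + (X m - X n) * Y n"
      by (simp add: algebra_simps)
    have "padic_abs p (X m * (Y m - Y n)) \<le> A * padic_abs p (Y m - Y n)"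
      by (simp add: padic_abs_mult[OF p] mult_right_mono A padic_abs_nonneg[OF p])
    also have "\<dots> < e" using l[of m n] mn A by (simp add: field_simps)
    finally have 1: "padic_abs p (X m * (Y m - Y n)) < e" .
    have "padic_abs p ((X m - X n) * Y n) \<le> padic_abs p (X m - X n) * B"
      by (simp add: padic_abs_mult[OF p] mult_left_mono B padic_abs_nonneg[OF p])
    also have "\<dots> < e" using k[of m n] mn B by (simp add: field_simps)
    finally have 2: "padic_abs p ((X m - X n) * Y n) < e" .
    show ?thesis unfolding eq
      using padic_abs_add_le_max[OF p, of "X m * (Y m - Y n)" "(X m - X n) * Y n"] 1 2 by linarith
  qed
  then show "\<exists>k. \<forall>m\<ge>k. \<forall>n\<ge>k. padic_abs p (X m * Y m - X n * Y n) < e" by blast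
qed

lemma padic_not_null_away:
  assumes X: "padic_cauchy p X" and nz: "\<not> padic_null p X"
  obtains b k where "b > 0" "\<And>n. n \<ge> k \<Longrightarrow> padic_abs p (X n) > b"
proof -
  obtain L where L: "(\<lambda>n. padic_abs p (X n)) \<longlonglongrightarrow> L"
    using padic_cauchy_abs_convergent[OF X] by (auto simp: convergent_def)
  have "L \<ge> 0" by (rule LIMSEQ_le_const[OF L]) (auto simp: padic_abs_nonneg[OF p])
  with nz L have "L > 0" by (cases "L = 0") (auto simp: padic_null_def)
  then have "eventually (\<lambda>n. padic_abs p (X n) > L / 2) sequentially"
    using L by (intro order_tendstoD) auto
  then obtain k where "\<And>n. n \<ge> k \<Longrightarrow> padic_abs p (X n) > L / 2"
    by (auto simp: eventually_sequentially)
  with that[of "L / 2" k] \<open>L > 0\<close> show ?thesis by simp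
qed

lemma padic_abs_inverse_diff:
  assumes "b > 0" "c > 0" "padic_abs p x > b" "padic_abs p y > c"
  shows "padic_abs p (inverse x - inverse y) \<le> padic_abs p (x - y) / (b * c)"
proof -
  have nz: "x \<noteq> 0" "y \<noteq> 0" using assms by auto
  have "padic_abs p (inverse x - inverse y) = padic_abs p ((y - x) * inverse x * inverse y)"
    using nz by (simp add: field_simps)
  also have "\<dots> = padic_abs p (x - y) / (padic_abs p x * padic_abs p y)"
    by (simp add: padic_abs_mult[OF p] padic_abs_inverse[OF p] padic_abs_minus_commute[OF p, of y x]
        divide_inverse)
  also have "\<dots> \<le> padic_abs p (x - y) / (b * c)"
    using assms by (intro divide_left_mono mult_mono mult_pos_pos)
      (auto simp: padic_abs_nonneg[OF p])
  finally show ?thesis .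
qed

lemma padic_cauchy_inverse:
  assumes X: "padic_cauchy p X" and nz: "\<not> padic_null p X"
  shows "padic_cauchy p (\<lambda>n. inverse (X n))"
  unfolding padic_cauchy_def
proof (intro allI impI)
  fix e :: real assume e: "e > 0"
  obtain b k where b: "b > 0" "\<And>n. n \<ge> k \<Longrightarrow> padic_abs p (X n) > b"
    using padic_not_null_away[OF X nz] by blast
  obtain l where l: "\<And>m n. m \<ge> l \<Longrightarrow> n \<ge> l \<Longrightarrow> padic_abs p (X m - X n) < e * (b * b)"
    using padic_cauchyD[OF X, of "e * (b * b)"] e b by auto
  have "padic_abs p (inverse (X m) - inverse (X n)) < e" if "m \<ge> max k l" "n \<ge> max k l" for m n
  proof -
    have "padic_abs p (X m - X n) / (b * b) < e"
      using l[of m n] that b by (simp add: divide_less_eq)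
    then show ?thesis
      using padic_abs_inverse_diff[of b b "X m" "X n"] b that by fastforce
  qed
  then show "\<exists>k. \<forall>m\<ge>k. \<forall>n\<ge>k. padic_abs p (inverse (X m) - inverse (X n)) < e" by blast
qed

lemma padic_null_inverse_diff:
  assumes X: "padic_cauchy p X" "\<not> padic_null p X"
    and Y: "padic_cauchy p Y" "\<not> padic_null p Y"
    and XY: "padic_null p (\<lambda>n. X n - Y n)"
  shows "padic_null p (\<lambda>n. inverse (X n) - inverse (Y n))"
proof -
  obtain b k where b: "b > 0" "\<And>n. n \<ge> k \<Longrightarrow> padic_abs p (X n) > b"
    using padic_not_null_away[OF X] by blast
  obtain c l where c: "c > 0" "\<And>n. n \<ge> l \<Longrightarrow> padic_abs p (Y n) > c"
    using padic_not_null_away[OF Y] by blast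
  have ev: "eventually (\<lambda>n. padic_abs p (inverse (X n) - inverse (Y n))
               \<le> padic_abs p (X n - Y n) / (b * c)) sequentially"
    unfolding eventually_sequentially
    by (intro exI[of _ "max k l"] allI impI padic_abs_inverse_diff b c) auto
  have "(\<lambda>n. padic_abs p (X n - Y n) / (b * c)) \<longlonglongrightarrow> 0"
    using XY b c unfolding padic_null_def by (auto intro: tendsto_divide_zero)
  then show ?thesis unfolding padic_null_def
    by (intro tendsto_sandwich[OF _ ev tendsto_const]) (auto simp: padic_abs_nonneg[OF p])
qed

lemma padic_rel_refl: "padic_cauchy p X \<Longrightarrow> padic_rel p X X"
  by (simp add: padic_rel_def padic_null_zero)

lemma padic_rel_self: "padic_rel p X X \<longleftrightarrow> padic_cauchy p X"
  by (simp add: padic_rel_def padic_null_zero)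

lemma part_equivp_padic_rel: "part_equivp (padic_rel p)"
proof (rule part_equivpI)
  show "\<exists>X. padic_rel p X X" using padic_rel_refl padic_cauchy_const by blast
  show "symp (padic_rel p)" 
    unfolding symp_def padic_rel_def using padic_null_commute by blast
  show "transp (padic_rel p)"
  proof (rule transpI)
    fix X Y Z assume "padic_rel p X Y" "padic_rel p Y Z"
    then show "padic_rel p X Z"
      using padic_null_add[of "\<lambda>n. X n - Y n" "\<lambda>n. Y n - Z n"] by (auto simp: padic_rel_def)
  qed
qed

end


section \<open>The field of p-adic numbers\<close>

text \<open>
  The prime is \<open>CARD('a)\<close>: \<open>'a padic\<close> is the completion of the rationals with respect to
  \<open>padic_abs CARD('a)\<close>, that is, Cauchy sequences modulo null sequences.
\<close>

typedef (overloaded) 'a padic =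
  "{c. \<exists>X. padic_cauchy CARD('a::prime_card) X \<and> c = Collect (padic_rel CARD('a) X)}"
  using padic_cauchy_const[OF prime_card] by blast

definition padic_of_seq :: "(nat \<Rightarrow> rat) \<Rightarrow> 'a::prime_card padic" where
  "padic_of_seq X = Abs_padic (Collect (padic_rel CARD('a) X))"

definition seq_of_padic :: "'a::prime_card padic \<Rightarrow> nat \<Rightarrow> rat" where
  "seq_of_padic x = (SOME X. X \<in> Rep_padic x)"

definition cr_padic :: "(nat \<Rightarrow> rat) \<Rightarrow> 'a::prime_card padic \<Rightarrow> bool" where
  "cr_padic X x \<longleftrightarrow> padic_rel CARD('a) X X \<and> padic_of_seq X = x"

lemma Quotient_padic:
  "Quotient (padic_rel CARD('a::prime_card)) padic_of_seq seq_of_padic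
     (cr_padic :: _ \<Rightarrow> 'a padic \<Rightarrow> bool)"
proof -
  have sym: "padic_rel CARD('a) Y X" if "padic_rel CARD('a) X Y" for X Y
    using that part_equivp_symp[OF part_equivp_padic_rel[OF prime_card[where 'a='a]]] by blast
  have trans: "padic_rel CARD('a) X Z" if "padic_rel CARD('a) X Y" "padic_rel CARD('a) Y Z" for X Y Z
    using that part_equivp_transp[OF part_equivp_padic_rel[OF prime_card[where 'a='a]]] by blast
  have refl: "padic_rel CARD('a) X X \<longleftrightarrow> padic_cauchy CARD('a) X" for X
    by (rule padic_rel_self[OF prime_card])
  have rep: "padic_rel CARD('a) (seq_of_padic x) (seq_of_padic x) \<and>
      Rep_padic x = Collect (padic_rel CARD('a) (seq_of_padic x))" for x :: "'a padic"
  proof -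
    obtain X where X: "padic_cauchy CARD('a) X" "Rep_padic x = Collect (padic_rel CARD('a) X)"
      using Rep_padic[of x] by blast
    then have "X \<in> Rep_padic x" by (simp add: refl)
    then have "seq_of_padic x \<in> Rep_padic x" unfolding seq_of_padic_def
      by (rule someI[where P = "\<lambda>X. X \<in> Rep_padic x"])
    with X have "padic_rel CARD('a) X (seq_of_padic x)" by simp
    then show ?thesis using X sym trans by blast
  qed
  have abs: "padic_of_seq X = (padic_of_seq Y :: 'a padic) \<longleftrightarrow> padic_rel CARD('a) X Y"
    if "padic_rel CARD('a) X X" "padic_rel CARD('a) Y Y" for X Y
  proof -
    have "padic_of_seq X = (padic_of_seq Y :: 'a padic) \<longleftrightarrow>
        Collect (padic_rel CARD('a) X) = Collect (padic_rel CARD('a) Y)"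
      unfolding padic_of_seq_def using that by (intro Abs_padic_inject) (auto simp: refl)
    then show ?thesis using that sym trans by blast
  qed
  show ?thesis
    unfolding Quotient_alt_def
  proof (intro conjI allI impI)
    show "cr_padic (seq_of_padic b) b" for b :: "'a padic"
      using rep[of b] Rep_padic_inverse[of b] by (simp add: cr_padic_def padic_of_seq_def)
    show "padic_rel CARD('a) X Y \<longleftrightarrow>
        cr_padic X (padic_of_seq X :: 'a padic) \<and> cr_padic Y (padic_of_seq Y :: 'a padic) \<and>
        padic_of_seq X = (padic_of_seq Y :: 'a padic)" for X Y
      unfolding cr_padic_def using abs[of X Y] sym[of X Y] trans[of X Y X] trans[of Y X Y] by blast
  qed (simp add: cr_padic_def)
qed

setup_lifting Quotient_padic

instantiation padic :: (prime_card) field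
begin

lift_definition zero_padic :: "'a padic" is "\<lambda>n. 0"
  by (simp add: padic_rel_self prime_card padic_cauchy_const)

lift_definition one_padic :: "'a padic" is "\<lambda>n. 1"
  by (simp add: padic_rel_self prime_card padic_cauchy_const)

lift_definition plus_padic :: "'a padic \<Rightarrow> 'a padic \<Rightarrow> 'a padic" is "\<lambda>X Y n. X n + Y n"
proof -
  fix X X' Y Y' :: "nat \<Rightarrow> rat"
  assume "padic_rel CARD('a) X X'" "padic_rel CARD('a) Y Y'"
  then show "padic_rel CARD('a) (\<lambda>n. X n + Y n) (\<lambda>n. X' n + Y' n)"
    using padic_null_add[OF prime_card[where 'a='a], of "\<lambda>n. X n - X' n" "\<lambda>n. Y n - Y' n"]
    by (auto simp: padic_rel_def padic_cauchy_add[OF prime_card] algebra_simps)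
qed

lift_definition uminus_padic :: "'a padic \<Rightarrow> 'a padic" is "\<lambda>X n. - X n"
proof -
  fix X Y :: "nat \<Rightarrow> rat"
  assume "padic_rel CARD('a) X Y"
  then show "padic_rel CARD('a) (\<lambda>n. - X n) (\<lambda>n. - Y n)"
    using padic_null_commute[OF prime_card[where 'a='a], of X Y]
    by (auto simp: padic_rel_def padic_cauchy_minus[OF prime_card])
qed

lift_definition times_padic :: "'a padic \<Rightarrow> 'a padic \<Rightarrow> 'a padic" is "\<lambda>X Y n. X n * Y n"
proof -
  fix X X' Y Y' :: "nat \<Rightarrow> rat"
  assume *: "padic_rel CARD('a) X X'" "padic_rel CARD('a) Y Y'"
  have "padic_null CARD('a) (\<lambda>n. (X n - X' n) * Y n + (Y n - Y' n) * X' n)"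
    using * by (intro padic_null_add padic_null_mult prime_card) (auto simp: padic_rel_def)
  then have "padic_null CARD('a) (\<lambda>n. X n * Y n - X' n * Y' n)"
    by (simp add: algebra_simps)
  with * show "padic_rel CARD('a) (\<lambda>n. X n * Y n) (\<lambda>n. X' n * Y' n)"
    by (auto simp: padic_rel_def padic_cauchy_mult[OF prime_card])
qed

lift_definition inverse_padic :: "'a padic \<Rightarrow> 'a padic"
  is "\<lambda>X. if padic_null CARD('a) X then (\<lambda>n. 0) else (\<lambda>n. inverse (X n))"
proof -
  fix X Y :: "nat \<Rightarrow> rat"
  assume *: "padic_rel CARD('a) X Y"
  then have eq: "padic_null CARD('a) X \<longleftrightarrow> padic_null CARD('a) Y"
    by (intro padic_null_cong_diff[OF prime_card]) (auto simp: padic_rel_def)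
  show "padic_rel CARD('a)
      (if padic_null CARD('a) X then (\<lambda>n. 0) else (\<lambda>n. inverse (X n)))
      (if padic_null CARD('a) Y then (\<lambda>n. 0) else (\<lambda>n. inverse (Y n)))"
    using * eq
    by (auto simp: padic_rel_def padic_cauchy_const[OF prime_card] padic_null_zero[OF prime_card]
        padic_cauchy_inverse[OF prime_card] padic_null_inverse_diff[OF prime_card])
qed

definition minus_padic :: "'a padic \<Rightarrow> 'a padic \<Rightarrow> 'a padic" where
  "x - y = x + - y" for x y :: "'a padic"

definition divide_padic :: "'a padic \<Rightarrow> 'a padic \<Rightarrow> 'a padic" where
  "x div y = x * inverse y" for x y :: "'a padic"

instance
proof
  fix a b c :: "'a padic"
  note [simp] = padic_rel_self[OF prime_card] padic_cauchy_add[OF prime_card]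
    padic_cauchy_mult[OF prime_card] padic_cauchy_const[OF prime_card]
    padic_cauchy_minus[OF prime_card]
  show "a + b = b + a" by transfer (simp add: add.commute)
  show "(a + b) + c = a + (b + c)" by transfer (simp add: add.assoc)
  show "0 + a = a" by transfer simp
  show "- a + a = 0" by transfer simp
  show "a - b = a + - b" by (rule minus_padic_def)
  show "(a * b) * c = a * (b * c)" by transfer (simp add: mult.assoc)
  show "a * b = b * a" by transfer (simp add: mult.commute)
  show "1 * a = a" by transfer simp
  show "(a + b) * c = a * c + b * c" by transfer (simp add: distrib_right)
  show "(0::'a padic) \<noteq> 1"
    by transfer (simp add: padic_rel_def padic_null_def padic_abs_minus[OF prime_card]
        padic_abs_1[OF prime_card] LIMSEQ_const_iff)
  have "padic_null CARD('a) (\<lambda>n. inverse (X n) * X n - 1)"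
    if X: "padic_cauchy CARD('a) X" "\<not> padic_null CARD('a) X" for X
  proof -
    obtain b k where bk: "b > 0" "\<And>n. n \<ge> k \<Longrightarrow> padic_abs CARD('a) (X n) > b"
      using padic_not_null_away[OF prime_card X] by blast
    have "padic_abs CARD('a) (inverse (X n) * X n - 1) = 0" if "n \<ge> k" for n
      using bk(1) bk(2)[OF that] by (cases "X n = 0") auto
    then show ?thesis unfolding padic_null_def
      by (intro tendsto_eventually) (auto simp: eventually_sequentially)
  qed
  then show "a \<noteq> 0 \<Longrightarrow> inverse a * a = 1"
    by transfer (auto simp: padic_rel_def padic_cauchy_inverse[OF prime_card]
        padic_cauchy_mult[OF prime_card] padic_cauchy_const[OF prime_card])
  show "a div b = a * inverse b" by (rule divide_padic_def)
  show "inverse (0::'a padic) = 0"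
    by transfer (simp add: padic_null_zero[OF prime_card])
qed

end

lift_definition padic_norm :: "'p::prime_card padic \<Rightarrow> real"
  is "\<lambda>X. lim (\<lambda>n. padic_abs CARD('p) (X n))"
proof -
  fix X Y :: "nat \<Rightarrow> rat"
  assume *: "padic_rel CARD('p) X Y"
  obtain L where L: "(\<lambda>n. padic_abs CARD('p) (X n)) \<longlonglongrightarrow> L"
    using * padic_cauchy_abs_convergent[OF prime_card] by (auto simp: padic_rel_def convergent_def)
  have "(\<lambda>n. padic_abs CARD('p) (X n) - padic_abs CARD('p) (Y n)) \<longlonglongrightarrow> 0"
  proof (rule Lim_null_comparison)
    show "\<forall>\<^sub>F n in sequentially. norm (padic_abs CARD('p) (X n) - padic_abs CARD('p) (Y n))
        \<le> padic_abs CARD('p) (X n - Y n)"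
      by (simp add: padic_abs_triangle_rev[OF prime_card])
    show "(\<lambda>n. padic_abs CARD('p) (X n - Y n)) \<longlonglongrightarrow> 0"
      using * by (simp add: padic_rel_def padic_null_def)
  qed
  from tendsto_diff[OF L this] have "(\<lambda>n. padic_abs CARD('p) (Y n)) \<longlonglongrightarrow> L" by simp
  with L show "lim (\<lambda>n. padic_abs CARD('p) (X n)) = lim (\<lambda>n. padic_abs CARD('p) (Y n))"
    by (simp add: limI)
qed

lemma padic_norm_LIMSEQ:
  assumes "padic_cauchy CARD('p::prime_card) X"
  shows "(\<lambda>n. padic_abs CARD('p) (X n)) \<longlonglongrightarrow> lim (\<lambda>n. padic_abs CARD('p) (X n))"
  using padic_cauchy_abs_convergent[OF prime_card assms] by (simp add: convergent_LIMSEQ_iff)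

lemma padic_norm_nonneg: "padic_norm x \<ge> 0"
proof (transfer, unfold padic_rel_self[OF prime_card])
  fix X assume X: "padic_cauchy CARD('a) X"
  show "0 \<le> lim (\<lambda>n. padic_abs CARD('a) (X n))"
    by (rule LIMSEQ_le_const[OF padic_norm_LIMSEQ[OF X]]) (auto simp: padic_abs_nonneg[OF prime_card])
qed

lemma padic_norm_eq_0: "padic_norm x = 0 \<longleftrightarrow> x = 0"
proof (transfer, unfold padic_rel_self[OF prime_card])
  fix X assume X: "padic_cauchy CARD('a) X"
  have eq: "padic_rel CARD('a) X (\<lambda>n. 0) \<longleftrightarrow> (\<lambda>n. padic_abs CARD('a) (X n)) \<longlonglongrightarrow> 0"
    using X by (simp add: padic_rel_def padic_null_def padic_cauchy_const[OF prime_card])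
  show "(lim (\<lambda>n. padic_abs CARD('a) (X n)) = 0) = padic_rel CARD('a) X (\<lambda>n. 0)"
    unfolding eq
  proof
    assume "lim (\<lambda>n. padic_abs CARD('a) (X n)) = 0"
    then show "(\<lambda>n. padic_abs CARD('a) (X n)) \<longlonglongrightarrow> 0"
      using padic_norm_LIMSEQ[OF X] by metis
  next
    assume "(\<lambda>n. padic_abs CARD('a) (X n)) \<longlonglongrightarrow> 0"
    then show "lim (\<lambda>n. padic_abs CARD('a) (X n)) = 0" by (rule limI)
  qed
qed

lemma padic_norm_mult: "padic_norm (x * y) = padic_norm x * padic_norm y"
proof (transfer, unfold padic_rel_self[OF prime_card])
  fix X Y assume "padic_cauchy CARD('a) X" "padic_cauchy CARD('a) Y"
  from tendsto_mult[OF this[THEN padic_norm_LIMSEQ]]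
  show "lim (\<lambda>n. padic_abs CARD('a) (X n * Y n)) =
      lim (\<lambda>n. padic_abs CARD('a) (X n)) * lim (\<lambda>n. padic_abs CARD('a) (Y n))"
    by (simp add: padic_abs_mult[OF prime_card] limI)
qed

lemma padic_norm_minus: "padic_norm (- x) = padic_norm x"
  by transfer (simp add: padic_abs_minus[OF prime_card])

lemma padic_norm_add_le_max: "padic_norm (x + y) \<le> max (padic_norm x) (padic_norm y)"
proof (transfer, unfold padic_rel_self[OF prime_card])
  fix X Y assume X: "padic_cauchy CARD('a) X" and Y: "padic_cauchy CARD('a) Y"
  show "lim (\<lambda>n. padic_abs CARD('a) (X n + Y n)) \<le>
      max (lim (\<lambda>n. padic_abs CARD('a) (X n))) (lim (\<lambda>n. padic_abs CARD('a) (Y n)))"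
    by (rule LIMSEQ_le[OF padic_norm_LIMSEQ[OF padic_cauchy_add[OF prime_card X Y]]
          tendsto_max[OF padic_norm_LIMSEQ[OF X] padic_norm_LIMSEQ[OF Y]]])
       (auto intro: padic_abs_add_le_max[OF prime_card])
qed

instantiation padic :: (prime_card) metric_space
begin

definition dist_padic :: "'a padic \<Rightarrow> 'a padic \<Rightarrow> real" where
  "dist_padic x y = padic_norm (x - y)"

definition uniformity_padic :: "('a padic \<times> 'a padic) filter" where
  "uniformity_padic = (INF e\<in>{0 <..}. principal {(x, y). dist x y < e})"

definition open_padic :: "'a padic set \<Rightarrow> bool" where
  "open_padic U \<longleftrightarrow> (\<forall>x\<in>U. eventually (\<lambda>(x', y). x' = x \<longrightarrow> y \<in> U) uniformity)"

instance
proof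
  fix x y z :: "'a padic"
  show "dist x y = 0 \<longleftrightarrow> x = y" by (simp add: dist_padic_def padic_norm_eq_0)
  show "dist x y \<le> dist x z + dist y z"
    using padic_norm_add_le_max[of "x - z" "z - y"] padic_norm_minus[of "y - z"]
      padic_norm_nonneg[of "x - z"] padic_norm_nonneg[of "y - z"]
    by (simp add: dist_padic_def)
qed (simp_all add: uniformity_padic_def open_padic_def)

end


section \<open>Balls and additive characters\<close>

definition real_ball :: "real \<Rightarrow> (real ^ 'm) set" where
  "real_ball r = {x. norm x \<le> r}"

text \<open>
  The library's metric on \<open>'p padic ^ 'm\<close> is the Euclidean combination of the coordinate distances.
  It is equivalent to the maximum used here, so both induce the product topology.
\<close>

definition padic_ball :: "real \<Rightarrow> ('p::prime_card padic ^ 'm) set" where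
  "padic_ball r = {x. Max (range (\<lambda>i. padic_norm (x $ i))) \<le> r}"

definition real_char :: "real \<Rightarrow> complex" where
  "real_char x = exp (2 * of_real pi * \<i> * of_real x)"

text \<open>
  \<open>padic_exponent x\<close> and \<open>padic_numerator x\<close> are \<open>n\<^sub>x\<close> and \<open>r\<^sub>x\<close>. A congruence modulo \<open>p\<^sup>n\<close>
  between p-adic integers means that their difference has absolute value at most \<open>1/p\<^sup>n\<close>.
\<close>

definition padic_exponent :: "'p::prime_card padic \<Rightarrow> nat" where
  "padic_exponent x = (LEAST n. padic_norm (of_nat CARD('p) ^ n * x) \<le> 1)"

definition padic_numerator :: "'p::prime_card padic \<Rightarrow> int" where
  "padic_numerator x = (SOME r. padic_norm (of_int r - of_nat CARD('p) ^ padic_exponent x * x)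
                                  \<le> 1 / real CARD('p) ^ padic_exponent x)"

lemma padic_of_int_seq: "(of_int k :: 'p::prime_card padic) = padic_of_seq (\<lambda>_. of_int k)"
proof -
  note [simp] = padic_rel_self[OF prime_card] padic_cauchy_const[OF prime_card]
  have nat: "(of_nat n :: 'p padic) = padic_of_seq (\<lambda>_. of_nat n)" for n
    by (induction n) (simp_all add: zero_padic.abs_eq one_padic.abs_eq plus_padic.abs_eq)
  show ?thesis
    by (cases k rule: int_cases2) (simp_all add: nat uminus_padic.abs_eq)
qed

lemma padic_norm_of_int: "padic_norm (of_int k :: 'p::prime_card padic) = padic_abs CARD('p) (of_int k)"
  by (simp add: padic_of_int_seq padic_norm.abs_eq padic_rel_self[OF prime_card]
      padic_cauchy_const[OF prime_card])

lemma padic_norm_prime_power: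
  "padic_norm (of_nat CARD('p) ^ n :: 'p::prime_card padic) = 1 / real CARD('p) ^ n"
proof -
  have "multiplicity (int CARD('p)) (int CARD('p) ^ n) = n"
    using prime_card[where 'a='p] prime_gt_1_nat[OF prime_card[where 'a='p]]
    by (intro multiplicity_same_power) (auto simp: not_prime_unit)
  then show ?thesis
    using padic_norm_of_int[where 'p='p, of "int CARD('p) ^ n"]
      padic_abs_int[OF prime_card[where 'a='p], of "int CARD('p) ^ n"]
      prime_gt_1_nat[OF prime_card[where 'a='p]]
    by (simp add: power_int_minus inverse_eq_divide)
qed

lemma padic_exponent_exists: "\<exists>n. padic_norm (of_nat CARD('p) ^ n * x) \<le> 1"
  for x :: "'p::prime_card padic"
proof -
  have p1: "real CARD('p) > 1" using prime_gt_1_nat[OF prime_card[where 'a='p]] by simp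
  then obtain n where "padic_norm x < real CARD('p) ^ n" using real_arch_pow by blast
  then show ?thesis using p1
    by (intro exI[of _ n]) (simp add: padic_norm_mult padic_norm_prime_power field_simps)
qed

lemma padic_int_approx_rat:
  assumes p: "prime p" and q: "padic_abs p q \<le> 1"
  shows "\<exists>c::int. padic_abs p (q - of_int c) \<le> 1 / real p ^ n"
proof (cases "q = 0")
  case True
  then show ?thesis by (intro exI[of _ 0]) simp
next
  case False
  have p1: "real p > 1" using prime_gt_1_nat[OF p] by simp
  obtain a b where ab: "quotient_of q = (a, b)" by force
  have b: "b > 0" and cop: "coprime a b" and qab: "q = of_int a / of_int b"
    using quotient_of_denom_pos[OF ab] quotient_of_coprime[OF ab] quotient_of_div[OF ab] by auto
  have a: "a \<noteq> 0" using False qab by auto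
  have pp: "prime (int p)" using p by simp
  have "real p powi (int (multiplicity (int p) b) - int (multiplicity (int p) a)) \<le> real p powi 0"
    using q padic_abs_frac[OF p a, of b] b qab by simp
  then have "multiplicity (int p) b \<le> multiplicity (int p) a"
    using p1 by (smt (verit) power_int_strict_increasing nat_int_comparison(3))
  moreover have "\<not> (int p dvd a \<and> int p dvd b)"
    using cop pp by (meson coprime_common_divisor not_prime_unit)
  ultimately have ndvd: "\<not> int p dvd b"
    using a b pp
    by (metis dvd_refl multiplicity_eq_zero_iff not_prime_unit le_zero_eq not_dvd_imp_multiplicity_0
        less_irrefl)
  then have "coprime b (int p ^ n)"
    using pp prime_imp_coprime[OF pp ndvd] by (simp add: coprime_commute)
  then obtain d where d: "[b * d = 1] (mod (int p ^ n))"
    using cong_solve_coprime_int by blast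
  define c where "c = d * a"
  have "[b * d * a = 1 * a] (mod (int p ^ n))" using d by (rule cong_scalar_right)
  then have dv: "int p ^ n dvd a - b * c"
    by (simp add: c_def cong_iff_dvd_diff dvd_diff_commute mult.assoc)
  have eq: "q - of_int c = of_int (a - b * c) / of_int b"
    using b qab by (simp add: field_simps)
  show ?thesis
  proof (cases "a - b * c = 0")
    case True
    then have "q - of_int c = 0" using eq by simp
    then show ?thesis by (intro exI[of _ c]) simp
  next
    case nz: False
    have m0: "multiplicity (int p) b = 0" using ndvd by (rule not_dvd_imp_multiplicity_0)
    have mn: "n \<le> multiplicity (int p) (a - b * c)"
      using dv nz pp by (intro multiplicity_geI) (auto simp: not_prime_unit)
    have "padic_abs p (q - of_int c) \<le> real p powi (- int n)"
      unfolding eq using b nz mn m0 p1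
      by (subst padic_abs_frac[OF p]) (auto intro!: power_int_increasing)
    then show ?thesis
      by (intro exI[of _ c]) (simp add: power_int_minus inverse_eq_divide)
  qed
qed

lemma padic_int_approx:
  assumes "padic_norm (y :: 'p::prime_card padic) \<le> 1"
  shows "\<exists>r::int. padic_norm (of_int r - y) \<le> 1 / real CARD('p) ^ n"
proof -
  note p = prime_card[where 'a='p]
  note [simp] = padic_rel_self[OF p] padic_cauchy_const[OF p]
  let ?e = "1 / real CARD('p) ^ n"
  have p1: "real CARD('p) > 1" using prime_gt_1_nat[OF p] by simp
  have e: "?e > 0" "?e \<le> 1" using p1 by auto
  obtain X where X: "padic_cauchy CARD('p) X" "y = padic_of_seq X"
    using padic.abs_induct[of "\<lambda>y. \<exists>X. padic_cauchy CARD('p) X \<and> y = padic_of_seq X" y] by auto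
  obtain k where k: "\<And>m l. m \<ge> k \<Longrightarrow> l \<ge> k \<Longrightarrow> padic_abs CARD('p) (X m - X l) < ?e"
    using padic_cauchyD[OF p X(1) e(1)] by blast
  define q where "q = X k"
  have norm_diff: "padic_norm (y - padic_of_seq (\<lambda>_. s)) = lim (\<lambda>m. padic_abs CARD('p) (X m - s))"
    and lim_diff: "(\<lambda>m. padic_abs CARD('p) (X m - s)) \<longlonglongrightarrow> padic_norm (y - padic_of_seq (\<lambda>_. s))" for s
  proof -
    have c: "padic_cauchy CARD('p) (\<lambda>m. X m - s)"
      using padic_cauchy_add[OF p X(1) padic_cauchy_const[OF p, of "-s"]] by simp
    have "y - padic_of_seq (\<lambda>_. s) = padic_of_seq (\<lambda>m. X m - s)"
      using X by (simp add: minus_padic_def uminus_padic.abs_eq plus_padic.abs_eq)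
    then show "padic_norm (y - padic_of_seq (\<lambda>_. s)) = lim (\<lambda>m. padic_abs CARD('p) (X m - s))"
      using c by (simp add: padic_norm.abs_eq)
    with padic_norm_LIMSEQ[OF c]
    show "(\<lambda>m. padic_abs CARD('p) (X m - s)) \<longlonglongrightarrow> padic_norm (y - padic_of_seq (\<lambda>_. s))" by simp
  qed
  have yq: "padic_norm (y - padic_of_seq (\<lambda>_. q)) \<le> ?e"
    using lim_diff by (rule LIMSEQ_le_const2) (auto intro!: exI[of _ k] less_imp_le k simp: q_def)
  have "padic_norm (padic_of_seq (\<lambda>_. q) :: 'p padic) \<le>
      max (padic_norm (padic_of_seq (\<lambda>_. q) - y)) (padic_norm y)"
    using padic_norm_add_le_max[of "padic_of_seq (\<lambda>_. q) - y" y] by simp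
  also have "\<dots> \<le> 1"
    using order_trans[OF yq e(2)] assms padic_norm_minus[of "y - padic_of_seq (\<lambda>_. q)"] by simp
  finally have "padic_abs CARD('p) q \<le> 1" by (simp add: padic_norm.abs_eq)
  from padic_int_approx_rat[OF p this] obtain c where c: "padic_abs CARD('p) (q - of_int c) \<le> ?e" by blast
  have "padic_abs CARD('p) (X m - of_int c) \<le> ?e" if "m \<ge> k" for m
    using padic_abs_add_le_max[OF p, of "X m - q" "q - of_int c"] c k[of m k] that
    by (simp add: q_def)
  then have "padic_norm (y - of_int c) \<le> ?e"
    unfolding padic_of_int_seq by (intro LIMSEQ_le_const2[OF lim_diff]) auto
  then show ?thesis using padic_norm_minus[of "y - of_int c"] by (intro exI[of _ c]) simp
qed

text \<open>Hence \<open>padic_exponent\<close> and \<open>padic_numerator\<close> do what they say.\<close>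

lemma padic_exponent_norm: "padic_norm (of_nat CARD('p) ^ padic_exponent x * x) \<le> 1"
  for x :: "'p::prime_card padic"
  unfolding padic_exponent_def using padic_exponent_exists by (rule LeastI_ex)

lemma padic_numerator_norm:
  "padic_norm (of_int (padic_numerator x) - of_nat CARD('p) ^ padic_exponent x * x)
     \<le> 1 / real CARD('p) ^ padic_exponent x"
  for x :: "'p::prime_card padic"
  unfolding padic_numerator_def
  by (rule someI_ex[OF padic_int_approx[OF padic_exponent_norm]])

definition padic_char :: "'p::prime_card padic \<Rightarrow> complex" where
  "padic_char x = exp (2 * of_real pi * \<i> * of_int (padic_numerator x)
                         / of_nat CARD('p) ^ padic_exponent x)"


section \<open>Measures\<close>

text \<open>
  On the second countable locally compact groups considered here, a Borel measure that is
  finite on compact sets is automatically regular. Haar measure is determined up to a positive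
  factor, which cancels in \<open>upper_density\<close> below.
\<close>

definition haar_measure :: "'v::{topological_space,plus} measure \<Rightarrow> bool" where
  "haar_measure M \<longleftrightarrow>
     sets M = sets borel \<and>
     (\<forall>x. \<forall>E\<in>sets borel. emeasure M ((+) x ` E) = emeasure M E) \<and>
     (\<forall>C. compact C \<longrightarrow> emeasure M C < \<infinity>) \<and>
     (\<forall>U. open U \<longrightarrow> U \<noteq> {} \<longrightarrow> emeasure M U > 0)"

lemma haar_measure_lborel: "haar_measure (lborel :: 'v::euclidean_space measure)"
  unfolding haar_measure_def
proof (intro conjI allI ballI impI)
  fix x :: 'v and E :: "'v set" assume E: "E \<in> sets borel"
  have "(+) x ` E = (+) (- x) -` E"
    by (auto simp: image_iff) (metis add.commute diff_add_cancel uminus_add_conv_diff)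
  moreover have "emeasure lborel E = emeasure (distr lborel borel ((+) (- x))) E"
    by (simp only: lborel_distr_plus)
  ultimately show "emeasure lborel ((+) x ` E) = emeasure lborel E"
    using E by (simp add: emeasure_distr)
next
  fix C :: "'v set" assume "compact C"
  then show "emeasure lborel C < \<infinity>"
    using emeasure_bounded_finite[OF compact_imp_bounded] by auto
next
  fix U :: "'v set" assume U: "open U" "U \<noteq> {}"
  then obtain x e where "e > 0" "ball x e \<subseteq> U" by (meson ex_in_conv openE)
  moreover then have "emeasure lborel (ball x e) > 0"
    using content_ball_pos[of e x]
    by (metis enn2real_0 measure_def order_less_irrefl not_gr_zero)
  ultimately show "emeasure lborel U > 0"
    using U emeasure_mono[of "ball x e" U lborel] by (auto intro: less_le_trans)
qed simp

definition measure_support :: "'v::topological_space measure \<Rightarrow> 'v set" where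
  "measure_support \<mu> = {x. \<forall>U. open U \<longrightarrow> x \<in> U \<longrightarrow> emeasure \<mu> U > 0}"

definition symmetric_measure :: "'v::uminus measure \<Rightarrow> bool" where
  "symmetric_measure \<mu> \<longleftrightarrow> (\<forall>E\<in>sets \<mu>. emeasure \<mu> (uminus ` E) = emeasure \<mu> E)"

text \<open>The transform of a symmetric measure is real-valued; infima of it are taken over its real part.\<close>

definition fourier :: "('k::comm_ring_1 \<Rightarrow> complex) \<Rightarrow> ('k ^ 'm) measure \<Rightarrow> 'k ^ 'm \<Rightarrow> complex" where
  "fourier \<psi> \<mu> u = (\<integral>x. cnj (\<psi> (\<Sum>i\<in>UNIV. x $ i * u $ i)) \<partial>\<mu>)"


section \<open>Cayley graphs and upper density\<close>

text \<open>A graph is given by its set of ordered pairs of adjacent vertices.\<close>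

definition cayley_graph :: "'v::minus set \<Rightarrow> ('v \<times> 'v) set" where
  "cayley_graph S = {(x, y). x - y \<in> S}"

definition independent_set :: "('v::topological_space \<times> 'v) set \<Rightarrow> 'v set \<Rightarrow> bool" where
  "independent_set G I \<longleftrightarrow> I \<in> sets borel \<and> (\<forall>x\<in>I. \<forall>y\<in>I. (x, y) \<notin> G)"

definition upper_density :: "'v measure \<Rightarrow> (real \<Rightarrow> 'v set) \<Rightarrow> 'v set \<Rightarrow> ereal" where
  "upper_density M B I = Limsup at_top (\<lambda>r. ereal (measure M (I \<inter> B r) / measure M (B r)))"

definition alpha_bar ::
  "'v::topological_space measure \<Rightarrow> (real \<Rightarrow> 'v set) \<Rightarrow> ('v \<times> 'v) set \<Rightarrow> ereal" where
  "alpha_bar M B G = (SUP I\<in>{I. independent_set G I}. upper_density M B I)"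

end

theory Submission
  imports Defs
begin

text \<open>
  Let \<open>l\<close> be the infimum of the transform of \<open>\<mu>\<close>. For real \<open>g\<close> that is bounded and of bounded
  support, with autocorrelation \<open>f x = \<integral> g y * g (y + x) dy\<close>, the key inequality is
  \<open>l * f 0 \<le> \<integral> f d\<mu>\<close>. No Plancherel theorem is needed for it: for a probability measure \<open>\<nu>\<close> on the
  dual side, Fubini turns \<open>\<integral> |G|\<^sup>2 (Re M - l) d\<nu> \<ge> 0\<close>, where \<open>G\<close> and \<open>M\<close> are the transforms of \<open>g\<close>
  and \<open>\<mu>\<close>, into an inequality between integrals of \<open>f\<close> against the transform of \<open>\<nu>\<close>, and the
  \<open>\<nu>\<close> can be chosen so that these transforms form an approximate identity (wide Gaussians on
  \<open>\<real>\<^sup>m\<close>, normalised Haar measure of large balls on \<open>\<rat>\<^sub>p\<^sup>m\<close>).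

  An independent set \<open>I\<close> of density \<open>d\<close> in a large ball \<open>B\<close> is tested with \<open>g = 1\<^sub>A - d 1\<^sub>B\<close>,
  \<open>A = I \<inter> B\<close>. Then \<open>f 0 = |B| (d - d\<^sup>2)\<close>, and on the bounded set \<open>S\<close> independence gives
  \<open>f \<le> |B| (- d\<^sup>2 + o(1))\<close>, whence \<open>d \<le> - l / (1 - l) + o(1)\<close>. That \<open>l \<le> 0\<close> follows from the same
  inequality for the indicator of a small ball \<open>A\<close> with \<open>A - A\<close> disjoint from \<open>S\<close>.
\<close>

section \<open>Topology of coordinate spaces\<close>

text \<open>Subtracting \<open>d 1\<^sub>B\<close> is what yields a density bound. The constant part
  of \<open>1\<^sub>A\<close> sits at frequency 0, where the transform of \<open>\<mu>\<close> is 1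
  and the lower bound \<open>l\<close> is wasteful. With \<open>g = 1\<^sub>A\<close> alone the key
  inequality only says \<open>l |A| \<le> 0\<close>; with the mean removed it reads
  \<open>l (d - d\<^sup>2) \<le> - d\<^sup>2 + o(1)\<close> and can be divided by \<open>d\<close>.
  All repeated integrals are taken against finite measures: \<open>\<mu>\<close>,
  \<open>\<nu>\<close>, or Haar measure restricted to a bounded set. Fubini then only asks for
  bounded integrands. Accordingly the transform of \<open>\<nu>\<close> has to concentrate only
  within a compact set holding all differences that occur. The two fields differ in the approximate
  identity and in the part of \<open>B\<close> that a translation by an element of \<open>S\<close>
  moves out of \<open>B\<close>. Over the reals that part lies in a shell of relative size tending
  to 0; over the p-adic numbers it is empty, because balls are subgroups. Haar measure is arbitrary,
  so the size of the real shell requires a comparison with Lebesgue measure.\<close>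

instance vec :: ("{metric_space, second_countable_topology}", finite) second_countable_topology
proof
  obtain B :: "'a set set" where B: "countable B" "topological_basis B"
    using ex_countable_basis by blast
  \<comment> \<open>Boxes with sides in \<open>B\<close>; there are countably many because the index
    type is finite.\<close>
  define C where "C = (\<lambda>A. {x :: 'a ^ 'b. \<forall>i. x $ i \<in> A i}) ` (Pi\<^sub>E UNIV (\<lambda>_. B))"
  have "topological_basis C"
  proof (rule topological_basisI)
    fix U assume "U \<in> C"
    then obtain A where A: "\<And>i. A i \<in> B" "U = {x. \<forall>i. x $ i \<in> A i}"
      unfolding C_def by (auto simp: PiE_def Pi_def intro: that)
    then show "open U"
      unfolding open_vec_def using topological_basis_open[OF B(2)] by blast
  next
    fix U :: "('a ^ 'b) set" and x assume U: "open U" "x \<in> U"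
    then obtain A where A: "\<And>i. open (A i)" "\<And>i. x $ i \<in> A i" "\<And>y. (\<forall>i. y $ i \<in> A i) \<Longrightarrow> y \<in> U"
      unfolding open_vec_def by metis
    have "\<exists>V. V \<in> B \<and> x $ i \<in> V \<and> V \<subseteq> A i" for i
      using topological_basisE[OF B(2) A(1) A(2)] by metis
    then obtain V where V: "\<And>i. V i \<in> B" "\<And>i. x $ i \<in> V i" "\<And>i. V i \<subseteq> A i" by metis
    have "V \<in> Pi\<^sub>E UNIV (\<lambda>_. B)" using V by auto
    then have "{x. \<forall>i. x $ i \<in> V i} \<in> C" unfolding C_def by (rule imageI)
    moreover have "{x. \<forall>i. x $ i \<in> V i} \<subseteq> U" using V(3) A(3) by blast
    moreover have "x \<in> {x. \<forall>i. x $ i \<in> V i}" using V(2) by simp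
    ultimately show "\<exists>V\<in>C. x \<in> V \<and> V \<subseteq> U" by (intro bexI conjI)
  qed
  moreover have "countable C"
    unfolding C_def by (intro countable_image countable_PiE) (auto simp: B)
  ultimately show "\<exists>B::('a ^ 'b) set set. countable B \<and> open = generate_topology B"
    using topological_basis_imp_subbasis by blast
qed

instance vec :: (topological_monoid_add, finite) topological_monoid_add
proof
  fix a b :: "'a ^ 'b"
  have "((\<lambda>p. \<chi> i. fst p $ i + snd p $ i) \<longlongrightarrow> (\<chi> i. a $ i + b $ i)) (nhds a \<times>\<^sub>F nhds b)"
    by (intro vec_tendstoI) (auto intro!: tendsto_add tendsto_vec_nth tendsto_fst tendsto_snd filterlim_fst filterlim_snd)
  then show "LIM x (nhds a \<times>\<^sub>F nhds b). fst x + snd x :> nhds (a + b)"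
    by (simp add: plus_vec_def)
qed

instance vec :: (topological_group_add, finite) topological_group_add
proof
  fix a :: "'a ^ 'b"
  have "((\<lambda>x. \<chi> i. - (x $ i)) \<longlongrightarrow> (\<chi> i. - (a $ i))) (nhds a)"
    by (intro vec_tendstoI) (auto intro!: tendsto_minus tendsto_vec_nth filterlim_ident)
  then show "(uminus \<longlongrightarrow> - a) (nhds a)"
    by (simp add: uminus_vec_def[abs_def])
qed

instance vec :: (topological_ab_group_add, finite) topological_ab_group_add ..

section \<open>Topology of the p-adic numbers\<close>

lemma padic_norm_triangle: "padic_norm (x + y) \<le> padic_norm x + padic_norm y"
  using padic_norm_add_le_max[of x y] padic_norm_nonneg[of x] padic_norm_nonneg[of y] by linarith

instance padic :: (prime_card) topological_monoid_add
proof
  fix a b :: "'a padic"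
  show "LIM x (nhds a \<times>\<^sub>F nhds b). fst x + snd x :> nhds (a + b)"
  proof (subst tendsto_dist_iff, rule tendsto_sandwich[OF _ _ tendsto_const])
    have "dist (x + y) (a + b) \<le> dist x a + dist y b" for x y
      using padic_norm_triangle[of "x - a" "y - b"] by (simp add: dist_padic_def algebra_simps)
    then show "\<forall>\<^sub>F p in nhds a \<times>\<^sub>F nhds b. dist (fst p + snd p) (a + b) \<le> dist (fst p) a + dist (snd p) b"
      by simp
    have "((\<lambda>p. dist (fst p) a + dist (snd p) b) \<longlongrightarrow> dist a a + dist b b) (nhds a \<times>\<^sub>F nhds b)"
      by (intro tendsto_add tendsto_dist tendsto_const filterlim_fst filterlim_snd)
    then show "((\<lambda>p. dist (fst p) a + dist (snd p) b) \<longlongrightarrow> 0) (nhds a \<times>\<^sub>F nhds b)" by simp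
  qed simp
qed

instance padic :: (prime_card) topological_ab_group_add
proof
  fix a :: "'a padic"
  have "dist (- x) (- a) = dist x a" for x
    using padic_norm_minus[of "x - a"] by (simp add: dist_padic_def)
  then show "(uminus \<longlongrightarrow> - a) (nhds a)"
    using tendsto_dist[OF filterlim_ident[of "nhds a"] tendsto_const[of a]]
    by (subst tendsto_dist_iff) simp
qed

text \<open>Continuity of the product makes \<open>pairing\<close> jointly continuous, hence jointly
  measurable. In the estimate \<open>padic_norm x\<close> varies with \<open>x\<close> and is
  replaced by \<open>dist x a + padic_norm a\<close>.\<close>

instance padic :: (prime_card) topological_semigroup_mult
proof
  fix a b :: "'a padic"
  show "LIM x (nhds a \<times>\<^sub>F nhds b). fst x * snd x :> nhds (a * b)"
  proof (subst tendsto_dist_iff, rule tendsto_sandwich[OF _ _ tendsto_const])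
    have "dist (x * y) (a * b) \<le> (dist x a + padic_norm a) * dist y b + dist x a * padic_norm b" for x y
    proof -
      have "x * y - a * b = x * (y - b) + (x - a) * b" by (simp add: algebra_simps)
      then have "dist (x * y) (a * b) \<le> padic_norm x * dist y b + dist x a * padic_norm b"
        using padic_norm_triangle[of "x * (y - b)" "(x - a) * b"] by (simp add: dist_padic_def padic_norm_mult)
      moreover have "padic_norm x \<le> dist x a + padic_norm a"
        using padic_norm_triangle[of "x - a" a] by (simp add: dist_padic_def)
      then have "padic_norm x * dist y b \<le> (dist x a + padic_norm a) * dist y b"
        by (rule mult_right_mono) simp
      ultimately show ?thesis by linarith
    qed
    then show "\<forall>\<^sub>F p in nhds a \<times>\<^sub>F nhds b. dist (fst p * snd p) (a * b)
      \<le> (dist (fst p) a + padic_norm a) * dist (snd p) b + dist (fst p) a * padic_norm b" by simp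
    have "((\<lambda>p. (dist (fst p) a + padic_norm a) * dist (snd p) b + dist (fst p) a * padic_norm b)
        \<longlongrightarrow> (dist a a + padic_norm a) * dist b b + dist a a * padic_norm b) (nhds a \<times>\<^sub>F nhds b)"
      by (intro tendsto_add tendsto_mult tendsto_dist tendsto_const filterlim_fst filterlim_snd)
    then show "((\<lambda>p. (dist (fst p) a + padic_norm a) * dist (snd p) b + dist (fst p) a * padic_norm b)
        \<longlongrightarrow> 0) (nhds a \<times>\<^sub>F nhds b)" by simp
  qed simp
qed

definition padic_of_rat :: "rat \<Rightarrow> 'p::prime_card padic" where
  "padic_of_rat q = padic_of_seq (\<lambda>_. q)"

text \<open>Subtracting the constant \<open>s\<close> termwise represents the difference, and
  \<open>padic_norm\<close> is a limit along a representative. Distances to rationals thus become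
  statements about \<open>padic_abs\<close>.\<close>

lemma dist_padic_of_seq_tendsto:
  assumes X: "padic_cauchy CARD('p::prime_card) X"
  shows "(\<lambda>m. padic_abs CARD('p) (X m - s)) \<longlonglongrightarrow> dist (padic_of_seq X) (padic_of_rat s :: 'p padic)"
proof -
  note p = prime_card[where 'a='p]
  note [simp] = padic_rel_self[OF p] padic_cauchy_const[OF p]
  have c: "padic_cauchy CARD('p) (\<lambda>m. X m - s)"
    using padic_cauchy_add[OF p X padic_cauchy_const[OF p, of "-s"]] by simp
  have "padic_of_seq X - (padic_of_rat s :: 'p padic) = padic_of_seq (\<lambda>m. X m - s)"
    using X by (simp add: minus_padic_def uminus_padic.abs_eq plus_padic.abs_eq padic_of_rat_def)
  then have "dist (padic_of_seq X) (padic_of_rat s :: 'p padic) = lim (\<lambda>m. padic_abs CARD('p) (X m - s))"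
    using c by (simp add: padic_norm.abs_eq dist_padic_def)
  with padic_norm_LIMSEQ[OF c] show ?thesis by simp
qed

lemma dist_padic_of_rat:
  "dist (padic_of_rat s) (padic_of_rat t :: 'p::prime_card padic) = padic_abs CARD('p) (s - t)"
  using dist_padic_of_seq_tendsto[where 'p='p, OF padic_cauchy_const[OF prime_card], of s t]
  by (simp add: LIMSEQ_const_iff padic_of_rat_def)

lemma dist_padic_of_seq_le:
  assumes X: "padic_cauchy CARD('p::prime_card) X" and e: "e > 0"
  obtains k where "\<And>n. n \<ge> k \<Longrightarrow> dist (padic_of_seq X) (padic_of_rat (X n) :: 'p padic) \<le> e"
proof -
  obtain k where k: "\<And>m n. m \<ge> k \<Longrightarrow> n \<ge> k \<Longrightarrow> padic_abs CARD('p) (X m - X n) < e"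
    using padic_cauchyD[OF prime_card X e] by blast
  have "dist (padic_of_seq X) (padic_of_rat (X n) :: 'p padic) \<le> e" if "n \<ge> k" for n
    by (rule LIMSEQ_le_const2[OF dist_padic_of_seq_tendsto[OF X]])
       (use k that in \<open>auto intro!: exI[of _ k] less_imp_le\<close>)
  then show thesis by (rule that)
qed

lemma padic_of_seq_cases:
  obtains X where "padic_cauchy CARD('p::prime_card) X" "(x :: 'p padic) = padic_of_seq X"
  using padic.abs_induct[of "\<lambda>y. \<exists>X. padic_cauchy CARD('p) X \<and> y = padic_of_seq X" x]
  by (auto simp: padic_rel_self[OF prime_card])

lemma padic_of_rat_dense:
  assumes "e > 0" shows "\<exists>s. dist (x :: 'p::prime_card padic) (padic_of_rat s) < e"
proof -
  obtain X where X: "padic_cauchy CARD('p) X" "x = padic_of_seq X" by (rule padic_of_seq_cases)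
  obtain k where "\<And>n. n \<ge> k \<Longrightarrow> dist (padic_of_seq X) (padic_of_rat (X n) :: 'p padic) \<le> e / 2"
    using dist_padic_of_seq_le[OF X(1), of "e / 2"] assms by auto
  from this[of k] show ?thesis using X assms by (intro exI[of _ "X k"]) auto
qed

instance padic :: (prime_card) second_countable_topology
proof
  define C where "C = (\<lambda>(q, n). ball (padic_of_rat q :: 'a padic) (inverse (real (Suc n)))) ` UNIV"
  have "topological_basis C"
  proof (rule topological_basisI)
    fix U assume "U \<in> C"
    then show "open U" by (auto simp: C_def)
  next
    fix U :: "'a padic set" and x assume "open U" "x \<in> U"
    then obtain e where e: "e > 0" "ball x e \<subseteq> U" by (meson openE)
    obtain n where n: "inverse (real (Suc n)) < e / 2"
      using reals_Archimedean[of "e / 2"] e by auto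
    obtain q where q: "dist x (padic_of_rat q) < inverse (real (Suc n))"
      using padic_of_rat_dense[of "inverse (real (Suc n))" x] by auto
    have "ball (padic_of_rat q) (inverse (real (Suc n))) \<subseteq> ball x e"
    proof
      fix y :: "'a padic" assume "y \<in> ball (padic_of_rat q) (inverse (real (Suc n)))"
      then show "y \<in> ball x e"
        using dist_triangle[of x y "padic_of_rat q"] n q by simp
    qed
    moreover have "x \<in> ball (padic_of_rat q) (inverse (real (Suc n)))"
      using q by (simp add: dist_commute)
    ultimately show "\<exists>V\<in>C. x \<in> V \<and> V \<subseteq> U" using e unfolding C_def
      by (intro bexI[of _ "ball (padic_of_rat q) (inverse (real (Suc n)))"]) auto
  qed
  moreover have "countable C" unfolding C_def by (intro countable_image) simp
  ultimately show "\<exists>B::'a padic set set. countable B \<and> open = generate_topology B"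
    using topological_basis_imp_subbasis by blast
qed

text \<open>A rational \<open>s k\<close> is chosen within \<open>1/(k+1)\<close> of
  \<open>X k\<close>. These rationals form a Cauchy sequence for \<open>padic_abs\<close>, and its
  class is the limit.\<close>

lemma padic_Cauchy_convergent:
  fixes X :: "nat \<Rightarrow> 'p::prime_card padic"
  assumes "Cauchy X" shows "\<exists>L. X \<longlonglongrightarrow> L"
proof -
  have "\<exists>s. dist (X k) (padic_of_rat s) < inverse (real (Suc k))" for k
    by (rule padic_of_rat_dense) simp
  then obtain s where s: "\<And>k. dist (X k) (padic_of_rat (s k)) < inverse (real (Suc k))" by metis
  have small: "\<exists>k. \<forall>n\<ge>k. dist (X n) (padic_of_rat (s n)) < e" if e: "e > 0" for e
  proof -
    obtain k where k: "inverse (real (Suc k)) < e" using reals_Archimedean[OF e] by auto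
    have "dist (X n) (padic_of_rat (s n)) < e" if "n \<ge> k" for n
    proof -
      have "inverse (real (Suc n)) \<le> inverse (real (Suc k))" using that by simp
      then show ?thesis using s[of n] k by linarith
    qed
    then show ?thesis by blast
  qed
  have sc: "padic_cauchy CARD('p) s"
    unfolding padic_cauchy_def
  proof (intro allI impI)
    fix e :: real assume e: "e > 0"
    obtain k where k: "\<And>n. n \<ge> k \<Longrightarrow> dist (X n) (padic_of_rat (s n)) < e / 3" using small[of "e / 3"] e by auto
    obtain l where l: "\<And>m n. m \<ge> l \<Longrightarrow> n \<ge> l \<Longrightarrow> dist (X m) (X n) < e / 3"
      using metric_CauchyD[OF assms, of "e / 3"] e by auto
    have "padic_abs CARD('p) (s m - s n) < e" if "m \<ge> max k l" "n \<ge> max k l" for m n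
    proof -
      have "dist (padic_of_rat (s m) :: 'p padic) (padic_of_rat (s n)) < e / 3 + e / 3 + e / 3"
        using k[of m] k[of n] l[of m n] that
          dist_triangle[of "padic_of_rat (s m)" "padic_of_rat (s n)" "X m"]
          dist_triangle[of "X m" "padic_of_rat (s n)" "X n"]
          dist_commute[of "X m" "padic_of_rat (s m)"] by simp
      then show ?thesis by (simp add: dist_padic_of_rat)
    qed
    then show "\<exists>k. \<forall>m\<ge>k. \<forall>n\<ge>k. padic_abs CARD('p) (s m - s n) < e" by blast
  qed
  have "X \<longlonglongrightarrow> padic_of_seq s"
  proof (rule metric_LIMSEQ_I)
    fix e :: real assume e: "e > 0"
    obtain k where k: "\<And>n. n \<ge> k \<Longrightarrow> dist (X n) (padic_of_rat (s n)) < e / 2" using small[of "e / 2"] e by auto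
    obtain l where l: "\<And>n. n \<ge> l \<Longrightarrow> dist (padic_of_seq s) (padic_of_rat (s n) :: 'p padic) \<le> e / 2"
      using dist_padic_of_seq_le[OF sc, of "e / 2"] e by auto
    have "dist (X n) (padic_of_seq s) < e" if "n \<ge> max k l" for n
      using k[of n] l[of n] that dist_triangle2[of "X n" "padic_of_seq s" "padic_of_rat (s n)"] by simp
    then show "\<exists>no. \<forall>n\<ge>no. dist (X n) (padic_of_seq s) < e" by blast
  qed
  then show ?thesis by blast
qed

lemma padic_norm_prime_power_mult:
  "padic_norm (of_nat CARD('p) ^ n * (x :: 'p::prime_card padic)) = padic_norm x / real CARD('p) ^ n"
  by (simp add: padic_norm_mult padic_norm_prime_power)

lemma padic_norm_of_int_le_1: "padic_norm (of_int k :: 'p::prime_card padic) \<le> 1"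
  by (simp add: padic_norm_of_int padic_abs_int_le1[OF prime_card])

lemma CARD_prime_gt_1: "real CARD('p::prime_card) > 1"
  using prime_gt_1_nat[OF prime_card[where 'a='p]] by simp

text \<open>Scaling by \<open>p^n\<close> carries the ball into the p-adic integers, where the
  integers \<open>0, ..., p^N - 1\<close> approximate every element to within \<open>p^(-N)\<close>.
  Scaling back gives a finite net.\<close>

lemma padic_totally_bounded:
  assumes e: "e > 0"
  shows "\<exists>K. finite K \<and> cball (0 :: 'p::prime_card padic) R \<subseteq> (\<Union>x\<in>K. ball x e)"
proof -
  note p1 = CARD_prime_gt_1[where 'p='p]
  define P :: "'p padic" where "P = of_nat CARD('p)"
  have P0: "P ^ n \<noteq> 0" for n
    using padic_norm_prime_power[where 'p='p, of n] p1 by (auto simp: P_def padic_norm_eq_0[symmetric])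
  obtain n where n: "R < real CARD('p) ^ n" using real_arch_pow[OF p1] by blast
  \<comment> \<open>Dividing by \<open>P ^ n\<close> stretches distances by \<open>p^n\<close>, so
    the precision has to satisfy \<open>p^n / p^N < e\<close>.\<close>
  obtain N where N: "real CARD('p) ^ n / e < real CARD('p) ^ N" using real_arch_pow[OF p1] by blast
  define K where "K = (\<lambda>r. of_int r / P ^ n) ` {0..<int CARD('p) ^ N}"
  have "x \<in> (\<Union>x\<in>K. ball x e)" if x: "x \<in> cball 0 R" for x
  proof -
    have "padic_norm x \<le> R" using x padic_norm_minus[of x] by (simp add: dist_padic_def)
    then have "padic_norm (P ^ n * x) \<le> 1"
      unfolding P_def padic_norm_prime_power_mult using n p1 by (subst pos_divide_le_eq) auto
    from padic_int_approx[OF this, of N] obtain r where r: "padic_norm (of_int r - P ^ n * x) \<le> 1 / real CARD('p) ^ N"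
      by blast
    \<comment> \<open>Reduction moves \<open>r\<close> by a multiple of \<open>P ^ N\<close>, of
      norm at most \<open>1/p^N\<close>, and leaves finitely many candidates.\<close>
    define r' where "r' = r mod int CARD('p) ^ N"
    have "of_int r' - (of_int r :: 'p padic) = P ^ N * of_int (- (r div int CARD('p) ^ N))"
      unfolding r'_def P_def by (simp add: minus_div_mult_eq_mod[symmetric])
    then have "padic_norm (of_int r' - (of_int r :: 'p padic)) \<le> 1 / real CARD('p) ^ N"
      unfolding P_def by (simp only: padic_norm_prime_power_mult) (intro divide_right_mono padic_norm_of_int_le_1, simp)
    then have "padic_norm (of_int r' - P ^ n * x) \<le> 1 / real CARD('p) ^ N"
      using r padic_norm_add_le_max[of "of_int r' - of_int r" "of_int r - P ^ n * x"] by simp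
    also have "of_int r' - P ^ n * x = P ^ n * (of_int r' / P ^ n - x)"
      using P0 by (simp add: right_diff_distrib)
    also have "padic_norm (P ^ n * (of_int r' / P ^ n - x)) = dist (of_int r' / P ^ n) x / real CARD('p) ^ n"
      unfolding P_def dist_padic_def by (rule padic_norm_prime_power_mult)
    finally have "dist (of_int r' / P ^ n) x \<le> 1 / real CARD('p) ^ N * real CARD('p) ^ n"
      using p1 by (subst (asm) pos_divide_le_eq) auto
    also have "\<dots> < e" using N e p1 by (simp add: pos_divide_less_eq mult.commute)
    finally have "x \<in> ball (of_int r' / P ^ n) e" by simp
    moreover have "of_int r' / P ^ n \<in> K"
      unfolding K_def r'_def using p1 by (intro imageI) auto
    ultimately show ?thesis by blast
  qed
  moreover have "finite K" by (simp add: K_def)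
  ultimately show ?thesis by blast
qed

text \<open>Closed balls are complete and totally bounded. Compactness is what bounds the Haar
  measure of bounded sets, since finiteness is postulated on compact sets only.\<close>

instance padic :: (prime_card) heine_borel
proof
  fix f :: "nat \<Rightarrow> 'a padic" assume "bounded (range f)"
  then obtain R where R: "range f \<subseteq> cball 0 R"
    by (meson bounded_subset_ballD ball_subset_cball order_trans)
  have "Topological_Spaces.complete (cball (0 :: 'a padic) R)"
  proof (rule completeI)
    fix g :: "nat \<Rightarrow> 'a padic" assume g: "\<forall>n. g n \<in> cball 0 R" "Cauchy g"
    obtain L where "g \<longlonglongrightarrow> L" using padic_Cauchy_convergent[OF g(2)] by blast
    with g show "\<exists>l\<in>cball 0 R. g \<longlonglongrightarrow> l"
      using closed_sequentially[OF closed_cball] by blast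
  qed
  then have "compact (cball (0 :: 'a padic) R)"
    unfolding compact_eq_totally_bounded using padic_totally_bounded by blast
  then have "seq_compact (cball (0 :: 'a padic) R)" by (rule compact_imp_seq_compact)
  then show "\<exists>l r. strict_mono r \<and> (f \<circ> r) \<longlonglongrightarrow> l"
    using R unfolding seq_compact_def by blast
qed

section \<open>The additive character of the p-adic numbers\<close>

text \<open>The value that a numerator \<open>r\<close> at level \<open>n\<close> prescribes for the
  character. Levels above the least exponent are needed to treat several arguments at once.\<close>

definition additive_root :: "nat \<Rightarrow> int \<Rightarrow> nat \<Rightarrow> complex" where
  "additive_root p r n = exp (2 * of_real pi * \<i> * of_int r / of_nat p ^ n)"

lemma prime_power_dvd_of_padic_norm:
  assumes "padic_norm (of_int a :: 'p::prime_card padic) \<le> 1 / real CARD('p) ^ m"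
  shows "int CARD('p) ^ m dvd a"
proof (cases "a = 0")
  case False
  note p1 = CARD_prime_gt_1[where 'p='p]
  have "real CARD('p) powi (- int (multiplicity (int CARD('p)) a)) \<le> real CARD('p) powi (- int m)"
    using assms False padic_abs_int[OF prime_card[where 'a='p] False]
    by (simp add: padic_norm_of_int power_int_minus inverse_eq_divide)
  then have "m \<le> multiplicity (int CARD('p)) a"
    using p1 by (smt (verit) power_int_strict_increasing of_nat_le_iff)
  then show ?thesis by (rule multiplicity_dvd')
qed simp

text \<open>The divisibility says that \<open>s / p^(n+j)\<close> and \<open>r / p^n\<close> differ
  by an integer.\<close>

lemma additive_root_lift:
  assumes p: "p > 0" and d: "int p ^ (n + j) dvd s - r * int p ^ j"
  shows "additive_root p s (n + j) = additive_root p r n"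
proof -
  obtain q where "s - r * int p ^ j = int p ^ (n + j) * q" using d by blast
  then have s: "s = r * int p ^ j + int p ^ (n + j) * q" by simp
  have "(of_int s :: complex) / of_nat p ^ (n + j) = of_int r / of_nat p ^ n + of_int q"
    unfolding s using p by (simp add: add_divide_distrib power_add)
  then have "2 * of_real pi * \<i> * of_int s / of_nat p ^ (n + j) =
      2 * of_real pi * \<i> * of_int r / of_nat p ^ n + 2 * of_int q * of_real pi * \<i>"
    unfolding times_divide_eq_right[symmetric] by (simp only: distrib_left mult_ac)
  then show ?thesis
    unfolding additive_root_def by (simp add: exp_add exp_integer_2pi mult_ac)
qed

lemma padic_approx_lift:
  fixes x :: "'p::prime_card padic"
  assumes "padic_norm (of_int r - of_nat CARD('p) ^ n * x) \<le> 1 / real CARD('p) ^ n"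
  shows "padic_norm (of_int (r * int CARD('p) ^ j) - of_nat CARD('p) ^ (n + j) * x) \<le> 1 / real CARD('p) ^ (n + j)"
proof -
  have "of_int (r * int CARD('p) ^ j) - of_nat CARD('p) ^ (n + j) * x
      = of_nat CARD('p) ^ j * (of_int r - of_nat CARD('p) ^ n * x)"
    by (simp add: algebra_simps power_add)
  then have "padic_norm (of_int (r * int CARD('p) ^ j) - of_nat CARD('p) ^ (n + j) * x)
      = padic_norm (of_int r - of_nat CARD('p) ^ n * x) / real CARD('p) ^ j"
    by (simp only: padic_norm_prime_power_mult)
  also have "\<dots> \<le> 1 / real CARD('p) ^ n / real CARD('p) ^ j"
    using assms by (intro divide_right_mono) auto
  also have "\<dots> = 1 / real CARD('p) ^ (n + j)" by (simp only: power_add divide_divide_eq_left)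
  finally show ?thesis .
qed

lemma additive_root_unique:
  fixes x :: "'p::prime_card padic"
  assumes r: "padic_norm (of_int r - of_nat CARD('p) ^ n * x) \<le> 1 / real CARD('p) ^ n"
    and s: "padic_norm (of_int s - of_nat CARD('p) ^ (n + j) * x) \<le> 1 / real CARD('p) ^ (n + j)"
  shows "additive_root CARD('p) s (n + j) = additive_root CARD('p) r n"
proof (rule additive_root_lift)
  let ?q = "r * int CARD('p) ^ j"
  let ?y = "of_nat CARD('p) ^ (n + j) * x"
  have "padic_norm (?y - of_int ?q) \<le> 1 / real CARD('p) ^ (n + j)"
    using padic_approx_lift[OF r, of j] padic_norm_minus[of "?y - of_int ?q"] by simp
  then have "padic_norm (of_int (s - ?q) :: 'p padic) \<le> 1 / real CARD('p) ^ (n + j)"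
    using s padic_norm_add_le_max[of "of_int s - ?y" "?y - of_int ?q"]
    by (simp del: of_int_mult of_int_power)
  then show "int CARD('p) ^ (n + j) dvd s - ?q"
    by (rule prime_power_dvd_of_padic_norm)
qed simp

text \<open>Approximations of \<open>x\<close> at two levels give fractions that agree modulo 1. The
  value therefore depends neither on taking the least exponent nor on the choice made in
  \<open>padic_numerator\<close>.\<close>

lemma padic_char_eqI:
  fixes x :: "'p::prime_card padic"
  assumes r: "padic_norm (of_int r - of_nat CARD('p) ^ n * x) \<le> 1 / real CARD('p) ^ n"
  shows "padic_char x = additive_root CARD('p) r n"
proof -
  have "padic_char x = additive_root CARD('p) (padic_numerator x) (padic_exponent x)"
    by (simp add: padic_char_def additive_root_def)
  also have "\<dots> = additive_root CARD('p) r n"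
  proof (cases "n \<le> padic_exponent x")
    case True
    then show ?thesis
      using additive_root_unique[OF r, of "padic_numerator x" "padic_exponent x - n"] padic_numerator_norm[of x] by simp
  next
    case False
    then show ?thesis
      using additive_root_unique[OF padic_numerator_norm[of x], of r "n - padic_exponent x"] r by simp
  qed
  finally show ?thesis .
qed

lemma padic_char_add: "padic_char (x + y) = padic_char x * padic_char (y :: 'p::prime_card padic)"
proof -
  let ?P = "of_nat CARD('p) :: 'p padic"
  \<comment> \<open>A common level to which both approximations lift, so that numerators can be
    added.\<close>
  define n where "n = padic_exponent x + padic_exponent y"
  obtain r where r: "padic_norm (of_int r - ?P ^ n * x) \<le> 1 / real CARD('p) ^ n"
    using padic_approx_lift[OF padic_numerator_norm[of x], of "padic_exponent y"] unfolding n_def by blast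
  obtain s where s: "padic_norm (of_int s - ?P ^ n * y) \<le> 1 / real CARD('p) ^ n"
    using padic_approx_lift[OF padic_numerator_norm[of y], of "padic_exponent x"]
    unfolding n_def by (subst (asm) (2 3) add.commute) blast
  have "padic_norm (of_int (r + s) - ?P ^ n * (x + y)) \<le> 1 / real CARD('p) ^ n"
    using r s padic_norm_add_le_max[of "of_int r - ?P ^ n * x" "of_int s - ?P ^ n * y"]
    by (simp add: algebra_simps)
  from padic_char_eqI[OF this] padic_char_eqI[OF r] padic_char_eqI[OF s] show ?thesis
    by (simp add: additive_root_def exp_add[symmetric] algebra_simps add_divide_distrib)
qed

lemma norm_padic_char: "norm (padic_char x) = 1"
proof -
  have "2 * of_real pi * \<i> * of_int (padic_numerator x) / of_nat CARD('a) ^ padic_exponent x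
      = \<i> * complex_of_real (2 * pi * of_int (padic_numerator x) / real CARD('a) ^ padic_exponent x)"
    by simp
  then show ?thesis unfolding padic_char_def by (simp only: norm_exp_i_times)
qed

lemma padic_char_integer: "padic_norm x \<le> 1 \<Longrightarrow> padic_char x = 1"
  using padic_char_eqI[of 0 0 x] by (simp add: padic_norm_minus additive_root_def)

text \<open>The value is the primitive root \<open>exp (2 \<pi> i / p)\<close>. This nontriviality
  is what lets the characters detect large coordinates in
  \<open>padic_annihilator_small\<close>.\<close>

lemma padic_char_inverse_prime: "padic_char (1 / of_nat CARD('p) :: 'p::prime_card padic) \<noteq> 1"
proof
  note p1 = CARD_prime_gt_1[where 'p='p]
  have P0: "(of_nat CARD('p) :: 'p padic) \<noteq> 0"
    using padic_norm_prime_power[where 'p='p, of 1] p1 by (auto simp: padic_norm_eq_0[symmetric])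
  assume "padic_char (1 / of_nat CARD('p) :: 'p padic) = 1"
  moreover have "padic_char (1 / of_nat CARD('p) :: 'p padic) = additive_root CARD('p) 1 1"
    using P0 by (intro padic_char_eqI) (simp add: padic_norm_eq_0[THEN iffD2])
  ultimately have root: "exp (2 * of_real pi * \<i> / of_nat CARD('p)) = (1::complex)"
    by (simp add: additive_root_def)
  have eq: "2 * of_real pi * \<i> / of_nat CARD('p) = \<i> * complex_of_real (2 * pi / real CARD('p))" by simp
  obtain n :: int where n: "2 * pi / real CARD('p) = of_int (2 * n) * pi"
    using root unfolding eq exp_eq_1 by auto
  have "2 * pi * 1 = 2 * pi * (of_int n * real CARD('p))" using n p1 by (simp add: divide_eq_eq mult_ac)
  then have "1 = real_of_int (n * int CARD('p))" by simp
  then have "n * int CARD('p) = 1" by linarith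
  then show False using p1 by (simp add: zmult_eq_1_iff)
qed

lemma continuous_padic_char: "continuous_on UNIV (padic_char :: 'p::prime_card padic \<Rightarrow> complex)"
proof (rule continuous_onI)
  fix x :: "'p padic" and e :: real assume e: "e > 0"
  \<comment> \<open>The character is trivial on p-adic integers, hence constant on balls of radius
    1.\<close>
  have "padic_char y = padic_char x" if "dist y x < 1" for y
    using padic_char_add[of "y - x" x] padic_char_integer[of "y - x"] that by (simp add: dist_padic_def)
  then have "dist y x < 1 \<Longrightarrow> dist (padic_char y) (padic_char x) \<le> e" for y
    using e by (metis dist_self less_imp_le)
  then show "\<exists>d>0. \<forall>y\<in>UNIV. dist y x < d \<longrightarrow> dist (padic_char y) (padic_char x) \<le> e"
    using zero_less_one by blast
qed

section \<open>Haar measure and translations\<close>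

text \<open>The non-integrable case holds because the Bochner integral is then 0 by convention.
  Iterated integrals can thus be bounded before their measurability is established.\<close>

lemma norm_integral_le_const:
  fixes f :: "'a \<Rightarrow> 'b::{banach, second_countable_topology}"
  assumes "finite_measure N" "\<And>x. norm (f x) \<le> C" "C \<ge> 0"
  shows "norm (\<integral>x. f x \<partial>N) \<le> C * measure N (space N)"
proof (cases "integrable N f")
  case True
  interpret finite_measure N by fact
  have "norm (\<integral>x. f x \<partial>N) \<le> (\<integral>x. norm (f x) \<partial>N)" by (rule integral_norm_bound)
  also have "\<dots> \<le> (\<integral>x. C \<partial>N)" using True assms by (intro integral_mono) auto
  finally show ?thesis by (simp add: mult.commute)
qed (use assms in \<open>simp add: not_integrable_integral_eq\<close>)

section \<open>Measurability of group operations, and Fubini for bounded integrands\<close>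

lemma borel_measurable_cnj [measurable]: "cnj \<in> borel_measurable borel"
  by (intro borel_measurable_continuous_onI continuous_intros)

lemma borel_measurable_group_add [measurable]:
  fixes f g :: "'a \<Rightarrow> 'v::{second_countable_topology, topological_group_add}"
  assumes "f \<in> borel_measurable N" "g \<in> borel_measurable N"
  shows "(\<lambda>w. f w + g w) \<in> borel_measurable N"
  using assms by (rule borel_measurable_continuous_Pair) (intro continuous_intros)

lemma borel_measurable_group_diff [measurable]:
  fixes f g :: "'a \<Rightarrow> 'v::{second_countable_topology, topological_group_add}"
  assumes "f \<in> borel_measurable N" "g \<in> borel_measurable N"
  shows "(\<lambda>w. f w - g w) \<in> borel_measurable N"
  using assms by (rule borel_measurable_continuous_Pair) (intro continuous_intros)

lemma integrable_finite_bounded: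
  fixes f :: "'a \<Rightarrow> 'b::{banach, second_countable_topology}"
  assumes "finite_measure N" "f \<in> borel_measurable N" "\<And>x. norm (f x) \<le> C"
  shows "integrable N f"
  using finite_measure.integrable_const_bound[OF assms(1) _ assms(2), of C] assms(3) by auto

lemma bounded_integral_swap:
  fixes f :: "'a \<Rightarrow> 'b \<Rightarrow> 'c::{banach, second_countable_topology}"
  assumes "finite_measure A" "finite_measure B"
    and "(\<lambda>(x, y). f x y) \<in> borel_measurable (A \<Otimes>\<^sub>M B)"
    and "\<And>x y. norm (f x y) \<le> C"
  shows "(\<integral>x. \<integral>y. f x y \<partial>B \<partial>A) = (\<integral>y. \<integral>x. f x y \<partial>A \<partial>B)"
proof -
  interpret A: finite_measure A by fact
  interpret B: finite_measure B by fact
  interpret pair_sigma_finite A B ..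
  interpret P: finite_measure "A \<Otimes>\<^sub>M B"
    by (rule finite_measure_pair_measure) fact+
  have "integrable (A \<Otimes>\<^sub>M B) (\<lambda>(x, y). f x y)"
    using assms by (intro P.integrable_const_bound[where B = C]) auto
  then show ?thesis by (rule Fubini_integral[symmetric])
qed

text \<open>\<open>heine_borel\<close> makes bounded sets relatively compact, hence of finite
  measure; second countability makes addition measurable on the product of the Borel
  algebras.\<close>

locale haar_space =
  fixes M :: "'v::{heine_borel, second_countable_topology, topological_ab_group_add} measure"
  assumes haar: "haar_measure M"
begin

lemma sets_M [measurable_cong, simp]: "sets M = sets borel"
  using haar by (simp add: haar_measure_def)

lemma space_M [simp]: "space M = UNIV"
  using sets_eq_imp_space_eq[OF sets_M] by simp

lemma emeasure_bounded_finite: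
  assumes "bounded A" shows "emeasure M A < \<infinity>"
proof -
  have "emeasure M A \<le> emeasure M (closure A)"
    by (intro emeasure_mono closure_subset) auto
  also have "\<dots> < \<infinity>"
    using haar assms by (simp add: haar_measure_def compact_closure)
  finally show ?thesis .
qed

lemma distr_translate: "distr M borel (\<lambda>y. y + a) = M"
proof (rule measure_eqI)
  fix E assume "E \<in> sets (distr M borel (\<lambda>y. y + a))"
  then have E: "E \<in> sets borel" by simp
  have eq: "(\<lambda>y. y + a) -` E = (+) (- a) ` E"
    by (auto simp: image_iff algebra_simps intro!: bexI[of _ "_ + a"])
  moreover have "emeasure M ((+) (- a) ` E) = emeasure M E"
    using haar E unfolding haar_measure_def by blast
  ultimately show "emeasure (distr M borel (\<lambda>y. y + a)) E = emeasure M E"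
    using E unfolding eq[symmetric] by (subst emeasure_distr) auto
qed auto

lemma nn_integral_translate:
  assumes [measurable]: "f \<in> borel_measurable borel"
  shows "(\<integral>\<^sup>+ y. f (y + a) \<partial>M) = (\<integral>\<^sup>+ y. f y \<partial>M)"
  by (subst (2) distr_translate[of a, symmetric], subst nn_integral_distr) auto

lemma sigma_finite: "sigma_finite_measure M"
proof
  have "emeasure M (ball 0 (real n)) \<noteq> \<infinity>" for n
    using emeasure_bounded_finite[of "ball 0 (real n)"] by auto
  moreover have "(\<Union>n. ball (0::'v) (real n)) = UNIV"
    using reals_Archimedean2 by (auto simp: dist_commute)
  ultimately show "\<exists>A. countable A \<and> A \<subseteq> sets M \<and> \<Union> A = space M \<and> (\<forall>a\<in>A. emeasure M a \<noteq> \<infinity>)"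
    by (intro exI[of _ "range (\<lambda>n. ball 0 (real n))"]) auto
qed

text \<open>Uniqueness of Haar measure, tested on symmetric sets: both sides equal the integral of
  \<open>1\<^sub>C y 1\<^sub>A (x + y)\<close> over the product measure.\<close>

lemma haar_measure_proportional:
  assumes N: "haar_measure N" and [measurable]: "A \<in> sets borel" "C \<in> sets borel"
    and C: "uminus ` C = C"
  shows "emeasure M A * emeasure N C = emeasure N A * emeasure M C"
proof -
  interpret N: haar_space N by unfold_locales (rule N)
  interpret M': sigma_finite_measure M by (rule sigma_finite)
  interpret N': sigma_finite_measure N by (rule N.sigma_finite)
  interpret pair_sigma_finite M N ..
  \<comment> \<open>Symmetry of \<open>C\<close> takes the place of invariance of \<open>M\<close>
    under inversion when \<open>x\<close> is integrated in \<open>y - x\<close>.\<close>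
  have C': "indicator C (y - x) = (indicator C (x - y) :: ennreal)" for x y
  proof -
    have "- z \<in> C" if "z \<in> C" for z using C that by blast
    from this[of "y - x"] this[of "x - y"] show ?thesis by (auto simp: indicator_def)
  qed
  have "emeasure M A * emeasure N C = (\<integral>\<^sup>+ y. (\<integral>\<^sup>+ x. indicator C y * indicator A (x + y) \<partial>M) \<partial>N)"
  proof -
    have "(\<integral>\<^sup>+ x. indicator A (x + y) \<partial>M) = emeasure M A" for y
      by (subst nn_integral_translate) auto
    then show ?thesis by (simp add: nn_integral_cmult nn_integral_multc mult.commute)
  qed
  also have "\<dots> = (\<integral>\<^sup>+ x. (\<integral>\<^sup>+ y. indicator C y * indicator A (x + y) \<partial>N) \<partial>M)"
    by (rule Fubini') measurable
  also have "\<dots> = (\<integral>\<^sup>+ x. (\<integral>\<^sup>+ y. indicator C (y - x) * indicator A y \<partial>N) \<partial>M)"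
  proof (rule nn_integral_cong)
    fix x
    show "(\<integral>\<^sup>+ y. indicator C y * indicator A (x + y) \<partial>N) = (\<integral>\<^sup>+ y. indicator C (y - x) * indicator A y \<partial>N)"
      using N.nn_integral_translate[of "\<lambda>y. indicator C (y - x) * indicator A y" x]
      by (simp add: add.commute)
  qed
  also have "\<dots> = (\<integral>\<^sup>+ y. (\<integral>\<^sup>+ x. indicator C (y - x) * indicator A y \<partial>M) \<partial>N)"
    by (rule Fubini'[symmetric]) measurable
  also have "\<dots> = emeasure N A * emeasure M C"
  proof -
    have "(\<integral>\<^sup>+ x. indicator C (y - x) \<partial>M) = emeasure M C" for y
      unfolding C' using nn_integral_translate[of "indicator C" "- y"] by simp
    then show ?thesis by (simp add: nn_integral_cmult nn_integral_multc mult.commute)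
  qed
  finally show ?thesis .
qed

section \<open>Integration over bounded sets\<close>

lemma integral_translate:
  fixes f :: "'v \<Rightarrow> 'b::{banach, second_countable_topology}"
  assumes [measurable]: "f \<in> borel_measurable borel"
  shows "(\<integral>y. f (y + a) \<partial>M) = (\<integral>y. f y \<partial>M)"
  by (subst (2) distr_translate[of a, symmetric], subst integral_distr) auto

lemma measure_open_pos:
  assumes "open U" "bounded U" "U \<noteq> {}" shows "measure M U > 0"
proof -
  have "emeasure M U > 0" using haar assms by (auto simp: haar_measure_def)
  then show ?thesis using emeasure_bounded_finite[OF assms(2)]
    by (simp add: measure_def enn2real_positive_iff)
qed

lemma integrable_bounded_support:
  fixes f :: "'v \<Rightarrow> 'b::{banach, second_countable_topology}"
  assumes [measurable]: "f \<in> borel_measurable borel" "B \<in> sets borel" and "bounded B"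
    and "\<And>x. norm (f x) \<le> C" "\<And>x. x \<notin> B \<Longrightarrow> f x = 0"
  shows "integrable M f"
proof (rule Bochner_Integration.integrable_bound[where f="\<lambda>x. C * indicator B x"])
  show "integrable M (\<lambda>x. C * indicat_real B x)"
    using emeasure_bounded_finite[OF assms(3)] by auto
  show "AE x in M. norm (f x) \<le> norm (C * indicat_real B x)"
  proof (intro AE_I2)
    fix x show "norm (f x) \<le> norm (C * indicat_real B x)"
      using assms(4)[of x] assms(5)[of x] by (cases "x \<in> B") auto
  qed
qed simp

text \<open>Restriction of \<open>M\<close> to \<open>A\<close>, kept as a measure on the whole
  Borel algebra so that the same functions stay measurable. It is finite for bounded Borel
  \<open>A\<close>.\<close>

definition window :: "'v set \<Rightarrow> 'v measure" where
  "window A = density M (indicator A)"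

lemma sets_window [simp, measurable_cong]: "sets (window A) = sets borel"
  by (simp add: window_def)

lemma finite_window:
  assumes "bounded A" "A \<in> sets borel" shows "finite_measure (window A)"
  using emeasure_bounded_finite[OF assms(1)] assms(2)
  by (intro finite_measureI) (simp add: window_def emeasure_density)

lemma integral_window:
  fixes f :: "'v \<Rightarrow> 'b::{banach, second_countable_topology}"
  assumes [measurable]: "f \<in> borel_measurable borel" "A \<in> sets borel"
  shows "(\<integral>x. f x \<partial>window A) = (\<integral>x. indicat_real A x *\<^sub>R f x \<partial>M)"
proof -
  have "window A = density M (\<lambda>x. ennreal (indicat_real A x))"
    unfolding window_def by (rule arg_cong[of _ _ "density M"]) (auto simp: indicator_def)
  then show ?thesis by (simp add: integral_density)
qed

lemma integral_window_support:
  fixes f :: "'v \<Rightarrow> 'b::{banach, second_countable_topology}"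
  assumes "f \<in> borel_measurable borel" "A \<in> sets borel" "\<And>x. x \<notin> A \<Longrightarrow> f x = 0"
  shows "(\<integral>x. f x \<partial>window A) = (\<integral>x. f x \<partial>M)"
  using assms by (subst integral_window) (auto intro!: Bochner_Integration.integral_cong simp: indicator_def)

section \<open>Continuity of translation in the mean\<close>

lemma integrable_indicator_bounded [simp]:
  "bounded A \<Longrightarrow> A \<in> sets borel \<Longrightarrow> integrable M (indicat_real A)"
  using emeasure_bounded_finite by simp

text \<open>The L1 modulus of continuity of the indicator, that is, the measure of the symmetric
  difference of \<open>A\<close> and a translate.\<close>

definition shift_diff :: "'v set \<Rightarrow> 'v \<Rightarrow> real" where
  "shift_diff A t = (\<integral>y. \<bar>indicat_real A (y + t) - indicat_real A y\<bar> \<partial>M)"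

lemma integrable_indicator_translate [simp]:
  assumes "bounded A" "A \<in> sets borel"
  shows "integrable M (\<lambda>y. indicat_real A (y + t))"
proof -
  have "integrable (distr M borel (\<lambda>y. y + t)) (indicat_real A)"
    using assms by (simp add: distr_translate)
  then show ?thesis using assms by (subst (asm) integrable_distr_eq) auto
qed

text \<open>If \<open>U\<close> is open and \<open>y \<in> U\<close>, then
  \<open>y + t \<in> U\<close> for small \<open>t\<close>, so dominated convergence applies to the
  overlap \<open>h t\<close>. A translate has the same measure, so the symmetric difference has
  measure \<open>2 |U| - 2 h t\<close>.\<close>

lemma shift_diff_open:
  assumes U: "open U" "bounded U"
  shows "(shift_diff U \<longlongrightarrow> 0) (at 0)"
proof -
  have [measurable]: "U \<in> sets borel" using U by simp
  define h where "h t = (\<integral>y. indicat_real U y * indicat_real U (y + t) \<partial>M)" for t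
  have int: "integrable M (\<lambda>y. indicat_real U y * indicat_real U (y + t))" for t
    using U by (intro integrable_bounded_support[where B=U and C=1]) (auto simp: indicator_def)
  have "continuous (at 0) h"
  proof (rule continuous_at_sequentiallyI)
    fix X :: "nat \<Rightarrow> 'v" assume X: "X \<longlonglongrightarrow> 0"
    show "(\<lambda>n. h (X n)) \<longlonglongrightarrow> h 0"
      unfolding h_def
    proof (rule integral_dominated_convergence[where w="indicat_real U"])
      show "AE y in M. (\<lambda>n. indicat_real U y * indicat_real U (y + X n))
               \<longlonglongrightarrow> indicat_real U y * indicat_real U (y + 0)"
      proof (intro AE_I2)
        fix y
        show "(\<lambda>n. indicat_real U y * indicat_real U (y + X n))
               \<longlonglongrightarrow> indicat_real U y * indicat_real U (y + 0)"
        proof (cases "y \<in> U")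
          case True
          have "(\<lambda>n. y + X n) \<longlonglongrightarrow> y" using tendsto_add[OF tendsto_const[of y] X] by simp
          then have "\<forall>\<^sub>F n in sequentially. y + X n \<in> U" using U(1) True by (rule topological_tendstoD)
          then show ?thesis using True by (intro tendsto_eventually) (auto elim: eventually_mono)
        qed simp
      qed
    qed (use U in \<open>auto simp: indicator_def\<close>)
  qed
  then have "(h \<longlongrightarrow> h 0) (at 0)" by (simp add: continuous_at)
  then have "((\<lambda>t. 2 * measure M U - 2 * h t) \<longlongrightarrow> 2 * measure M U - 2 * h 0) (at 0)"
    by (intro tendsto_intros)
  moreover have "h 0 = measure M U"
    by (simp add: h_def indicator_inter_arith[symmetric])
  moreover have "shift_diff U = (\<lambda>t. 2 * measure M U - 2 * h t)"
  proof
    fix t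
    have "shift_diff U t = (\<integral>y. indicat_real U (y + t) + indicat_real U y
        - 2 * (indicat_real U y * indicat_real U (y + t)) \<partial>M)"
      unfolding shift_diff_def by (intro Bochner_Integration.integral_cong) (auto simp: indicator_def)
    also have "\<dots> = (\<integral>y. indicat_real U (y + t) \<partial>M) + measure M U - 2 * h t"
      using U int by (simp add: h_def)
    also have "(\<integral>y. indicat_real U (y + t) \<partial>M) = measure M U"
      by (subst integral_translate) auto
    finally show "shift_diff U t = 2 * measure M U - 2 * h t" by simp
  qed
  ultimately show ?thesis by simp
qed

text \<open>The indicator of \<open>A\<close> is that of \<open>U\<close> minus that of
  \<open>U - A\<close>; the latter counts once in place and once translated.\<close>

lemma shift_diff_le:
  assumes A: "A \<in> sets borel" "bounded A" and U: "U \<in> sets borel" "bounded U" and AU: "A \<subseteq> U"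
  shows "shift_diff A t \<le> shift_diff U t + 2 * measure M (U - A)"
proof -
  note [measurable] = A(1) U(1)
  have b: "bounded (U - A)" using U by (meson Diff_subset bounded_subset)
  have int: "integrable M (\<lambda>y. \<bar>indicat_real B (y + t) - indicat_real B y\<bar>)"
    if "B \<in> sets borel" "bounded B" for B
    using that by (intro integrable_abs Bochner_Integration.integrable_diff) auto
  have i2: "integrable M (\<lambda>y. indicat_real (U - A) (y + t) + indicat_real (U - A) y)"
    using b A U by (intro Bochner_Integration.integrable_add) auto
  have "shift_diff A t \<le> (\<integral>y. \<bar>indicat_real U (y + t) - indicat_real U y\<bar> +
      (indicat_real (U - A) (y + t) + indicat_real (U - A) y) \<partial>M)"
    unfolding shift_diff_def using AU
    by (intro integral_mono int A Bochner_Integration.integrable_add[OF int[OF U] i2])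
       (auto simp: indicator_def)
  also have "\<dots> = shift_diff U t + ((\<integral>y. indicat_real (U - A) (y + t) \<partial>M) + measure M (U - A))"
    using b A U unfolding shift_diff_def
    by (subst Bochner_Integration.integral_add[OF int[OF U] i2]) (simp)
  also have "(\<integral>y. indicat_real (U - A) (y + t) \<partial>M) = measure M (U - A)"
    by (subst integral_translate) auto
  finally show ?thesis by simp
qed

text \<open>Outer regularity is applied to the finite measure \<open>window V\<close>, with
  \<open>V\<close> a ball containing \<open>A\<close>. Intersecting with \<open>V\<close> transfers
  the result to \<open>M\<close> and keeps the open set bounded.\<close>

lemma outer_approx:
  assumes A: "A \<in> sets borel" "bounded A" and e: "e > 0"
  obtains U where "open U" "bounded U" "A \<subseteq> U" "measure M (U - A) < e"
proof -
  obtain r where r: "A \<subseteq> ball 0 r" using A(2) by (meson bounded_subset_ballD)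
  define V where "V = ball (0::'v) r"
  have V: "open V" "bounded V" by (auto simp: V_def)
  interpret W: finite_measure "window V" using V by (intro finite_window) auto
  have ms: "emeasure (window V) B = emeasure M (V \<inter> B)" if [measurable]: "B \<in> sets borel" for B
    using V unfolding window_def by (intro emeasure_restricted) auto
  have "emeasure (window V) A = (INF U \<in> {U. A \<subseteq> U \<and> open U}. emeasure (window V) U)"
    using A(1) W.emeasure_finite by (intro outer_regular) auto
  moreover have "emeasure (window V) A < emeasure (window V) A + ennreal e"
    using e W.emeasure_finite[of A] by (cases "emeasure (window V) A") (auto simp: ennreal_less_iff simp flip: ennreal_plus)
  ultimately obtain U where U: "A \<subseteq> U" "open U" "emeasure (window V) U < emeasure (window V) A + ennreal e"
    by (metis (mono_tags, lifting) INF_less_iff mem_Collect_eq)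
  have AV: "A \<subseteq> V" using r by (simp add: V_def)
  have bd: "bounded (V \<inter> U)" using V by (meson Int_lower1 bounded_subset)
  have fin: "emeasure M (V \<inter> U) < \<infinity>" "emeasure M A < \<infinity>"
    using emeasure_bounded_finite bd A by auto
  have "emeasure M (V \<inter> U) < emeasure M A + ennreal e"
    using U(3) AV U(2) A(1) by (simp add: ms Int_absorb1)
  then have "measure M (V \<inter> U) < measure M A + e"
    using fin e by (simp add: emeasure_eq_ennreal_measure less_top ennreal_less_iff flip: ennreal_plus)
  moreover have "measure M (V \<inter> U - A) = measure M (V \<inter> U) - measure M A"
    using fin U V AV A by (intro measure_Diff) auto
  ultimately show thesis
    using that[of "V \<inter> U"] U V AV bd by auto
qed

lemma shift_diff_tendsto:
  assumes A: "A \<in> sets borel" "bounded A"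
  shows "(shift_diff A \<longlongrightarrow> 0) (at 0)"
proof (rule tendstoI)
  fix e :: real assume e: "e > 0"
  \<comment> \<open>\<open>shift_diff_le\<close> counts \<open>U - A\<close> twice, which leaves
    half of \<open>e\<close> for the open set.\<close>
  obtain U where U: "open U" "bounded U" "A \<subseteq> U" "measure M (U - A) < e / 4"
    using outer_approx[OF A, of "e / 4"] e by auto
  have "\<forall>\<^sub>F t in at 0. dist (shift_diff U t) 0 < e / 2"
    using tendstoD[OF shift_diff_open[OF U(1,2)], of "e / 2"] e by simp
  then show "\<forall>\<^sub>F t in at 0. dist (shift_diff A t) 0 < e"
  proof (rule eventually_mono)
    fix t assume "dist (shift_diff U t) 0 < e / 2"
    moreover have "shift_diff A t \<ge> 0" unfolding shift_diff_def by simp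
    moreover have "shift_diff A t \<le> shift_diff U t + 2 * measure M (U - A)"
      using A U by (intro shift_diff_le) auto
    ultimately show "dist (shift_diff A t) 0 < e" using U(4) by simp
  qed
qed

end

section \<open>The spectral inequality\<close>

text \<open>The space itself indexes its characters. Additivity is asked for in the first argument
  only: the second is just integrated against the auxiliary measure \<open>\<nu>\<close>.\<close>

locale haar_pairing = haar_space M
  for M :: "'v::{heine_borel, second_countable_topology, topological_ab_group_add} measure" +
  fixes chi :: "'v \<Rightarrow> 'v \<Rightarrow> complex"
  assumes chi_add: "chi (x + y) u = chi x u * chi y u"
    and chi_norm: "norm (chi x u) = 1"
    and chi_measurable: "(\<lambda>(x, u). chi x u) \<in> borel_measurable (borel \<Otimes>\<^sub>M borel)"
begin

lemma chi_measurable' [measurable]: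
  assumes [measurable]: "f \<in> measurable N borel" "g \<in> measurable N borel"
  shows "(\<lambda>w. chi (f w) (g w)) \<in> borel_measurable N"
  using measurable_compose[OF _ chi_measurable, of "\<lambda>w. (f w, g w)" N] by simp

lemma chi_zero: "chi 0 u = 1"
  using chi_add[of 0 0 u] chi_norm[of 0 u] by (cases "chi 0 u = 0") auto

lemma chi_minus: "chi (- x) u = cnj (chi x u)"
proof -
  have "chi x u * chi (- x) u = 1" by (simp add: chi_zero flip: chi_add)
  moreover have "chi x u * cnj (chi x u) = 1"
    using chi_norm[of x u] by (simp add: complex_norm_square[symmetric])
  ultimately show ?thesis
    by (metis mult_cancel_left mult_zero_left zero_neq_one)
qed

lemma chi_diff: "chi (x - y) u = chi x u * cnj (chi y u)"
  using chi_add[of x "- y" u] by (simp add: chi_minus)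

text \<open>Expanding both transforms gives integrals over \<open>x\<close>, \<open>y\<close>,
  \<open>z\<close> whose phases combine to \<open>chi (z - y - x) u\<close>; the integral over
  \<open>u\<close> then moves inwards past one finite measure at a time. The formula serves twice,
  for the given \<open>\<mu>\<close> and for the point mass at 0.\<close>

lemma fourier_form:
  fixes g :: "'v \<Rightarrow> real"
  assumes N: "finite_measure N" "sets N = sets borel" and \<mu>: "finite_measure \<mu>" "sets \<mu> = sets borel"
    and \<nu>: "finite_measure \<nu>" "sets \<nu> = sets borel"
    and g [measurable]: "g \<in> borel_measurable borel" and C: "\<And>x. \<bar>g x\<bar> \<le> C"
  defines "G \<equiv> \<lambda>u. \<integral>y. g y * chi y u \<partial>N"
  shows "(\<integral>u. (\<integral>x. cnj (chi x u) \<partial>\<mu>) * (G u * cnj (G u)) \<partial>\<nu>) =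
    (\<integral>x. \<integral>y. \<integral>z. of_real (g y * g z) * (\<integral>u. chi (z - y - x) u \<partial>\<nu>) \<partial>N \<partial>N \<partial>\<mu>)"
proof -
  note [measurable_cong] = N(2) \<mu>(2) \<nu>(2)
  interpret N: finite_measure N by fact
  interpret \<mu>: finite_measure \<mu> by fact
  interpret \<nu>: finite_measure \<nu> by fact
  have C0: "C \<ge> 0" using C[of 0] by linarith
  let ?h = "\<lambda>u x y z. of_real (g y * g z) * chi (z - y - x) u"
  have nh: "norm (?h u x y z) \<le> C * C" for u x y z
    using C[of y] C[of z] C0 by (simp add: norm_mult chi_norm mult_mono)
  define m where "m = measure N (space N)"
  have m: "m \<ge> 0" by (simp add: m_def)
  have n1: "norm (\<integral>z. ?h u x y z \<partial>N) \<le> C * C * m" for u x y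
    unfolding m_def using C0 by (intro norm_integral_le_const N nh) auto
  have n2: "norm (\<integral>y. \<integral>z. ?h u x y z \<partial>N \<partial>N) \<le> C * C * m * m" for u x
    unfolding m_def by (rule norm_integral_le_const[OF N(1) n1[unfolded m_def]]) (simp add: C0)
  have "(\<integral>x. cnj (chi x u) \<partial>\<mu>) * (G u * cnj (G u)) = (\<integral>x. \<integral>y. \<integral>z. ?h u x y z \<partial>N \<partial>N \<partial>\<mu>)" for u
  proof -
    have "cnj (G u) = (\<integral>y. cnj (g y * chi y u) \<partial>N)"
      unfolding G_def by (rule Bochner_Integration.integral_cnj[symmetric])
    then have "G u * cnj (G u) = (\<integral>y. cnj (g y * chi y u) * G u \<partial>N)"
      by (simp add: mult.commute)
    also have "\<dots> = (\<integral>y. \<integral>z. cnj (g y * chi y u) * (g z * chi z u) \<partial>N \<partial>N)"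
      unfolding G_def by simp
    finally have "(\<integral>x. cnj (chi x u) \<partial>\<mu>) * (G u * cnj (G u)) =
      (\<integral>x. \<integral>y. \<integral>z. cnj (chi x u) * (cnj (g y * chi y u) * (g z * chi z u)) \<partial>N \<partial>N \<partial>\<mu>)" by simp
    then show ?thesis
      by (simp add: chi_diff mult_ac)
  qed
  then have "(\<integral>u. (\<integral>x. cnj (chi x u) \<partial>\<mu>) * (G u * cnj (G u)) \<partial>\<nu>) =
      (\<integral>u. \<integral>x. \<integral>y. \<integral>z. ?h u x y z \<partial>N \<partial>N \<partial>\<mu> \<partial>\<nu>)" by simp
  also have "\<dots> = (\<integral>x. \<integral>u. \<integral>y. \<integral>z. ?h u x y z \<partial>N \<partial>N \<partial>\<nu> \<partial>\<mu>)"
    by (rule bounded_integral_swap[OF \<nu>(1) \<mu>(1) _ n2]) measurable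
  also have "\<dots> = (\<integral>x. \<integral>y. \<integral>u. \<integral>z. ?h u x y z \<partial>N \<partial>\<nu> \<partial>N \<partial>\<mu>)"
    by (intro Bochner_Integration.integral_cong refl bounded_integral_swap[OF \<nu>(1) N(1) _ n1]) measurable
  also have "\<dots> = (\<integral>x. \<integral>y. \<integral>z. \<integral>u. ?h u x y z \<partial>\<nu> \<partial>N \<partial>N \<partial>\<mu>)"
    by (intro Bochner_Integration.integral_cong refl bounded_integral_swap[OF \<nu>(1) N(1) _ nh]) measurable
  finally show ?thesis by simp
qed

text \<open>No concentration enters here: every finite \<open>\<nu>\<close> with real transform
  \<open>k\<close> gives a valid inequality. The passage to values of the autocorrelation is a
  separate limit.\<close>

lemma spectral_bound:
  fixes g :: "'v \<Rightarrow> real"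
  assumes N: "finite_measure N" "sets N = sets borel" and \<mu>: "prob_space \<mu>" "sets \<mu> = sets borel"
    and \<nu>: "finite_measure \<nu>" "sets \<nu> = sets borel"
    and g [measurable]: "g \<in> borel_measurable borel" and C: "\<And>x. \<bar>g x\<bar> \<le> C"
    and k: "\<And>x. (\<integral>u. chi x u \<partial>\<nu>) = complex_of_real (k x)"
    and l: "\<And>u. l \<le> Re (\<integral>x. cnj (chi x u) \<partial>\<mu>)"
  shows "l * (\<integral>y. \<integral>z. g y * g z * k (z - y) \<partial>N \<partial>N)
    \<le> (\<integral>x. \<integral>y. \<integral>z. g y * g z * k (z - y - x) \<partial>N \<partial>N \<partial>\<mu>)"
proof -
  note [measurable_cong] = N(2) \<mu>(2) \<nu>(2)
  interpret N: finite_measure N by fact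
  interpret \<mu>: prob_space \<mu> by fact
  interpret \<nu>: finite_measure \<nu> by fact
  define G where "G u = (\<integral>y. g y * chi y u \<partial>N)" for u
  define m where "m u = (\<integral>x. cnj (chi x u) \<partial>\<mu>)" for u
  have C0: "C \<ge> 0" using C[of 0] by linarith
  have [measurable]: "G \<in> borel_measurable borel" "m \<in> borel_measurable borel"
    unfolding G_def[abs_def] m_def[abs_def] by measurable
  have fm: "finite_measure \<mu>" by unfold_locales
  have A: "(\<integral>u. m u * (G u * cnj (G u)) \<partial>\<nu>)
      = complex_of_real (\<integral>x. \<integral>y. \<integral>z. g y * g z * k (z - y - x) \<partial>N \<partial>N \<partial>\<mu>)"
    using fourier_form[OF N fm \<mu>(2) \<nu> g C] by (simp add: k m_def G_def flip: of_real_mult)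
  \<comment> \<open>The point mass at 0 has transform 1, so the same formula evaluates the integral
    of \<open>|G|\<^sup>2\<close> alone.\<close>
  have ret: "finite_measure (return borel (0::'v))"
    by (intro prob_space.finite_measure prob_space_return) simp
  have r: "(\<integral>x. f x \<partial>return borel (0::'v)) = f 0" if "f \<in> borel_measurable borel" for f :: "'v \<Rightarrow> 'b::{banach,second_countable_topology}"
    using that by (intro integral_return) auto
  have "(\<integral>u. (G u * cnj (G u)) \<partial>\<nu>) = (\<integral>u. (\<integral>x. cnj (chi x u) \<partial>return borel 0) * (G u * cnj (G u)) \<partial>\<nu>)"
    by (subst r) (simp_all add: chi_zero)
  also have "\<dots> = (\<integral>x. \<integral>y. \<integral>z. of_real (g y * g z) * (\<integral>u. chi (z - y - x) u \<partial>\<nu>) \<partial>N \<partial>N \<partial>return borel 0)"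
    unfolding G_def by (rule fourier_form[OF N ret _ \<nu> g C]) simp
  also have "\<dots> = (\<integral>y. \<integral>z. of_real (g y * g z) * (\<integral>u. chi (z - y - 0) u \<partial>\<nu>) \<partial>N \<partial>N)"
    by (rule r) measurable
  also have "\<dots> = complex_of_real (\<integral>y. \<integral>z. g y * g z * k (z - y) \<partial>N \<partial>N)"
    by (simp add: k flip: of_real_mult)
  finally have B: "(\<integral>u. (G u * cnj (G u)) \<partial>\<nu>) = complex_of_real (\<integral>y. \<integral>z. g y * g z * k (z - y) \<partial>N \<partial>N)" .
  have nG: "norm (G u) \<le> C * measure N (space N)" for u
    unfolding G_def using C0 C by (intro norm_integral_le_const N) (auto simp: norm_mult chi_norm)
  have nm: "norm (m u) \<le> 1" for u
    using norm_integral_le_const[OF fm, of "\<lambda>x. cnj (chi x u)" 1]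
    by (simp add: m_def chi_norm \<mu>.prob_space)
  let ?D = "C * measure N (space N) * (C * measure N (space N))"
  have nn: "norm (G u * cnj (G u)) \<le> ?D" for u
    using nG[of u] order_trans[OF norm_ge_zero nG[of u]] by (simp only: norm_mult complex_mod_cnj) (intro mult_mono, auto)
  have i1: "integrable \<nu> (\<lambda>u. G u * cnj (G u))"
    using nn by (intro integrable_finite_bounded \<nu>) auto
  have i2: "integrable \<nu> (\<lambda>u. m u * (G u * cnj (G u)))"
  proof (intro integrable_finite_bounded \<nu>)
    show "norm (m u * (G u * cnj (G u))) \<le> 1 * ?D" for u
      unfolding norm_mult[of "m u"] by (intro mult_mono nm nn) auto
  qed measurable
  have "0 \<le> (\<integral>u. Re (m u * (G u * cnj (G u))) - l * Re (G u * cnj (G u)) \<partial>\<nu>)"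
  proof (intro integral_nonneg_AE AE_I2)
    fix u
    have e: "G u * cnj (G u) = of_real ((cmod (G u))\<^sup>2)"
      by (rule complex_norm_square[symmetric])
    have "Re (m u * (G u * cnj (G u))) - l * Re (G u * cnj (G u)) = (Re (m u) - l) * (cmod (G u))\<^sup>2"
      unfolding e by (simp add: algebra_simps)
    then show "0 \<le> Re (m u * (G u * cnj (G u))) - l * Re (G u * cnj (G u))"
      using l[of u] by (simp add: m_def)
  qed
  also have "\<dots> = Re (\<integral>u. m u * (G u * cnj (G u)) \<partial>\<nu>) - l * Re (\<integral>u. (G u * cnj (G u)) \<partial>\<nu>)"
    using i1 i2 by (simp del: times_complex.sel)
  finally show ?thesis unfolding A B by simp
qed

section \<open>Autocorrelation and its smoothing by a kernel\<close>

definition autocorr :: "('v \<Rightarrow> real) \<Rightarrow> 'v \<Rightarrow> real" where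
  "autocorr g x = (\<integral>y. g y * g (y + x) \<partial>M)"

text \<open>Substituting \<open>z = t + y + x\<close> turns the kernel form into an average of
  translates of the autocorrelation with weight \<open>k t\<close>. Since \<open>D\<close> holds
  every difference that matters, \<open>t\<close> also runs over a finite measure and the integrals
  can be exchanged.\<close>

lemma smoothed_form:
  fixes g :: "'v \<Rightarrow> real"
  assumes \<mu>: "prob_space \<mu>" "sets \<mu> = sets borel" and S: "AE x in \<mu>. x \<in> S"
    and g [measurable]: "g \<in> borel_measurable borel" and C: "\<And>x. \<bar>g x\<bar> \<le> C"
    and B: "B \<in> sets borel" "bounded B" "\<And>x. x \<notin> B \<Longrightarrow> g x = 0"
    and D: "D \<in> sets borel" "bounded D" "\<And>x y z. x \<in> S \<Longrightarrow> y \<in> B \<Longrightarrow> z \<in> B \<Longrightarrow> z - y - x \<in> D"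
    and k [measurable]: "k \<in> borel_measurable borel" and k1: "\<And>x. \<bar>k x\<bar> \<le> 1"
  shows "(\<integral>x. \<integral>y. \<integral>z. g y * g z * k (z - y - x) \<partial>window B \<partial>window B \<partial>\<mu>)
    = (\<integral>t. k t * (\<integral>x. autocorr g (x + t) \<partial>\<mu>) \<partial>window D)"
proof -
  note [measurable_cong] = \<mu>(2)
  note [measurable] = B(1) D(1)
  interpret N: finite_measure "window B" using B by (intro finite_window)
  interpret W: finite_measure "window D" using D by (intro finite_window)
  interpret \<mu>: prob_space \<mu> by fact
  have fm: "finite_measure \<mu>" by unfold_locales
  have C0: "C \<ge> 0" using C[of 0] by linarith
  have ac: "(\<integral>y. g y * g (y + x) \<partial>window B) = autocorr g x" for x
    unfolding autocorr_def using B by (intro integral_window_support) auto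
  have [measurable]: "autocorr g \<in> borel_measurable borel"
    unfolding ac[abs_def, symmetric] by measurable
  have gg: "\<bar>g y * g z * k x\<bar> \<le> C * C" for x y z
  proof -
    have "\<bar>g y * g z * k x\<bar> \<le> C * C * 1"
      unfolding abs_mult by (intro mult_mono C k1) (auto simp: C0)
    then show ?thesis by simp
  qed
  have nac: "\<bar>autocorr g x\<bar> \<le> C * C * measure (window B) (space (window B))" for x
    unfolding ac[symmetric] real_norm_def[symmetric]
    by (intro norm_integral_le_const N.finite_measure_axioms)
       (auto simp: C0 abs_mult intro!: mult_mono C)
  have inner: "(\<integral>y. \<integral>z. g y * g z * k (z - y - x) \<partial>window B \<partial>window B)
      = (\<integral>t. k t * autocorr g (x + t) \<partial>window D)" if x: "x \<in> S" for x
  proof -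
    have "(\<integral>z. g y * g z * k (z - y - x) \<partial>window B) = (\<integral>t. g y * g (y + (x + t)) * k t \<partial>window D)" for y
    proof -
      have "(\<integral>z. g y * g z * k (z - y - x) \<partial>window B) = (\<integral>z. g y * g z * k (z - y - x) \<partial>M)"
        using B by (intro integral_window_support) auto
      also have "\<dots> = (\<integral>t. g y * g (t + (y + x)) * k (t + (y + x) - y - x) \<partial>M)"
        by (rule integral_translate[symmetric]) measurable
      also have "\<dots> = (\<integral>t. g y * g (y + (x + t)) * k t \<partial>M)"
        by (simp add: algebra_simps)
      also have "\<dots> = (\<integral>t. g y * g (y + (x + t)) * k t \<partial>window D)"
      proof (intro integral_window_support[symmetric])
        fix t assume t: "t \<notin> D"
        show "g y * g (y + (x + t)) * k t = 0"
          using B(3)[of y] B(3)[of "y + (x + t)"] D(3)[OF x, of y "y + (x + t)"] t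
          by (auto simp: algebra_simps)
      qed measurable
      finally show ?thesis .
    qed
    then have "(\<integral>y. \<integral>z. g y * g z * k (z - y - x) \<partial>window B \<partial>window B)
        = (\<integral>y. \<integral>t. g y * g (y + (x + t)) * k t \<partial>window D \<partial>window B)" by simp
    also have "\<dots> = (\<integral>t. \<integral>y. g y * g (y + (x + t)) * k t \<partial>window B \<partial>window D)"
      using gg by (intro bounded_integral_swap[where C="C * C"] N.finite_measure_axioms W.finite_measure_axioms) auto
    also have "\<dots> = (\<integral>t. k t * autocorr g (x + t) \<partial>window D)"
      by (simp add: ac mult.commute)
    finally show ?thesis .
  qed
  have "(\<integral>x. \<integral>y. \<integral>z. g y * g z * k (z - y - x) \<partial>window B \<partial>window B \<partial>\<mu>)
      = (\<integral>x. \<integral>t. k t * autocorr g (x + t) \<partial>window D \<partial>\<mu>)"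
    using S by (intro integral_cong_AE) (auto intro: inner)
  also have "\<dots> = (\<integral>t. \<integral>x. k t * autocorr g (x + t) \<partial>\<mu> \<partial>window D)"
  proof (intro bounded_integral_swap fm W.finite_measure_axioms)
    show "norm (k t * autocorr g (x + t)) \<le> 1 * (C * C * measure (window B) (space (window B)))" for x t
      unfolding real_norm_def abs_mult[of "k t"] by (intro mult_mono nac k1) auto
  qed measurable
  finally show ?thesis by simp
qed

text \<open>Inside the ball \<open>F\<close> varies by at most \<open>e\<close>; outside,
  \<open>|F|\<close> is at most \<open>C\<close> and \<open>k\<close> has at most \<open>e\<close>
  times its inner mass. This explains \<open>1 + C\<close>. The inner mass stays as a factor because
  \<open>k\<close> is not normalised.\<close>

lemma approx_unit_integral:
  fixes F :: "'v \<Rightarrow> real"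
  assumes k [measurable]: "k \<in> borel_measurable borel" and k1: "\<And>x. 0 \<le> k x" "\<And>x. k x \<le> 1"
    and F [measurable]: "F \<in> borel_measurable borel" and FC: "\<And>t. \<bar>F t\<bar> \<le> C"
    and D: "D \<in> sets borel" "bounded D" "ball 0 d \<subseteq> D"
    and near: "\<And>t. t \<in> ball 0 d \<Longrightarrow> \<bar>F t - F 0\<bar> \<le> e"
    and tail: "(\<integral>t. k t \<partial>window (D - ball 0 d)) \<le> e * (\<integral>t. k t \<partial>window (ball 0 d))"
  shows "\<bar>(\<integral>t. k t * F t \<partial>window D) - F 0 * (\<integral>t. k t \<partial>window (ball 0 d))\<bar>
    \<le> (1 + C) * e * (\<integral>t. k t \<partial>window (ball 0 d))"
proof -
  note [measurable] = D(1)
  have [measurable]: "ball (0::'v) d \<in> sets borel" by simp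
  have C0: "C \<ge> 0" using FC[of 0] by linarith
  have bd: "bounded (D - ball 0 d)" "bounded (ball (0::'v) d)" using D(2) by (auto intro: bounded_subset)
  have fin: "finite_measure (window (D - ball 0 d))" "finite_measure (window (ball 0 d))"
    using bd by (auto intro!: finite_window)
  have kF: "\<bar>k t * F t\<bar> \<le> C" for t
    using mult_mono[of "\<bar>k t\<bar>" 1 "\<bar>F t\<bar>" C] k1[of t] FC[of t] by (simp add: abs_mult)
  have iM: "integrable M (\<lambda>t. indicat_real A t * (k t * F t))" if "A \<in> sets borel" "bounded A" for A
    using that kF C0 by (intro integrable_bounded_support[where B=A and C=C]) (auto simp: indicator_def)
  have ik: "integrable (window A) k" if "finite_measure (window A)" for A
    using that k1 by (intro integrable_finite_bounded[where C=1]) auto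
  have ikF: "integrable (window A) (\<lambda>t. k t * F t)" if "finite_measure (window A)" for A
    using that kF by (intro integrable_finite_bounded[where C=C]) auto
  have "(\<integral>t. k t * F t \<partial>window D) = (\<integral>t. indicat_real (ball 0 d) t * (k t * F t)
      + indicat_real (D - ball 0 d) t * (k t * F t) \<partial>M)"
    using D(3) by (subst integral_window) (auto intro!: Bochner_Integration.integral_cong simp: indicator_def)
  also have "\<dots> = (\<integral>t. k t * F t \<partial>window (ball 0 d)) + (\<integral>t. k t * F t \<partial>window (D - ball 0 d))"
    using bd by (subst Bochner_Integration.integral_add[OF iM iM]) (auto simp: integral_window)
  finally have split: "(\<integral>t. k t * F t \<partial>window D) =
    (\<integral>t. k t * F t \<partial>window (ball 0 d)) + (\<integral>t. k t * F t \<partial>window (D - ball 0 d))" .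
  have "\<bar>(\<integral>t. k t * F t \<partial>window (D - ball 0 d))\<bar> \<le> (\<integral>t. \<bar>k t * F t\<bar> \<partial>window (D - ball 0 d))"
    using integral_norm_bound[of "window (D - ball 0 d)" "\<lambda>t. k t * F t"] by simp
  also have "\<dots> \<le> (\<integral>t. C * k t \<partial>window (D - ball 0 d))"
    using FC k1 by (intro integral_mono integrable_abs ikF Bochner_Integration.integrable_mult_right ik fin)
      (auto simp: abs_mult mult.commute[of C] intro!: mult_left_mono)
  also have "\<dots> = C * (\<integral>t. k t \<partial>window (D - ball 0 d))" by simp
  also have "\<dots> \<le> C * (e * (\<integral>t. k t \<partial>window (ball 0 d)))"
    using tail C0 by (rule mult_left_mono)
  finally have far: "\<bar>(\<integral>t. k t * F t \<partial>window (D - ball 0 d))\<bar> \<le> C * (e * (\<integral>t. k t \<partial>window (ball 0 d)))" .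
  have i3: "integrable (window (ball 0 d)) (\<lambda>t. F 0 * k t)" using fin ik by simp
  have i4: "integrable (window (ball 0 d)) (\<lambda>t. k t * F t - F 0 * k t)"
    using fin ikF i3 by (intro Bochner_Integration.integrable_diff) auto
  have "(\<integral>t. k t * F t \<partial>window (ball 0 d)) - F 0 * (\<integral>t. k t \<partial>window (ball 0 d))
      = (\<integral>t. k t * F t - F 0 * k t \<partial>window (ball 0 d))"
    using fin ikF i3 by simp
  also have "\<bar>\<dots>\<bar> \<le> (\<integral>t. \<bar>k t * F t - F 0 * k t\<bar> \<partial>window (ball 0 d))"
    using integral_norm_bound[of "window (ball 0 d)" "\<lambda>t. k t * F t - F 0 * k t"] by simp
  also have "\<dots> = (\<integral>t. indicator (ball 0 d) t * \<bar>k t * F t - F 0 * k t\<bar> \<partial>M)"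
    by (simp add: integral_window)
  also have "\<dots> \<le> (\<integral>t. indicator (ball 0 d) t * (e * k t) \<partial>M)"
  proof (rule integral_mono)
    show "integrable M (\<lambda>t. indicat_real (ball 0 d) t * \<bar>k t * F t - F 0 * k t\<bar>)"
    proof (intro integrable_bounded_support[where B="ball 0 d" and C="C + C"])
      have "\<bar>F 0 * k t\<bar> \<le> C" for t
        using mult_mono[of "\<bar>F 0\<bar>" C "\<bar>k t\<bar>" 1] k1[of t] FC[of 0] C0 by (simp add: abs_mult)
      then have "\<bar>k t * F t - F 0 * k t\<bar> \<le> C + C" for t
        using kF[of t] by (smt (verit))
      then show "norm (indicat_real (ball 0 d) t * \<bar>k t * F t - F 0 * k t\<bar>) \<le> C + C" for t
        using C0 by (simp add: indicator_def)
      show "(\<lambda>t. indicat_real (ball 0 d) t * \<bar>k t * F t - F 0 * k t\<bar>) \<in> borel_measurable borel"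
        by measurable
    qed (use bd in auto)
    show "integrable M (\<lambda>t. indicat_real (ball 0 d) t * (e * k t))"
      using k1 bd by (intro integrable_bounded_support[where B="ball 0 d" and C="\<bar>e\<bar>"])
        (auto simp: indicator_def abs_mult intro!: mult_left_le)
    fix t
    have "\<bar>k t * F t - F 0 * k t\<bar> = k t * \<bar>F t - F 0\<bar>"
      using k1(1)[of t] by (simp add: abs_mult[symmetric] algebra_simps abs_mult_pos')
    moreover have "t \<in> ball 0 d \<Longrightarrow> k t * \<bar>F t - F 0\<bar> \<le> k t * e"
      using near[of t] k1(1)[of t] by (intro mult_left_mono)
    ultimately show "indicat_real (ball 0 d) t * \<bar>k t * F t - F 0 * k t\<bar> \<le> indicat_real (ball 0 d) t * (e * k t)"
      by (auto simp: indicator_def mult.commute)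
  qed
  also have "\<dots> = e * (\<integral>t. k t \<partial>window (ball 0 d))"
    by (simp add: integral_window mult.left_commute)
  finally show ?thesis using far unfolding split by (simp add: algebra_simps abs_le_iff)
qed

end

text \<open>Concentration of \<open>k\<close> is measured relative to its mass in the ball and only
  on a compact \<open>D\<close> fixed beforehand, so neither normalisation nor decay at infinity is
  demanded.\<close>

locale haar_pairing_approx = haar_pairing +
  assumes approx_unit: "\<lbrakk>0 < d; 0 < e; compact D\<rbrakk> \<Longrightarrow>
    \<exists>\<nu> k. prob_space \<nu> \<and> sets \<nu> = sets borel \<and> (\<forall>x. (\<integral>u. chi x u \<partial>\<nu>) = complex_of_real (k x)) \<and>
      (\<forall>x. 0 \<le> k x) \<and> 0 < (\<integral>t. k t \<partial>window (ball 0 d)) \<and>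
      (\<integral>t. k t \<partial>window (D - ball 0 d)) \<le> e * (\<integral>t. k t \<partial>window (ball 0 d))"
begin

text \<open>\<open>spectral_bound\<close> compares averages of the autocorrelation with weight
  \<open>k\<close>; dividing by the mass of \<open>k\<close> near 0 and letting it concentrate
  recovers point values. The hypothesis on translates of \<open>g\<close> makes the autocorrelation
  uniformly continuous.\<close>

lemma autocorr_integral_ge:
  fixes g :: "'a \<Rightarrow> real"
  assumes \<mu>: "prob_space \<mu>" "sets \<mu> = sets borel" and S: "AE x in \<mu>. x \<in> S" "bounded S"
    and g [measurable]: "g \<in> borel_measurable borel" and C: "\<And>x. \<bar>g x\<bar> \<le> C"
    and B: "B \<in> sets borel" "bounded B" "\<And>x. x \<notin> B \<Longrightarrow> g x = 0"
    and sh: "((\<lambda>t. \<integral>y. \<bar>g (y + t) - g y\<bar> \<partial>M) \<longlongrightarrow> 0) (at 0)"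
    and l: "\<And>u. l \<le> Re (\<integral>x. cnj (chi x u) \<partial>\<mu>)"
  shows "l * autocorr g 0 \<le> (\<integral>x. autocorr g x \<partial>\<mu>)"
proof -
  note [measurable_cong] = \<mu>(2)
  note [measurable] = B(1)
  interpret N: finite_measure "window B" using B by (intro finite_window)
  interpret \<mu>: prob_space \<mu> by fact
  have fm: "finite_measure \<mu>" by unfold_locales
  have C0: "C \<ge> 0" using C[of 0] by linarith
  define w where "w t = (\<integral>y. \<bar>g (y + t) - g y\<bar> \<partial>M)" for t
  define K where "K = C * C * measure (window B) (space (window B))"
  have K0: "K \<ge> 0" unfolding K_def by simp
  have ac: "(\<integral>y. g y * g (y + x) \<partial>window B) = autocorr g x" for x
    unfolding autocorr_def using B by (intro integral_window_support) auto
  have acm [measurable]: "autocorr g \<in> borel_measurable borel"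
    unfolding ac[abs_def, symmetric] by measurable
  have nac: "\<bar>autocorr g x\<bar> \<le> K" for x
    unfolding K_def ac[symmetric] real_norm_def[symmetric]
    by (intro norm_integral_le_const N.finite_measure_axioms)
       (auto simp: C0 abs_mult intro!: mult_mono C)
  have gi: "integrable M (\<lambda>y. g (y + t))" for t
  proof -
    have "integrable (distr M borel (\<lambda>y. y + t)) g"
      unfolding distr_translate using B C by (intro integrable_bounded_support[where C=C and B=B]) auto
    then show ?thesis by (subst (asm) integrable_distr_eq) auto
  qed
  have gbi: "integrable M (\<lambda>y. g y * f y)"
    if "f \<in> borel_measurable borel" "\<And>y. \<bar>f y\<bar> \<le> b" for f b
  proof (intro integrable_bounded_support[where C="C * b" and B=B] B)
    show "norm (g x * f x) \<le> C * b" for x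
      using C[of x] that(2)[of x] C0 by (auto simp: abs_mult intro!: mult_mono)
  qed (use that B in auto)
  \<comment> \<open>Translation invariance removes \<open>x\<close> from the bound, so the same
    modulus of continuity passes to the average \<open>F\<close> over \<open>\<mu>\<close>.\<close>
  have lip: "\<bar>autocorr g (x + t) - autocorr g x\<bar> \<le> C * w t" for x t
  proof -
    have wi: "integrable M (\<lambda>y. \<bar>g (y + (x + t)) - g (y + x)\<bar>)"
      using gi by (intro integrable_abs Bochner_Integration.integrable_diff)
    have "autocorr g (x + t) - autocorr g x = (\<integral>y. g y * g (y + (x + t)) - g y * g (y + x) \<partial>M)"
      unfolding autocorr_def using C by (intro Bochner_Integration.integral_diff[symmetric] gbi) auto
    also have "\<dots> = (\<integral>y. g y * (g (y + (x + t)) - g (y + x)) \<partial>M)"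
      by (simp add: algebra_simps)
    also have "\<bar>\<dots>\<bar> \<le> (\<integral>y. \<bar>g y * (g (y + (x + t)) - g (y + x))\<bar> \<partial>M)"
      using integral_norm_bound[of M "\<lambda>y. g y * (g (y + (x + t)) - g (y + x))"] by simp
    also have "\<dots> \<le> (\<integral>y. C * \<bar>g (y + (x + t)) - g (y + x)\<bar> \<partial>M)"
    proof (rule integral_mono)
      have "\<bar>g a - g b\<bar> \<le> C + C" for a b using C[of a] C[of b] by linarith
      then show "integrable M (\<lambda>y. \<bar>g y * (g (y + (x + t)) - g (y + x))\<bar>)"
        by (intro integrable_abs gbi[of _ "C + C"]) auto
      show "\<bar>g y * (g (y + (x + t)) - g (y + x))\<bar> \<le> C * \<bar>g (y + (x + t)) - g (y + x)\<bar>" for y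
        unfolding abs_mult by (intro mult_right_mono C) auto
    qed (use wi in auto)
    also have "\<dots> = C * (\<integral>y. \<bar>g ((y + x) + t) - g (y + x)\<bar> \<partial>M)" by (simp add: add.assoc)
    also have "(\<integral>y. \<bar>g ((y + x) + t) - g (y + x)\<bar> \<partial>M) = w t"
      unfolding w_def by (rule integral_translate) measurable
    finally show ?thesis .
  qed
  \<comment> \<open>Inserting 0 into \<open>S\<close> lets one \<open>D\<close> serve both
    \<open>\<mu>\<close> and the point mass at 0. The unit ball is added so that
    \<open>ball 0 d'\<close> lies in \<open>D\<close>.\<close>
  let ?cl = "closure B \<times> closure B \<times> closure (insert 0 S)"
  define D where "D = (\<lambda>(z, y, x). z - y - x) ` ?cl \<union> cball 0 1"
  have D: "compact D"
    unfolding D_def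
  proof (intro compact_Un compact_continuous_image compact_Times compact_cball)
    show "continuous_on ?cl (\<lambda>(z, y, x). z - y - x)"
      unfolding case_prod_unfold by (intro continuous_intros)
  qed (use B S in \<open>auto simp: compact_closure\<close>)
  have Db: "D \<in> sets borel" "bounded D" using D by (auto intro: compact_imp_bounded borel_compact)
  have Dm: "z - y - x \<in> D" if "x \<in> insert 0 S" "y \<in> B" "z \<in> B" for x y z
    unfolding D_def using that closure_subset[of B] closure_subset[of "insert 0 S"]
    by (intro UnI1 image_eqI[where x="(z, y, x)"]) auto
  define F where "F t = (\<integral>x. autocorr g (x + t) \<partial>\<mu>)" for t
  have [measurable]: "F \<in> borel_measurable borel" unfolding F_def[abs_def] by measurable
  have FK: "\<bar>F t\<bar> \<le> K" for t
    using norm_integral_le_const[OF fm, of "\<lambda>x. autocorr g (x + t)" K] nac K0 \<mu>.prob_space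
    by (simp add: F_def)
  have Fl: "\<bar>F t - F 0\<bar> \<le> C * w t" for t
  proof -
    have "F t - F 0 = (\<integral>x. autocorr g (x + t) - autocorr g x \<partial>\<mu>)"
      unfolding F_def using nac
      by (subst Bochner_Integration.integral_diff) (auto intro!: integrable_finite_bounded[where C=K] fm)
    also have "\<bar>\<dots>\<bar> \<le> C * w t"
      using norm_integral_le_const[OF fm, of "\<lambda>x. autocorr g (x + t) - autocorr g x" "C * w t"]
        lip[of _ t] C0 \<mu>.prob_space by (simp add: w_def)
    finally show ?thesis .
  qed
  have ret: "prob_space (return borel (0::'a))" "sets (return borel (0::'a)) = sets borel"
    by (auto intro: prob_space_return)
  have "AE x in return borel (0::'a). x = 0" by (subst AE_return) auto
  then have AE0: "AE x in return borel 0. x \<in> insert 0 S" by auto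
  have main: "l * autocorr g 0 \<le> F 0 + e * ((1 + K) * (1 + \<bar>l\<bar>))" if e: "e > 0" for e
  proof -
    \<comment> \<open>\<open>C + 1\<close> in place of \<open>C\<close> avoids a division by zero
      and still gives \<open>C * w t \<le> e\<close>.\<close>
    have "\<forall>\<^sub>F t in at 0. w t < e / (C + 1)"
      using order_tendstoD(2)[OF sh, of "e / (C + 1)"] e C0 by (simp add: w_def)
    then obtain d where d: "d > 0" "\<And>t. t \<noteq> 0 \<Longrightarrow> dist t 0 < d \<Longrightarrow> w t < e / (C + 1)"
      unfolding eventually_at by auto
    define d' where "d' = min d 1"
    have wt: "C * w t \<le> e" if "t \<in> ball 0 d'" for t
    proof -
      have "w t \<le> e / (C + 1)" using d(2)[of t] that e C0
        by (cases "t = 0") (auto simp: d'_def w_def dist_commute less_imp_le)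
      then have "C * w t \<le> C * (e / (C + 1))" using C0 by (rule mult_left_mono)
      also have "\<dots> \<le> e" using C0 e by (simp add: field_simps)
      finally show ?thesis .
    qed
    have d': "d' > 0" "ball 0 d' \<subseteq> D" using d by (auto simp: d'_def D_def)
    obtain \<nu> k where \<nu>: "prob_space \<nu>" "sets \<nu> = sets borel" and k: "\<And>x. (\<integral>u. chi x u \<partial>\<nu>) = complex_of_real (k x)"
      and k0: "\<And>x. 0 \<le> k x" and pos: "0 < (\<integral>t. k t \<partial>window (ball 0 d'))"
      and tail: "(\<integral>t. k t \<partial>window (D - ball 0 d')) \<le> e * (\<integral>t. k t \<partial>window (ball 0 d'))"
      using approx_unit[OF d'(1) e D] by auto
    interpret \<nu>: prob_space \<nu> by fact
    have f\<nu>: "finite_measure \<nu>" by unfold_locales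
    have [measurable]: "k \<in> borel_measurable borel"
    proof -
      note [measurable_cong] = \<nu>(2)
      have "(\<lambda>x. Re (\<integral>u. chi x u \<partial>\<nu>)) \<in> borel_measurable borel" by measurable
      then show ?thesis by (simp add: k)
    qed
    have k1: "k x \<le> 1" for x
      using norm_integral_le_const[OF f\<nu>, of "\<lambda>u. chi x u" 1] \<nu>.prob_space k0[of x] by (simp add: k chi_norm)
    have k1': "\<bar>k x\<bar> \<le> 1" for x using k0[of x] k1[of x] by simp
    define a where "a = (\<integral>t. k t \<partial>window (ball 0 d'))"
    define T where "T = (\<integral>t. k t * F t \<partial>window D)"
    define T0 where "T0 = (\<integral>t. k t * autocorr g t \<partial>window D)"
    have "(\<integral>x. \<integral>y. \<integral>z. g y * g z * k (z - y - x) \<partial>window B \<partial>window B \<partial>\<mu>) = T"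
      unfolding T_def F_def using S(1) Dm
      by (intro smoothed_form[where S="insert 0 S" and C=C] \<mu> C B Db k1') auto
    moreover have "(\<integral>x. \<integral>y. \<integral>z. g y * g z * k (z - y - x) \<partial>window B \<partial>window B \<partial>return borel 0)
        = (\<integral>t. k t * (\<integral>x. autocorr g (x + t) \<partial>return borel 0) \<partial>window D)"
      using Dm AE0 by (intro smoothed_form[where S="insert 0 S" and C=C] ret C B Db k1') auto
    then have "(\<integral>y. \<integral>z. g y * g z * k (z - y) \<partial>window B \<partial>window B) = T0"
      unfolding T0_def by (subst (asm) (1 2) integral_return) simp_all
    ultimately have TT: "l * T0 \<le> T"
      using spectral_bound[OF N.finite_measure_axioms sets_window \<mu> f\<nu> \<nu>(2) g C k l] by simp
    have "\<bar>T - F 0 * a\<bar> \<le> (1 + K) * e * a"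
      unfolding T_def a_def
      by (intro approx_unit_integral k0 k1 FK Db d' tail order_trans[OF Fl wt]) auto
    moreover have "\<bar>T0 - autocorr g 0 * a\<bar> \<le> (1 + K) * e * a"
      unfolding T0_def a_def
      using lip[of 0] by (intro approx_unit_integral k0 k1 nac Db d' tail order_trans[OF _ wt]) auto
    \<comment> \<open>The sign of \<open>l\<close> is not known here, so its error term is carried
      with \<open>\<bar>l\<bar>\<close>.\<close>
    then have "\<bar>l\<bar> * \<bar>T0 - autocorr g 0 * a\<bar> \<le> \<bar>l\<bar> * ((1 + K) * e * a)"
      by (rule mult_left_mono) simp
    then have "\<bar>l * T0 - l * autocorr g 0 * a\<bar> \<le> \<bar>l\<bar> * ((1 + K) * e * a)"
      by (simp add: abs_mult[symmetric] algebra_simps)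
    ultimately have "l * autocorr g 0 * a \<le> F 0 * a + (1 + K) * e * a + \<bar>l\<bar> * ((1 + K) * e * a)"
      using TT by linarith
    also have "\<dots> = (F 0 + e * ((1 + K) * (1 + \<bar>l\<bar>))) * a" by (simp add: algebra_simps)
    finally show ?thesis using pos by (simp add: a_def)
  qed
  have "l * autocorr g 0 \<le> F 0"
  proof (rule field_le_epsilon)
    fix e :: real assume e: "e > 0"
    define c where "c = (1 + K) * (1 + \<bar>l\<bar>)"
    have c: "c > 0" using K0 by (auto simp: c_def intro!: mult_pos_pos)
    show "l * autocorr g 0 \<le> F 0 + e"
      using main[of "e / c"] e c by (simp add: c_def[symmetric])
  qed
  then show ?thesis by (simp add: F_def)
qed

text \<open>This secures \<open>1 - l \<ge> 1\<close> for the final division, and a nonnegative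
  bound for sets of density 0.\<close>

lemma fourier_inf_nonpos:
  assumes \<mu>: "prob_space \<mu>" "sets \<mu> = sets borel" and S: "AE x in \<mu>. x \<in> S" "bounded S" "0 \<notin> closure S"
    and l: "\<And>u. l \<le> Re (\<integral>x. cnj (chi x u) \<partial>\<mu>)"
  shows "l \<le> 0"
proof -
  \<comment> \<open>The metric is not assumed translation invariant, so a ball whose differences
    avoid \<open>S\<close> is obtained from continuity of subtraction at
    \<open>(0, 0)\<close>.\<close>
  have "\<forall>\<^sub>F x in nhds (0 - 0). x \<in> - closure S"
    using S(3) by (intro eventually_nhds_in_open) auto
  moreover have "((\<lambda>p. snd p - fst p) \<longlongrightarrow> 0 - 0) (nhds (0::'a) \<times>\<^sub>F nhds (0::'a))"
    by (intro tendsto_diff filterlim_fst filterlim_snd)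
  ultimately have "\<forall>\<^sub>F p in nhds (0::'a) \<times>\<^sub>F nhds 0. snd p - fst p \<in> - closure S"
    by (rule eventually_compose_filterlim)
  then obtain P Q where PQ: "eventually P (nhds (0::'a))" "eventually Q (nhds (0::'a))"
      "\<And>x y. P x \<Longrightarrow> Q y \<Longrightarrow> y - x \<in> - closure S"
    unfolding eventually_prod_filter by auto
  from eventually_conj[OF PQ(1,2)] obtain d where d: "d > 0" "\<And>x. dist x 0 < d \<Longrightarrow> P x \<and> Q x"
    unfolding eventually_nhds_metric by auto
  define A where "A = ball (0::'a) d"
  have A: "A \<in> sets borel" "bounded A" "open A" "A \<noteq> {}" using d by (auto simp: A_def)
  have AS: "y - x \<notin> S" if "x \<in> A" "y \<in> A" for x y
    using PQ(3)[of x y] d(2)[of x] d(2)[of y] that closure_subset[of S]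
    by (auto simp: A_def dist_commute)
  have "l * autocorr (indicat_real A) 0 \<le> (\<integral>x. autocorr (indicat_real A) x \<partial>\<mu>)"
  proof (rule autocorr_integral_ge[OF \<mu> S(1,2) _ _ A(1,2) _ _ l])
    show "((\<lambda>t. LINT y|M. \<bar>indicat_real A (y + t) - indicat_real A y\<bar>) \<longlongrightarrow> 0) (at 0)"
      using shift_diff_tendsto[OF A(1,2)] by (simp add: shift_diff_def[abs_def])
    show "\<bar>indicat_real A x\<bar> \<le> 1" for x by (simp add: indicator_def)
  qed (use A in auto)
  also have "\<dots> = 0"
  proof (rule integral_eq_zero_AE)
    show "AE x in \<mu>. autocorr (indicat_real A) x = 0"
      using S(1)
    proof (rule AE_mp, intro AE_I2 impI)
      fix x assume "x \<in> S"
      then have "indicat_real A y * indicat_real A (y + x) = 0" for y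
        using AS[of y "y + x"] by (auto simp: indicator_def)
      then show "autocorr (indicat_real A) x = 0" by (simp only: autocorr_def integral_zero)
    qed
  qed
  also have "autocorr (indicat_real A) 0 = measure M A"
    by (simp add: autocorr_def indicator_inter_arith[symmetric])
  finally have "l * measure M A \<le> 0" .
  moreover have "measure M A > 0" using measure_open_pos A by blast
  ultimately show ?thesis by (simp add: mult_le_0_iff)
qed

text \<open>On \<open>S\<close> the product of \<open>A\<close> with its own translate vanishes by
  independence, each mixed term is at least \<open>|A| - E |B|\<close>, and the last term is at most
  \<open>|B|\<close>. In units of \<open>|B|\<close> the main part is
  \<open>- 2 d\<^sup>2 + d\<^sup>2\<close>. \<open>E\<close> bounds the fraction of \<open>B\<close>
  that a translation by an element of \<open>S\<close> moves out.\<close>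

lemma independent_density_ineq:
  assumes \<mu>: "prob_space \<mu>" "sets \<mu> = sets borel" and S: "AE x in \<mu>. x \<in> S" "bounded S" "uminus ` S = S"
    and l: "\<And>u. l \<le> Re (\<integral>x. cnj (chi x u) \<partial>\<mu>)"
    and A: "A \<in> sets borel" "A \<subseteq> B" "\<And>x y. x \<in> A \<Longrightarrow> y \<in> A \<Longrightarrow> x - y \<notin> S"
    and B: "B \<in> sets borel" "bounded B" "measure M B > 0"
    and E: "\<And>x. x \<in> S \<Longrightarrow> measure M (B - {y. y + x \<in> B}) \<le> E * measure M B"
  defines "d \<equiv> measure M A / measure M B"
  shows "l * (d - d\<^sup>2) \<le> - d\<^sup>2 + 2 * d * E"
proof -
  interpret \<mu>: prob_space \<mu> by fact
  note [measurable] = A(1) B(1)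
  have Ab: "bounded A" using A B by (auto intro: bounded_subset)
  define c where "c X Y x = (\<integral>y. indicat_real X y * indicat_real Y (y + x) \<partial>M)" for X Y x
  define g where "g y = indicat_real A y - d * indicat_real B y" for y
  have [measurable]: "g \<in> borel_measurable borel" unfolding g_def[abs_def] by measurable
  have MAB: "measure M A = d * measure M B" using B by (simp add: d_def)
  have "measure M A \<le> measure M B"
    using A B emeasure_bounded_finite[OF B(2)] by (intro measure_mono_fmeasurable) (auto simp: fmeasurable_def)
  then have d: "0 \<le> d" "d \<le> 1" using B by (auto simp: d_def)
  have ci: "integrable M (\<lambda>y. indicat_real X y * indicat_real Y (y + x))"
    if [measurable]: "X \<in> sets borel" "Y \<in> sets borel" and "bounded X" for X Y x
    using that by (intro integrable_bounded_support[where B=X and C=1]) (auto simp: indicator_def)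
  have ag: "autocorr g x = c A A x - d * c A B x - d * c B A x + d\<^sup>2 * c B B x" for x
  proof -
    have "autocorr g x = (\<integral>y. indicat_real A y * indicat_real A (y + x)
       - d * (indicat_real A y * indicat_real B (y + x)) - d * (indicat_real B y * indicat_real A (y + x))
       + d\<^sup>2 * (indicat_real B y * indicat_real B (y + x)) \<partial>M)"
      unfolding autocorr_def g_def by (simp add: algebra_simps power2_eq_square)
    then show ?thesis
      using Ab B ci by (simp add: c_def)
  qed
  have c0: "c X Y 0 = measure M (X \<inter> Y)" for X Y
    unfolding c_def by (simp add: indicator_inter_arith[symmetric])
  have ag0: "autocorr g 0 = measure M B * (d - d\<^sup>2)"
    using A(2) MAB by (simp add: ag c0 Int_absorb1 Int_absorb2 power2_eq_square algebra_simps)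
  have cAB: "c A B x \<ge> measure M A - E * measure M B" if x: "x \<in> S" for x
  proof -
    have "measure M A - c A B x = (\<integral>y. indicat_real A y - indicat_real A y * indicat_real B (y + x) \<partial>M)"
      unfolding c_def using Ab ci by simp
    also have "\<dots> \<le> (\<integral>y. indicat_real (B - {y. y + x \<in> B}) y \<partial>M)"
    proof (rule integral_mono)
      have "bounded (B - {y. y + x \<in> B})" using B(2) by (rule bounded_subset) auto
      then show "integrable M (indicat_real (B - {y. y + x \<in> B}))"
        by (intro integrable_indicator_bounded) measurable
      show "indicat_real A y - indicat_real A y * indicat_real B (y + x) \<le> indicat_real (B - {y. y + x \<in> B}) y" for y
        using A(2) by (auto simp: indicator_def)
    qed (use Ab ci in simp)
    also have "\<dots> \<le> E * measure M B" using E[OF x] by simp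
    finally show ?thesis by simp
  qed
  have cBA: "c B A x = c A B (- x)" for x
  proof -
    have "(\<integral>y. indicat_real B (y + x - x) * indicat_real A (y + x) \<partial>M) = (\<integral>y. indicat_real B (y - x) * indicat_real A y \<partial>M)"
      by (rule integral_translate) measurable
    then show ?thesis by (simp add: c_def mult.commute)
  qed
  have cBB: "c B B x \<le> measure M B" for x
  proof -
    have "c B B x \<le> (\<integral>y. indicat_real B y \<partial>M)"
      unfolding c_def by (rule integral_mono[OF ci integrable_indicator_bounded])
        (use B in \<open>auto simp: indicator_def\<close>)
    then show ?thesis by simp
  qed
  have up: "autocorr g x \<le> measure M B * (- d\<^sup>2 + 2 * d * E)" if x: "x \<in> S" for x
  proof -
    \<comment> \<open>The second mixed term is the first one at \<open>- x\<close>; here symmetry of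
      \<open>S\<close> enters.\<close>
    have "- x \<in> S" using S(3) x by blast
    then have "c B A x \<ge> measure M A - E * measure M B" using cAB cBA by simp
    moreover have "c A A x = 0"
    proof -
      have "indicat_real A y * indicat_real A (y + x) = 0" for y
        using A(3)[of "y + x" y] x by (auto simp: indicator_def)
      then show ?thesis by (simp only: c_def integral_zero)
    qed
    ultimately have "autocorr g x \<le> 0 - d * (measure M A - E * measure M B)
        - d * (measure M A - E * measure M B) + d\<^sup>2 * measure M B"
      unfolding ag using d cAB[OF x] cBB[of x] by (intro add_mono diff_mono mult_left_mono) auto
    then show ?thesis by (simp add: MAB power2_eq_square algebra_simps)
  qed
  have "l * autocorr g 0 \<le> (\<integral>x. autocorr g x \<partial>\<mu>)"
  proof (rule autocorr_integral_ge[OF \<mu> S(1,2) _ _ B(1,2) _ _ l])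
    have "((\<lambda>t. shift_diff A t + d * shift_diff B t) \<longlongrightarrow> 0 + d * 0) (at 0)"
      using Ab B by (intro tendsto_intros shift_diff_tendsto) auto
    then have lim: "((\<lambda>t. shift_diff A t + d * shift_diff B t) \<longlongrightarrow> 0) (at 0)" by simp
    show "((\<lambda>t. LINT y|M. \<bar>g (y + t) - g y\<bar>) \<longlongrightarrow> 0) (at 0)"
    proof (rule tendsto_sandwich[OF _ _ tendsto_const lim])
      show "\<forall>\<^sub>F t in at 0. (LINT y|M. \<bar>g (y + t) - g y\<bar>) \<le> shift_diff A t + d * shift_diff B t"
      proof (intro always_eventually allI)
        fix t
        have i: "integrable M (\<lambda>y. \<bar>indicat_real X (y + t) - indicat_real X y\<bar>)"
          if "X \<in> sets borel" "bounded X" for X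
          using that by (intro integrable_abs Bochner_Integration.integrable_diff) auto
        have j: "integrable M (\<lambda>y. \<bar>indicat_real A (y + t) - indicat_real A y\<bar> + d * \<bar>indicat_real B (y + t) - indicat_real B y\<bar>)"
          using Ab B i by simp
        have le: "\<bar>g (y + t) - g y\<bar> \<le> \<bar>indicat_real A (y + t) - indicat_real A y\<bar> + d * \<bar>indicat_real B (y + t) - indicat_real B y\<bar>" for y
          using d by (auto simp: g_def indicator_def)
        have "(LINT y|M. \<bar>g (y + t) - g y\<bar>) \<le> (\<integral>y. \<bar>indicat_real A (y + t) - indicat_real A y\<bar> + d * \<bar>indicat_real B (y + t) - indicat_real B y\<bar> \<partial>M)"
        proof (rule integral_mono[OF _ j le])
          show "integrable M (\<lambda>y. \<bar>g (y + t) - g y\<bar>)"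
            unfolding g_def using Ab B by (intro integrable_abs) simp
        qed
        also have "\<dots> = shift_diff A t + d * shift_diff B t"
          unfolding shift_diff_def using Ab B i by simp
        finally show "(LINT y|M. \<bar>g (y + t) - g y\<bar>) \<le> shift_diff A t + d * shift_diff B t" .
      qed
    qed simp
    show "\<bar>g x\<bar> \<le> 1" for x
      using d A(2) by (auto simp: g_def indicator_def)
    show "g x = 0" if "x \<notin> B" for x
      using that A(2) by (auto simp: g_def indicator_def)
  qed measurable
  also have "\<dots> \<le> measure M B * (- d\<^sup>2 + 2 * d * E)"
  proof (cases "integrable \<mu> (autocorr g)")
    case True
    have "AE x in \<mu>. autocorr g x \<le> measure M B * (- d\<^sup>2 + 2 * d * E)"
      using S(1) by (rule eventually_mono) (rule up)
    then have "(\<integral>x. autocorr g x \<partial>\<mu>) \<le> (\<integral>x. measure M B * (- d\<^sup>2 + 2 * d * E) \<partial>\<mu>)"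
      using True by (intro integral_mono_AE) auto
    then show ?thesis by (simp add: \<mu>.prob_space)
  next
    case False
    have "\<bar>autocorr g x\<bar> \<le> 1 * measure (window B) (space (window B))" for x
    proof -
      have "autocorr g x = (\<integral>y. g y * g (y + x) \<partial>window B)"
        unfolding autocorr_def using A(2) B
        by (intro integral_window_support[symmetric]) (auto simp: g_def indicator_def)
      also have "\<bar>\<dots>\<bar> \<le> 1 * measure (window B) (space (window B))"
      proof -
        have "\<bar>g x\<bar> \<le> 1" for x using d A(2) by (auto simp: g_def indicator_def)
        then show ?thesis unfolding real_norm_def[symmetric] using B
          by (intro norm_integral_le_const finite_window) (auto simp: abs_mult intro!: mult_le_one)
      qed
      finally show ?thesis .
    qed
    moreover have "autocorr g \<in> borel_measurable \<mu>"
    proof -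
      interpret N: finite_measure "window B" using B by (intro finite_window)
      have "(\<integral>y. g y * g (y + x) \<partial>window B) = autocorr g x" for x
        unfolding autocorr_def using A(2) B
        by (intro integral_window_support) (auto simp: g_def indicator_def)
      moreover have "(\<lambda>x. \<integral>y. g y * g (y + x) \<partial>window B) \<in> borel_measurable borel" by measurable
      ultimately show ?thesis using \<mu>(2) by (simp cong: measurable_cong_sets)
    qed
    ultimately have "integrable \<mu> (autocorr g)"
      by (intro integrable_finite_bounded[where C="1 * measure (window B) (space (window B))"]) (auto intro: \<mu>.finite_measure_axioms)
    with False show ?thesis by simp
  qed
  finally have "measure M B * (l * (d - d\<^sup>2)) \<le> measure M B * (- d\<^sup>2 + 2 * d * E)"
    by (simp add: ag0 mult_ac)
  then show ?thesis using B(3) by simp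
qed

text \<open>After division by \<open>d\<close> the density inequality is linear in \<open>d\<close>,
  which can be isolated since \<open>1 - l > 0\<close>; the error disappears along the balls.
  \<open>l\<close> may be any lower bound of the transform.\<close>

theorem alpha_bar_le:
  assumes \<mu>: "prob_space \<mu>" "sets \<mu> = sets borel"
    and S: "AE x in \<mu>. x \<in> S" "bounded S" "uminus ` S = S" "0 \<notin> closure S"
    and l: "\<And>u. l \<le> Re (\<integral>x. cnj (chi x u) \<partial>\<mu>)"
    and B: "\<And>r. B r \<in> sets borel" "\<And>r. bounded (B r)" "\<forall>\<^sub>F r in at_top. measure M (B r) > 0"
    and E: "\<forall>\<^sub>F r in at_top. \<forall>x\<in>S. measure M (B r - {y. y + x \<in> B r}) \<le> E r * measure M (B r)"
      "(E \<longlongrightarrow> 0) at_top"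
  shows "alpha_bar M B (cayley_graph S) \<le> ereal (- (l / (1 - l)))"
  unfolding alpha_bar_def
proof (intro SUP_least)
  fix I assume "I \<in> {I. independent_set (cayley_graph S) I}"
  then have I [measurable]: "I \<in> sets borel" and ind: "\<And>x y. x \<in> I \<Longrightarrow> y \<in> I \<Longrightarrow> x - y \<notin> S"
    by (auto simp: independent_set_def cayley_graph_def)
  have l0: "l \<le> 0" using fourier_inf_nonpos[OF \<mu> S(1,2,4) l] .
  define b where "b r = - l / (1 - l) + 2 * \<bar>E r\<bar> / (1 - l)" for r
  have "\<forall>\<^sub>F r in at_top. measure M (I \<inter> B r) / measure M (B r) \<le> b r"
    using E(1) B(3)
  proof eventually_elim
    case (elim r)
    define d where "d = measure M (I \<inter> B r) / measure M (B r)"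
    have d0: "d \<ge> 0" by (simp add: d_def)
    have "l * (d - d\<^sup>2) \<le> - d\<^sup>2 + 2 * d * E r"
      unfolding d_def using I B(1,2) ind elim
      by (intro independent_density_ineq[OF \<mu> S(1-3) l, of "I \<inter> B r" "B r" "E r"]) auto
    also have "\<dots> \<le> - d\<^sup>2 + 2 * d * \<bar>E r\<bar>" using d0 by (simp add: mult_left_mono)
    finally have "d * (d * (1 - l)) \<le> d * (- l + 2 * \<bar>E r\<bar>)"
      by (simp add: algebra_simps power2_eq_square)
    \<comment> \<open>When \<open>d = 0\<close> the right side is nonnegative because
      \<open>l \<le> 0\<close>.\<close>
    then have "d * (1 - l) \<le> - l + 2 * \<bar>E r\<bar>"
      using d0 l0 by (cases "d = 0") (auto simp: mult_le_cancel_left)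
    then have "d \<le> (- l + 2 * \<bar>E r\<bar>) / (1 - l)" using l0 by (simp add: le_divide_eq)
    then show ?case unfolding d_def[symmetric] b_def by (simp only: add_divide_distrib)
  qed
  then have "upper_density M B I \<le> Limsup at_top (\<lambda>r. ereal (b r))"
    unfolding upper_density_def by (intro Limsup_mono) (auto elim: eventually_mono)
  also have "(b \<longlongrightarrow> - l / (1 - l) + 2 * \<bar>0\<bar> / (1 - l)) at_top"
    unfolding b_def using l0 E(2) by (intro tendsto_intros) auto
  then have "Limsup at_top (\<lambda>r. ereal (b r)) = ereal (- l / (1 - l))"
    by (intro lim_imp_Limsup) auto
  finally show "upper_density M B I \<le> ereal (- (l / (1 - l)))" by simp
qed

end

text \<open>Each point outside the support lies in a null set of a countable basis, and countably
  many null sets are jointly null.\<close>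

lemma AE_measure_support:
  fixes \<mu> :: "'v::second_countable_topology measure"
  assumes [simp]: "sets \<mu> = sets borel" and sub: "measure_support \<mu> \<subseteq> S"
  shows "AE x in \<mu>. x \<in> S"
proof -
  obtain B :: "'v set set" where B: "countable B" "topological_basis B"
    using ex_countable_basis by blast
  define N where "N = {b \<in> B. emeasure \<mu> b = 0}"
  have "AE x in \<mu>. \<forall>b\<in>N. x \<notin> b"
  proof (subst AE_ball_countable)
    show "countable N" using B(1) by (simp add: N_def)
    show "\<forall>b\<in>N. AE x in \<mu>. x \<notin> b"
      using topological_basis_open[OF B(2)] by (auto simp: N_def null_sets_def intro!: AE_not_in)
  qed
  then show ?thesis
  proof (rule eventually_mono)
    fix x assume x: "\<forall>b\<in>N. x \<notin> b"
    show "x \<in> S"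
    proof (rule ccontr)
      assume "x \<notin> S"
      with sub have "x \<notin> measure_support \<mu>" by blast
      then obtain U where U: "open U" "x \<in> U" "emeasure \<mu> U = 0"
        by (auto simp: measure_support_def)
      obtain b where b: "b \<in> B" "x \<in> b" "b \<subseteq> U" using topological_basisE[OF B(2) U(1,2)] .
      have "emeasure \<mu> b = 0"
        using emeasure_mono[OF b(3), of \<mu>] U by simp
      with b x show False by (simp add: N_def)
    qed
  qed
qed

definition pairing :: "('k::comm_ring_1 \<Rightarrow> complex) \<Rightarrow> 'k ^ 'm \<Rightarrow> 'k ^ 'm \<Rightarrow> complex" where
  "pairing \<psi> x u = \<psi> (\<Sum>i\<in>UNIV. x $ i * u $ i)"

lemma fourier_eq: "fourier \<psi> \<mu> u = (\<integral>x. cnj (pairing \<psi> x u) \<partial>\<mu>)"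
  by (simp add: fourier_def pairing_def)

text \<open>The transform has modulus at most 1, which supplies the lower bound that an infimum of
  reals requires.\<close>

lemma fourier_INF_le:
  assumes \<mu>: "prob_space \<mu>" and \<psi>: "\<And>z. norm (\<psi> z) = 1"
  shows "(INF u. Re (fourier \<psi> \<mu> u)) \<le> Re (\<integral>x. cnj (pairing \<psi> x u) \<partial>\<mu>)"
  unfolding fourier_eq
proof (rule cINF_lower[OF bdd_belowI2[of _ "-1"]])
  interpret prob_space \<mu> by fact
  fix u
  have "norm (\<integral>x. cnj (pairing \<psi> x u) \<partial>\<mu>) \<le> 1 * measure \<mu> (space \<mu>)"
    by (intro norm_integral_le_const finite_measure_axioms) (auto simp: pairing_def \<psi>)
  then show "- 1 \<le> Re (\<integral>x. cnj (pairing \<psi> x u) \<partial>\<mu>)"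
    using abs_Re_le_cmod[of "\<integral>x. cnj (pairing \<psi> x u) \<partial>\<mu>"] by (simp add: prob_space)
qed simp

text \<open>The dot product is continuous, so \<open>pairing\<close> is jointly continuous; second
  countability identifies the Borel algebra of the product with the product algebra.\<close>

lemma haar_pairingI:
  fixes M :: "('k::{comm_ring_1, heine_borel, second_countable_topology, topological_ab_group_add,
    topological_semigroup_mult} ^ 'm) measure"
  assumes M: "haar_measure M" and add: "\<And>a b. \<psi> (a + b) = \<psi> a * \<psi> b" and norm: "\<And>a. norm (\<psi> a) = 1"
    and cont: "continuous_on UNIV \<psi>"
  shows "haar_pairing M (pairing \<psi>)"
proof
  fix x y u :: "'k ^ 'm"
  show "pairing \<psi> (x + y) u = pairing \<psi> x u * pairing \<psi> y u"
    by (simp add: pairing_def add distrib_right sum.distrib flip: add)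
  show "norm (pairing \<psi> x u) = 1" by (simp add: pairing_def norm)
  have "continuous_on UNIV (\<lambda>(x, u). pairing \<psi> x u)"
    unfolding case_prod_unfold pairing_def
    by (intro continuous_on_compose2[OF cont] continuous_on_sum continuous_on_mult' continuous_intros) auto
  then show "(\<lambda>(x, u). pairing \<psi> x u) \<in> borel_measurable (borel \<Otimes>\<^sub>M borel)"
    unfolding borel_prod by (rule borel_measurable_continuous_onI)
qed (rule M)

section \<open>Real space\<close>

lemma real_char_add: "real_char (a + b) = real_char a * real_char b"
  by (simp add: real_char_def distrib_left exp_add)

lemma norm_real_char: "norm (real_char a) = 1"
proof -
  have "2 * of_real pi * \<i> * of_real a = \<i> * complex_of_real (2 * pi * a)" by simp
  then show ?thesis unfolding real_char_def by (simp only: norm_exp_i_times)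
qed

lemma continuous_real_char: "continuous_on UNIV real_char"
  unfolding real_char_def by (intro continuous_intros)

text \<open>Independent normal coordinates; the factor \<open>2 * pi\<close> cancels the one in
  \<open>real_char\<close>. Large \<open>c\<close> gives a wide Gaussian, hence a narrow
  transform.\<close>

definition gaussian_vec :: "real \<Rightarrow> (real ^ 'm) measure" where
  "gaussian_vec c = distr (\<Pi>\<^sub>M i\<in>UNIV. std_normal_distribution) borel (\<lambda>f. \<chi> i. c * f i / (2 * pi))"

lemma measurable_vec_lambda_PiM [measurable]:
  "(\<lambda>f. \<chi> i. c * f i / (2 * pi)) \<in> borel_measurable (\<Pi>\<^sub>M i\<in>(UNIV :: 'm::finite set). std_normal_distribution)"
proof (subst borel_measurable_euclidean_space, intro ballI)
  fix b :: "real ^ 'm" assume "b \<in> Basis"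
  then obtain j where j: "b = axis j 1" by (auto simp: Basis_vec_def)
  have "(\<lambda>f. c * f j / (2 * pi)) \<in> borel_measurable (\<Pi>\<^sub>M i\<in>(UNIV :: 'm set). std_normal_distribution)"
    by measurable
  then show "(\<lambda>f. (\<chi> i. c * f i / (2 * pi)) \<bullet> b) \<in> borel_measurable (\<Pi>\<^sub>M i\<in>(UNIV :: 'm set). std_normal_distribution)"
    by (simp add: j inner_axis)
qed

lemma prob_space_gaussian_vec: "prob_space (gaussian_vec c :: (real ^ 'm) measure)"
  unfolding gaussian_vec_def
  by (intro prob_space.prob_space_distr prob_space_PiM measurable_vec_lambda_PiM)
     (simp add: prob_space_normal_density)

text \<open>The character of a sum factors over the coordinates, so independence leaves
  one-dimensional characteristic functions.\<close>

lemma gaussian_vec_transform: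
  "(\<integral>u. pairing real_char x u \<partial>gaussian_vec c) = complex_of_real (exp (- (c\<^sup>2 * (norm x)\<^sup>2) / 2))"
  for x :: "real ^ 'm"
proof -
  interpret N: prob_space std_normal_distribution by (simp add: prob_space_normal_density)
  interpret product_sigma_finite "\<lambda>_::'m. std_normal_distribution" ..
  have [measurable]: "(\<lambda>u. pairing real_char x u) \<in> borel_measurable borel"
    unfolding pairing_def
    by (intro borel_measurable_continuous_onI continuous_on_compose2[OF continuous_real_char] continuous_intros) auto
  have "(\<integral>u. pairing real_char x u \<partial>gaussian_vec c) =
      (\<integral>f. pairing real_char x (\<chi> i. c * f i / (2 * pi)) \<partial>(\<Pi>\<^sub>M i\<in>UNIV. std_normal_distribution))"
    unfolding gaussian_vec_def by (rule integral_distr) measurable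
  also have "\<dots> = (\<integral>f. (\<Prod>i\<in>UNIV. iexp (c * x $ i * f i)) \<partial>(\<Pi>\<^sub>M i\<in>UNIV. std_normal_distribution))"
  proof (rule Bochner_Integration.integral_cong[OF refl])
    fix f :: "'m \<Rightarrow> real"
    have "2 * of_real pi * \<i> * of_real (\<Sum>i\<in>UNIV. x $ i * (c * f i / (2 * pi)))
       = (\<Sum>i\<in>UNIV. \<i> * complex_of_real (c * x $ i * f i))"
      by (simp add: sum_distrib_left field_simps)
    then show "pairing real_char x (\<chi> i. c * f i / (2 * pi)) = (\<Prod>i\<in>UNIV. iexp (c * x $ i * f i))"
      by (simp only: pairing_def real_char_def vec_lambda_beta exp_sum[OF finite])
  qed
  also have "\<dots> = (\<Prod>i\<in>UNIV. char std_normal_distribution (c * x $ i))"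
    unfolding char_def
  proof (intro product_integral_prod)
    show "integrable std_normal_distribution (\<lambda>s. iexp (c * x $ i * s))" for i
      by (intro N.integrable_const_bound[where B=1]) auto
  qed simp
  also have "\<dots> = complex_of_real (\<Prod>i\<in>UNIV. exp (- ((c * x $ i)\<^sup>2) / 2))"
    by (simp add: char_std_normal_distribution)
  also have "(\<Prod>i\<in>UNIV. exp (- ((c * x $ i)\<^sup>2) / 2)) = exp (\<Sum>i\<in>UNIV. - ((c * x $ i)\<^sup>2) / 2)"
    by (simp add: exp_sum)
  also have "(\<Sum>i\<in>UNIV. - ((c * x $ i)\<^sup>2) / 2) = - (c\<^sup>2 * (norm x)\<^sup>2) / 2"
    by (simp add: norm_vec_def L2_set_def sum_nonneg real_sqrt_pow2 sum_distrib_left sum_negf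
        sum_divide_distrib power_mult_distrib)
  finally show ?thesis .
qed

lemma haar_pairing_approx_real:
  fixes M :: "(real ^ 'm) measure"
  assumes "haar_measure M" shows "haar_pairing_approx M (pairing real_char)"
proof -
  interpret haar_pairing M "pairing real_char"
    by (rule haar_pairingI[OF assms real_char_add norm_real_char continuous_real_char])
  show ?thesis
  proof
    fix d e :: real and D :: "(real ^ 'm) set"
    assume d: "0 < d" and e: "0 < e" and D: "compact D"
    let ?m = "measure M (ball 0 (d / 2))"
    have m: "?m > 0" using d by (intro measure_open_pos) auto
    have [measurable]: "D \<in> sets borel" using D by (rule borel_compact)
    have bD: "bounded D" using D by (rule compact_imp_bounded)
    \<comment> \<open>For squared width \<open>b\<close> the kernel is at least
      \<open>exp (- b d\<^sup>2 / 8)\<close> on the ball of radius \<open>d / 2\<close> and at most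
      \<open>exp (- b d\<^sup>2 / 2)\<close> off the ball of radius \<open>d\<close>;
      \<open>3 / 8\<close> is the gap \<open>1 / 2 - 1 / 8\<close>.\<close>
    have "((\<lambda>c. exp (- (3 / 8 * d\<^sup>2 * c))) \<longlongrightarrow> 0) at_top"
      using d by real_asymp
    then have "((\<lambda>c. exp (- (3 / 8 * d\<^sup>2 * c)) * measure M D) \<longlongrightarrow> 0 * measure M D) at_top"
      by (intro tendsto_intros)
    then have "\<forall>\<^sub>F c in at_top. exp (- (3 / 8 * d\<^sup>2 * c)) * measure M D < e * ?m"
      using e m by (intro order_tendstoD) auto
    then have "\<forall>\<^sub>F c in at_top. exp (- (3 / 8 * d\<^sup>2 * c)) * measure M D < e * ?m \<and> c \<ge> 0"
      using eventually_ge_at_top[of 0] by eventually_elim auto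
    then obtain b where b: "exp (- (3 / 8 * d\<^sup>2 * b)) * measure M D < e * ?m" "b \<ge> 0"
      unfolding eventually_at_top_linorder by blast
    define c where "c = sqrt b"
    have cb: "c\<^sup>2 = b" using b by (simp add: c_def)
    define k where "k x = exp (- (c\<^sup>2 * (norm x)\<^sup>2) / 2)" for x :: "real ^ 'm"
    have [measurable]: "k \<in> borel_measurable borel" unfolding k_def by measurable
    have k01: "0 \<le> k x" "k x \<le> 1" for x by (auto simp: k_def)
    have near: "exp (- (b * d\<^sup>2) / 8) * ?m \<le> (\<integral>t. k t \<partial>window (ball 0 d))"
    proof -
      have "exp (- (b * d\<^sup>2) / 8) * ?m = (\<integral>t. indicat_real (ball 0 (d/2)) t * exp (- (b * d\<^sup>2) / 8) \<partial>M)" by simp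
      also have "\<dots> \<le> (\<integral>t. indicat_real (ball 0 d) t * k t \<partial>M)"
      proof (rule integral_mono)
        show "integrable M (\<lambda>t. indicat_real (ball 0 d) t * k t)"
          using k01 by (intro integrable_bounded_support[where B="ball 0 d" and C=1]) (auto simp: indicator_def)
        show "integrable M (\<lambda>t. indicat_real (ball 0 (d/2)) t * exp (- (b * d\<^sup>2) / 8))" by simp
        fix t :: "real ^ 'm"
        show "indicat_real (ball 0 (d/2)) t * exp (- (b * d\<^sup>2) / 8) \<le> indicat_real (ball 0 d) t * k t"
        proof (cases "t \<in> ball 0 (d / 2)")
          case True
          then have "(norm t)\<^sup>2 \<le> (d / 2)\<^sup>2" by (intro power_mono) auto
          then have "b * (norm t)\<^sup>2 \<le> b * (d / 2)\<^sup>2" using b(2) by (rule mult_left_mono)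
          then have "exp (- (b * d\<^sup>2) / 8) \<le> k t" by (simp add: k_def cb power_divide)
          moreover have "t \<in> ball 0 d" using True d by simp
          ultimately show ?thesis using True by (simp add: indicator_def)
        qed (use k01 in simp)
      qed
      also have "\<dots> = (\<integral>t. k t \<partial>window (ball 0 d))" by (simp add: integral_window)
      finally show ?thesis .
    qed
    have "(\<integral>t. k t \<partial>window (D - ball 0 d)) = (\<integral>t. indicat_real (D - ball 0 d) t * k t \<partial>M)"
      by (simp add: integral_window)
    also have "\<dots> \<le> (\<integral>t. indicat_real D t * exp (- (b * d\<^sup>2) / 2) \<partial>M)"
    proof (rule integral_mono)
      show "integrable M (\<lambda>t. indicat_real (D - ball 0 d) t * k t)"
        using k01 bD by (intro integrable_bounded_support[where B=D and C=1]) (auto simp: indicator_def)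
      show "integrable M (\<lambda>t. indicat_real D t * exp (- (b * d\<^sup>2) / 2))" using bD by simp
      fix t :: "real ^ 'm"
      show "indicat_real (D - ball 0 d) t * k t \<le> indicat_real D t * exp (- (b * d\<^sup>2) / 2)"
      proof (cases "t \<in> D - ball 0 d")
        case True
        then have "d\<^sup>2 \<le> (norm t)\<^sup>2" using d by (intro power_mono) auto
        then have "b * d\<^sup>2 \<le> b * (norm t)\<^sup>2" using b(2) by (rule mult_left_mono)
        then have "k t \<le> exp (- (b * d\<^sup>2) / 2)" by (simp add: k_def cb)
        then show ?thesis using True by (simp add: indicator_def)
      qed (simp add: indicator_def)
    qed
    also have "\<dots> = exp (- (b * d\<^sup>2) / 8) * (exp (- (3 / 8 * d\<^sup>2 * b)) * measure M D)"
      by (simp add: mult.assoc[symmetric] exp_add[symmetric] mult.commute)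
    also have "\<dots> \<le> exp (- (b * d\<^sup>2) / 8) * (e * ?m)"
      using b(1) by (intro mult_left_mono) auto
    also have "\<dots> = e * (exp (- (b * d\<^sup>2) / 8) * ?m)" by simp
    also have "\<dots> \<le> e * (\<integral>t. k t \<partial>window (ball 0 d))"
      using near e by (intro mult_left_mono) auto
    finally have tail: "(\<integral>t. k t \<partial>window (D - ball 0 d)) \<le> e * (\<integral>t. k t \<partial>window (ball 0 d))" .
    have pos: "0 < (\<integral>t. k t \<partial>window (ball 0 d))"
      using near m by (intro less_le_trans[OF _ near]) simp
    show "\<exists>\<nu> k. prob_space \<nu> \<and> sets \<nu> = sets borel \<and>
        (\<forall>x. (\<integral>u. pairing real_char x u \<partial>\<nu>) = complex_of_real (k x)) \<and> (\<forall>x. 0 \<le> k x) \<and>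
        0 < (\<integral>t. k t \<partial>window (ball 0 d)) \<and>
        (\<integral>t. k t \<partial>window (D - ball 0 d)) \<le> e * (\<integral>t. k t \<partial>window (ball 0 d))"
      using prob_space_gaussian_vec[of c] gaussian_vec_transform[where c=c] pos tail k01
      by (intro exI[of _ "gaussian_vec c"] exI[of _ k]) (auto simp: k_def gaussian_vec_def)
  qed
qed

lemma real_ball_eq: "real_ball r = cball 0 r"
  by (auto simp: real_ball_def)

text \<open>Haar and Lebesgue measure are compared by testing on the unit ball, which is symmetric.
  What is wanted is the growth rate of balls.\<close>

lemma haar_real_ball:
  fixes M :: "(real ^ 'm) measure"
  assumes "haar_measure M"
  shows "\<exists>C>0. \<forall>r\<ge>0. measure M (cball 0 r) = C * r ^ CARD('m)"
proof -
  interpret haar_space M by unfold_locales (rule assms)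
  let ?L = "lborel :: (real ^ 'm) measure"
  let ?u = "unit_ball_vol (real CARD('m))"
  have u: "?u > 0" by simp
  have "uminus ` cball (0 :: real ^ 'm) 1 = cball 0 1"
    by (auto simp: image_iff intro!: bexI[of _ "- _"])
  then have "emeasure M (cball 0 r) * emeasure ?L (cball 0 1) = emeasure ?L (cball 0 r) * emeasure M (cball 0 1)" for r
    by (intro haar_measure_proportional haar_measure_lborel) auto
  then have eq: "measure M (cball 0 r) * ?u = (?u * r ^ CARD('m)) * measure M (cball 0 1)" if "r \<ge> 0" for r
    using that content_cball[of 1 "0 :: real ^ 'm"] content_cball[of r "0 :: real ^ 'm"]
    unfolding measure_def by (metis enn2real_mult DIM_cart DIM_real mult_1_right power_one zero_le_one)
  have "measure M (ball 0 1) \<le> measure M (cball 0 1)"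
    using emeasure_bounded_finite[of "cball 0 1"]
    by (intro measure_mono_fmeasurable) (auto simp: fmeasurable_def)
  then have "measure M (cball 0 1) > 0"
    using measure_open_pos[of "ball 0 1"] by auto
  moreover have "measure M (cball 0 r) = measure M (cball 0 1) * r ^ CARD('m)" if "r \<ge> 0" for r
    using eq[OF that] u by simp
  ultimately show ?thesis by blast
qed

lemma alpha_bar_real:
  fixes M :: "(real ^ 'm) measure"
  assumes M: "haar_measure M" and S: "S \<subseteq> real_ball s" "uminus ` S = S" "0 \<notin> closure S"
    and \<mu>: "prob_space \<mu>" "sets \<mu> = sets borel" "measure_support \<mu> \<subseteq> S"
  shows "alpha_bar M real_ball (cayley_graph S)
    \<le> ereal (- ((INF u. Re (fourier real_char \<mu> u)) / (1 - (INF u. Re (fourier real_char \<mu> u)))))"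
proof -
  interpret haar_pairing_approx M "pairing real_char" by (rule haar_pairing_approx_real[OF M])
  obtain C where C: "C > 0" "\<And>r. r \<ge> 0 \<Longrightarrow> measure M (cball 0 r) = C * r ^ CARD('m)"
    using haar_real_ball[OF M] by blast
  have bS: "bounded S" using S(1) by (auto simp: real_ball_eq intro: bounded_subset)
  \<comment> \<open>\<open>s\<close> may be negative, in which case \<open>S\<close> is
    empty.\<close>
  define s' where "s' = max s 0"
  show ?thesis
  \<comment> \<open>The relative volume of the shell between radii \<open>r - s'\<close> and
    \<open>r\<close>; points at norm up to \<open>r - s'\<close> stay in the ball when shifted by an
    element of \<open>S\<close>.\<close>
  proof (rule alpha_bar_le[where E="\<lambda>r. 1 - ((r - s') / r) ^ CARD('m)"])
    show "AE x in \<mu>. x \<in> S" using \<mu> by (intro AE_measure_support)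
    show "(INF u. Re (fourier real_char \<mu> u)) \<le> Re (\<integral>x. cnj (pairing real_char x u) \<partial>\<mu>)" for u
      by (intro fourier_INF_le \<mu> norm_real_char)
    show "\<forall>\<^sub>F r in at_top. measure M (real_ball r) > 0"
      using eventually_gt_at_top[of 0] by eventually_elim (simp add: real_ball_eq C)
    have "((\<lambda>r. 1 - ((r - s') / r) ^ CARD('m)) \<longlongrightarrow> 1 - 1 ^ CARD('m)) at_top"
      by (intro tendsto_intros) real_asymp
    then show "((\<lambda>r. 1 - ((r - s') / r) ^ CARD('m)) \<longlongrightarrow> 0) at_top" by simp
    show "\<forall>\<^sub>F r in at_top. \<forall>x\<in>S. measure M (real_ball r - {y. y + x \<in> real_ball r})
        \<le> (1 - ((r - s') / r) ^ CARD('m)) * measure M (real_ball r)"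
      using eventually_gt_at_top[of s']
    proof (eventually_elim, intro ballI)
      fix r x assume r: "s' < r" and x: "x \<in> S"
      have r0: "r > 0" "s' \<ge> 0" using r by (auto simp: s'_def)
      have nx: "norm x \<le> s'" using x S(1) by (auto simp: real_ball_eq s'_def)
      have fm: "cball 0 r' \<in> fmeasurable M" for r'
        using emeasure_bounded_finite[of "cball 0 r'"] by (simp add: fmeasurable_def)
      have "real_ball r - {y. y + x \<in> real_ball r} \<subseteq> cball 0 r - cball 0 (r - s')"
      proof
        fix y assume y: "y \<in> real_ball r - {y. y + x \<in> real_ball r}"
        then show "y \<in> cball 0 r - cball 0 (r - s')"
          using norm_triangle_ineq[of y x] nx by (auto simp: real_ball_eq)
      qed
      then have "measure M (real_ball r - {y. y + x \<in> real_ball r}) \<le> measure M (cball 0 r - cball 0 (r - s'))"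
        using fm by (intro measure_mono_fmeasurable fmeasurable.Diff) (auto simp: real_ball_eq)
      also have "\<dots> = measure M (cball 0 r) - measure M (cball 0 (r - s'))"
        using fm emeasure_bounded_finite[of "cball 0 r"] r0 by (intro measure_Diff) auto
      also have "\<dots> = (1 - ((r - s') / r) ^ CARD('m)) * measure M (real_ball r)"
        using r r0 by (simp add: real_ball_eq C left_diff_distrib power_divide)
      finally show "measure M (real_ball r - {y. y + x \<in> real_ball r})
        \<le> (1 - ((r - s') / r) ^ CARD('m)) * measure M (real_ball r)" .
    qed
  qed (use S \<mu> bS in \<open>auto simp: real_ball_eq\<close>)
qed

section \<open>p-adic space\<close>

lemma padic_norm_inverse_prime: "padic_norm (1 / of_nat CARD('p) :: 'p::prime_card padic) = real CARD('p)"
proof -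
  note p1 = CARD_prime_gt_1[where 'p='p]
  have P: "padic_norm (of_nat CARD('p) :: 'p padic) = 1 / real CARD('p)"
    using padic_norm_prime_power[where 'p='p, of 1] by simp
  then have "(of_nat CARD('p) :: 'p padic) \<noteq> 0" using p1 by (auto simp: padic_norm_eq_0[symmetric])
  then have "padic_norm (of_nat CARD('p) * (1 / of_nat CARD('p)) :: 'p padic) = padic_norm (1 :: 'p padic)" by simp
  moreover have "padic_norm (1 :: 'p padic) = 1" using padic_norm_prime_power[where 'p='p, of 0] by simp
  ultimately show ?thesis using p1 by (simp only: padic_norm_mult P) (simp add: divide_eq_eq)
qed

lemma padic_ball_iff: "x \<in> padic_ball r \<longleftrightarrow> (\<forall>i. padic_norm (x $ i) \<le> r)"
  by (simp add: padic_ball_def)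

lemma closed_padic_ball: "closed (padic_ball r :: ('p::prime_card padic ^ 'm) set)"
proof -
  have "padic_ball r = (\<Inter>i. {x :: 'p padic ^ 'm. dist (x $ i) 0 \<le> r})"
    by (auto simp: padic_ball_iff dist_padic_def)
  then show ?thesis by (auto intro!: closed_INT closed_Collect_le continuous_intros)
qed

lemma borel_padic_ball [simp, measurable]:
  "(padic_ball r :: ('p::prime_card padic ^ 'm) set) \<in> sets borel"
  using closed_padic_ball by (rule borel_closed)

text \<open>A bridge between the Euclidean combination in \<open>dist\<close> and the coordinate
  norms that define \<open>padic_ball\<close>.\<close>

lemma norm_vec_padic_le: "dist x 0 \<le> (\<Sum>i\<in>UNIV. padic_norm (x $ i))" for x :: "'p::prime_card padic ^ 'm"
proof -
  have "dist x 0 \<le> (\<Sum>i\<in>UNIV. dist (x $ i) (0 $ i))"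
    unfolding dist_vec_def by (intro L2_set_le_sum) auto
  then show ?thesis by (simp add: dist_padic_def)
qed

lemma bounded_padic_ball: "bounded (padic_ball r :: ('p::prime_card padic ^ 'm) set)"
proof -
  have "dist 0 x \<le> real CARD('m) * r" if "x \<in> padic_ball r" for x :: "'p padic ^ 'm"
    using norm_vec_padic_le[of x] sum_bounded_above[of UNIV "\<lambda>i. padic_norm (x $ i)" r] that
    by (simp add: padic_ball_iff dist_commute)
  then show ?thesis unfolding bounded_def by blast
qed

text \<open>By the ultrametric inequality balls are subgroups. Both the orthogonality of characters
  on a ball and its invariance under translation by \<open>S\<close> rest on this.\<close>

lemma padic_ball_add: "x \<in> padic_ball r \<Longrightarrow> y \<in> padic_ball r \<Longrightarrow> x + y \<in> padic_ball r"
  unfolding padic_ball_iff using padic_norm_add_le_max order_trans by (fastforce simp: le_max_iff_disj)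

lemma padic_ball_minus: "- x \<in> padic_ball r \<longleftrightarrow> x \<in> padic_ball r"
  by (simp add: padic_ball_iff padic_norm_minus)

lemma ball_subset_padic_ball: "ball 0 r \<subseteq> (padic_ball r :: ('p::prime_card padic ^ 'm) set)"
proof
  fix x :: "'p padic ^ 'm" assume "x \<in> ball 0 r"
  then show "x \<in> padic_ball r"
    using dist_vec_nth_le[of x _ 0] by (auto simp: padic_ball_iff dist_padic_def dist_commute intro: order_trans less_imp_le le_less_trans)
qed

text \<open>If coordinate \<open>i\<close> had norm at least \<open>d\<close>, take the vector with
  single entry \<open>a\<close> such that \<open>x $ i * a = 1/p\<close>. It has norm at most
  \<open>p / d\<close> and a nontrivial character value.\<close>

lemma padic_annihilator_small:
  fixes x :: "'p::prime_card padic ^ 'm"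
  assumes d: "d > 0" and ann: "\<And>u. u \<in> padic_ball (real CARD('p) / d) \<Longrightarrow> pairing padic_char x u = 1"
  shows "padic_norm (x $ i) < d"
proof (rule ccontr)
  assume "\<not> padic_norm (x $ i) < d"
  then have le: "d \<le> padic_norm (x $ i)" by simp
  then have nz: "x $ i \<noteq> 0" using d padic_norm_eq_0[of "x $ i"] by auto
  define a where "a = 1 / of_nat CARD('p) / x $ i"
  have ax: "x $ i * a = 1 / of_nat CARD('p)" using nz by (simp add: a_def)
  have "padic_norm (x $ i) * padic_norm a = real CARD('p)"
    using padic_norm_inverse_prime[where 'p='p] by (simp only: padic_norm_mult[symmetric] ax)
  then have "padic_norm a = real CARD('p) / padic_norm (x $ i)" using le d by (simp add: field_simps)
  also have "\<dots> \<le> real CARD('p) / d" using le d by (intro divide_left_mono mult_pos_pos) auto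
  finally have na: "padic_norm a \<le> real CARD('p) / d" .
  have "axis i a \<in> padic_ball (real CARD('p) / d)"
    using na d by (auto simp: padic_ball_iff axis_def padic_norm_eq_0[THEN iffD2])
  then have "pairing padic_char x (axis i a) = 1" by (rule ann)
  moreover have "(\<Sum>j\<in>UNIV. x $ j * axis i a $ j) = 1 / of_nat CARD('p)"
    using ax by (subst sum.remove[of _ i]) (auto simp: axis_def intro!: sum.neutral)
  ultimately show False using padic_char_inverse_prime[where 'p='p] by (simp add: pairing_def)
qed

text \<open>The transform of the uniform measure on a ball is the indicator of its annihilator
  \<open>H\<close>. For a large ball \<open>H\<close> lies in \<open>ball 0 d\<close>, so the tail
  is exactly 0; \<open>H\<close> also contains a small ball, so its mass is positive.\<close>

lemma haar_pairing_approx_padic: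
  fixes M :: "('p::prime_card padic ^ 'm) measure"
  assumes "haar_measure M" shows "haar_pairing_approx M (pairing padic_char)"
proof -
  interpret haar_pairing M "pairing padic_char"
    by (rule haar_pairingI[OF assms padic_char_add norm_padic_char continuous_padic_char])
  show ?thesis
  proof
    fix d e :: real and D :: "('p padic ^ 'm) set"
    assume d: "0 < d" and e: "0 < e" and D: "compact D"
    note p1 = CARD_prime_gt_1[where 'p='p]
    \<comment> \<open>Coordinates below \<open>d / m\<close> sum to less than \<open>d\<close>, and
      this sum bounds the Euclidean distance to 0.\<close>
    define \<delta> where "\<delta> = d / real CARD('m)"
    have \<delta>: "\<delta> > 0" using d by (simp add: \<delta>_def)
    define R where "R = real CARD('p) / \<delta>"
    have R: "R > 0" using p1 \<delta> by (simp add: R_def)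
    define B where "B = (padic_ball R :: ('p padic ^ 'm) set)"
    have [measurable]: "B \<in> sets borel" unfolding B_def by simp
    have Bb: "bounded B" unfolding B_def by (rule bounded_padic_ball)
    have "measure M (ball 0 R) \<le> measure M B"
      using emeasure_bounded_finite[OF Bb] ball_subset_padic_ball[of R]
      by (intro measure_mono_fmeasurable) (auto simp: fmeasurable_def B_def)
    then have MB: "measure M B > 0"
      using measure_open_pos[of "ball 0 R"] R by auto
    define H where "H = {x. \<forall>u\<in>B. pairing padic_char x u = 1}"
    define k where "k = indicat_real H"
    define \<nu> where "\<nu> = uniform_measure M B"
    have eB: "emeasure M B = ennreal (measure M B)"
      using emeasure_bounded_finite[OF Bb] by (intro emeasure_eq_ennreal_measure) auto
    have \<nu>1: "prob_space \<nu>" unfolding \<nu>_def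
      using MB emeasure_bounded_finite[OF Bb] by (intro prob_space_uniform_measure) (auto simp: eB)
    have \<nu>i: "(\<integral>u. f u \<partial>\<nu>) = (\<integral>u. (indicat_real B u / measure M B) *\<^sub>R f u \<partial>M)"
      if [measurable]: "f \<in> borel_measurable borel" for f :: "_ \<Rightarrow> complex"
    proof -
      have "\<nu> = density M (\<lambda>u. ennreal (indicat_real B u / measure M B))"
        unfolding \<nu>_def uniform_measure_def
        by (rule arg_cong[of _ _ "density M"])
           (use MB in \<open>auto simp: eB indicator_def divide_ennreal ennreal_1[symmetric] simp del: ennreal_1\<close>)
      then show ?thesis by (simp add: integral_density)
    qed
    have [measurable]: "pairing padic_char x \<in> borel_measurable borel" for x :: "'p padic ^ 'm"
      by (rule chi_measurable'[of "\<lambda>_. x" borel "\<lambda>u. u"]) (auto intro: measurable_ident_sets)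
    have K: "(\<integral>u. pairing padic_char x u \<partial>\<nu>) = complex_of_real (k x)" for x
    proof (cases "x \<in> H")
      case True
      have "(\<integral>u. pairing padic_char x u \<partial>\<nu>) = (\<integral>u. (indicat_real B u / measure M B) *\<^sub>R 1 \<partial>M)"
        using True by (subst \<nu>i) (auto intro!: Bochner_Integration.integral_cong simp: H_def indicator_def)
      also have "\<dots> = of_real (\<integral>u. indicat_real B u / measure M B \<partial>M)"
        by (simp add: scaleR_conv_of_real)
      also have "(\<integral>u. indicat_real B u / measure M B \<partial>M) = 1" using MB by simp
      finally show ?thesis using True by (simp add: k_def)
    next
      case False
      then obtain v where v: "v \<in> B" "pairing padic_char x v \<noteq> 1" by (auto simp: H_def)
      have iB: "indicat_real B (u + v) = indicat_real B u" for u
      proof -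
        have "u + v \<in> B \<longleftrightarrow> u \<in> B"
          using padic_ball_add[of u R v] padic_ball_add[of "u + v" R "- v"] v(1)
          by (auto simp: B_def padic_ball_minus)
        then show ?thesis by (simp add: indicator_def)
      qed
      have pv: "pairing padic_char x (u + v) = pairing padic_char x u * pairing padic_char x v" for u
        by (simp add: pairing_def distrib_left sum.distrib padic_char_add)
      let ?I = "\<integral>u. (indicat_real B u / measure M B) *\<^sub>R pairing padic_char x u \<partial>M"
      \<comment> \<open>Orthogonality: translation by \<open>v\<close> preserves the ball and
        multiplies the integral by a value other than 1, so the integral is 0.\<close>
      have "?I = (\<integral>u. (indicat_real B (u + v) / measure M B) *\<^sub>R pairing padic_char x (u + v) \<partial>M)"
        by (rule integral_translate[symmetric]) measurable
      also have "\<dots> = (\<integral>u. (indicat_real B u / measure M B) *\<^sub>R pairing padic_char x u * pairing padic_char x v \<partial>M)"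
        by (simp add: iB pv)
      also have "\<dots> = ?I * pairing padic_char x v" by (simp only: integral_mult_left_zero)
      finally have "?I = 0" using v(2) by simp
      then show ?thesis using False by (simp add: \<nu>i k_def)
    qed
    have Hm [measurable]: "k \<in> borel_measurable borel"
    proof -
      interpret prob_space \<nu> by (rule \<nu>1)
      have [measurable_cong]: "sets \<nu> = sets borel" by (simp add: \<nu>_def)
      have "(\<lambda>x. Re (\<integral>u. pairing padic_char x u \<partial>\<nu>)) \<in> borel_measurable borel" by measurable
      then show ?thesis by (simp add: K)
    qed
    have Hd: "x \<in> ball 0 d" if "x \<in> H" for x
    proof -
      have "padic_norm (x $ i) < \<delta>" for i
        using that by (intro padic_annihilator_small[OF \<delta>]) (auto simp: H_def B_def R_def)
      then have "(\<Sum>i\<in>UNIV. padic_norm (x $ i)) < (\<Sum>i\<in>(UNIV :: 'm set). \<delta>)"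
        by (intro sum_strict_mono) auto
      then have "dist x 0 < d"
        using norm_vec_padic_le[of x] by (simp add: \<delta>_def)
      then show ?thesis by (simp add: dist_commute)
    qed
    \<comment> \<open>The products \<open>x $ i * u $ i\<close> with \<open>u \<in> B\<close> are
      p-adic integers, and so is their sum.\<close>
    have dH: "x \<in> H" if "x \<in> ball 0 (1 / R)" for x
    proof -
      have "padic_norm (x $ i * u $ i) \<le> 1" if "u \<in> B" for u i
      proof -
        have "padic_norm (x $ i) \<le> 1 / R" "padic_norm (u $ i) \<le> R"
          using ball_subset_padic_ball[of "1 / R"] \<open>x \<in> ball 0 (1 / R)\<close> \<open>u \<in> B\<close>
          by (auto simp: padic_ball_iff B_def subset_iff)
        then have "padic_norm (x $ i) * padic_norm (u $ i) \<le> 1 / R * R"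
          using R by (intro mult_mono) (auto simp: padic_norm_nonneg)
        then show ?thesis using R by (simp add: padic_norm_mult)
      qed
      moreover have "padic_norm (\<Sum>i\<in>A. f i) \<le> 1" if "finite A" "\<And>i. padic_norm (f i) \<le> 1" for A and f :: "'m \<Rightarrow> 'p padic"
        using that(1)
      proof induction
        case empty show ?case by (simp add: padic_norm_eq_0[THEN iffD2])
      next
        case (insert j A)
        then show ?case using padic_norm_add_le_max[of "f j" "\<Sum>i\<in>A. f i"] that(2)[of j] by simp
      qed
      ultimately show ?thesis
        by (auto simp: H_def pairing_def intro!: padic_char_integer)
    qed
    have tail: "(\<integral>t. k t \<partial>window (D - ball 0 d)) = 0"
    proof -
      have [measurable]: "D \<in> sets borel" using D by (rule borel_compact)
      have "indicat_real (D - ball 0 d) t *\<^sub>R k t = 0" for t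
        using Hd[of t] by (auto simp: indicator_def k_def)
      then show ?thesis by (subst integral_window) (simp_all only: integral_zero, auto)
    qed
    have pos: "0 < (\<integral>t. k t \<partial>window (ball 0 d))"
    proof -
      define \<rho> where "\<rho> = min d (1 / R)"
      have "\<rho> > 0" using d R by (simp add: \<rho>_def)
      then have "0 < measure M (ball 0 \<rho>)" by (intro measure_open_pos) auto
      also have "\<dots> = (\<integral>t. indicat_real (ball 0 \<rho>) t \<partial>M)" by simp
      also have "\<dots> \<le> (\<integral>t. indicat_real (ball 0 d) t *\<^sub>R k t \<partial>M)"
      proof (rule integral_mono)
        show "integrable M (\<lambda>t. indicat_real (ball 0 d) t *\<^sub>R k t)"
        proof (rule integrable_bounded_support[where B="ball 0 d" and C=1])
          have [measurable]: "ball (0 :: 'p padic ^ 'm) d \<in> sets borel" by simp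
          show "(\<lambda>t. indicat_real (ball 0 d) t *\<^sub>R k t) \<in> borel_measurable borel" by measurable
        qed (auto simp: indicator_def k_def)
        show "indicat_real (ball 0 \<rho>) t \<le> indicat_real (ball 0 d) t *\<^sub>R k t" for t
          using dH[of t] by (auto simp: indicator_def k_def \<rho>_def)
      qed simp
      also have "\<dots> = (\<integral>t. k t \<partial>window (ball 0 d))" by (simp add: integral_window)
      finally show ?thesis .
    qed
    show "\<exists>\<nu> k. prob_space \<nu> \<and> sets \<nu> = sets borel \<and>
        (\<forall>x. (\<integral>u. pairing padic_char x u \<partial>\<nu>) = complex_of_real (k x)) \<and> (\<forall>x. 0 \<le> k x) \<and>
        0 < (\<integral>t. k t \<partial>window (ball 0 d)) \<and>
        (\<integral>t. k t \<partial>window (D - ball 0 d)) \<le> e * (\<integral>t. k t \<partial>window (ball 0 d))"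
      using \<nu>1 K pos tail e
      by (intro exI[of _ \<nu>] exI[of _ k]) (auto simp: \<nu>_def k_def)
  qed
qed

lemma alpha_bar_padic:
  fixes M :: "('p::prime_card padic ^ 'm) measure"
  assumes M: "haar_measure M" and S: "S \<subseteq> padic_ball s" "uminus ` S = S" "0 \<notin> closure S"
    and \<mu>: "prob_space \<mu>" "sets \<mu> = sets borel" "measure_support \<mu> \<subseteq> S"
  shows "alpha_bar M padic_ball (cayley_graph S)
    \<le> ereal (- ((INF u. Re (fourier padic_char \<mu> u)) / (1 - (INF u. Re (fourier padic_char \<mu> u)))))"
proof -
  interpret haar_pairing_approx M "pairing padic_char" by (rule haar_pairing_approx_padic[OF M])
  have bS: "bounded S" using S(1) bounded_padic_ball by (rule bounded_subset[rotated])
  show ?thesis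
  \<comment> \<open>For \<open>r \<ge> s\<close> the ball is closed under addition and contains
    \<open>S\<close>, so translation moves nothing out.\<close>
  proof (rule alpha_bar_le[where E="\<lambda>_. 0"])
    show "AE x in \<mu>. x \<in> S" using \<mu> by (intro AE_measure_support)
    show "(INF u. Re (fourier padic_char \<mu> u)) \<le> Re (\<integral>x. cnj (pairing padic_char x u) \<partial>\<mu>)" for u
      by (intro fourier_INF_le \<mu> norm_padic_char)
    show "\<forall>\<^sub>F r in at_top. measure M (padic_ball r) > 0"
      using eventually_gt_at_top[of 0]
    proof eventually_elim
      case (elim r)
      have "measure M (ball 0 r) \<le> measure M (padic_ball r)"
        using emeasure_bounded_finite[OF bounded_padic_ball] ball_subset_padic_ball[of r]
        by (intro measure_mono_fmeasurable) (auto simp: fmeasurable_def)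
      then show ?case using measure_open_pos[of "ball 0 r"] elim by auto
    qed
    show "\<forall>\<^sub>F r in at_top. \<forall>x\<in>S. measure M (padic_ball r - {y. y + x \<in> padic_ball r}) \<le> 0 * measure M (padic_ball r)"
      using eventually_ge_at_top[of s]
    proof (eventually_elim, intro ballI)
      fix r x assume r: "s \<le> r" and x: "x \<in> S"
      have "x \<in> padic_ball r" using x S(1) r unfolding padic_ball_iff subset_iff by (meson order_trans)
      then have "padic_ball r - {y. y + x \<in> padic_ball r} = {}" using padic_ball_add by blast
      then show "measure M (padic_ball r - {y. y + x \<in> padic_ball r}) \<le> 0 * measure M (padic_ball r)"
        by (simp only: measure_empty mult_zero_left order_refl)
    qed
  qed (use S \<mu> bS bounded_padic_ball in auto)
qed

theorem theorem2p6:
  shows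
    "(\<forall>(M :: (real ^ 'm) measure) (S :: (real ^ 'm) set) (\<mu> :: (real ^ 'm) measure).
        haar_measure M \<longrightarrow>
        S \<in> sets borel \<longrightarrow> (\<exists>r. S \<subseteq> real_ball r) \<longrightarrow> uminus ` S = S \<longrightarrow> 0 \<notin> closure S \<longrightarrow>
        prob_space \<mu> \<longrightarrow> sets \<mu> = sets borel \<longrightarrow> symmetric_measure \<mu> \<longrightarrow> measure_support \<mu> \<subseteq> S \<longrightarrow>
        alpha_bar M real_ball (cayley_graph S)
          \<le> ereal (- ((INF u. Re (fourier real_char \<mu> u)) /
                       (1 - (INF u. Re (fourier real_char \<mu> u))))))
     \<and>
     (\<forall>(M :: ('p::prime_card padic ^ 'm) measure) (S :: ('p padic ^ 'm) set) (\<mu> :: ('p padic ^ 'm) measure).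
        haar_measure M \<longrightarrow>
        S \<in> sets borel \<longrightarrow> (\<exists>r. S \<subseteq> padic_ball r) \<longrightarrow> uminus ` S = S \<longrightarrow> 0 \<notin> closure S \<longrightarrow>
        prob_space \<mu> \<longrightarrow> sets \<mu> = sets borel \<longrightarrow> symmetric_measure \<mu> \<longrightarrow> measure_support \<mu> \<subseteq> S \<longrightarrow>
        alpha_bar M padic_ball (cayley_graph S)
          \<le> ereal (- ((INF u. Re (fourier padic_char \<mu> u)) /
                       (1 - (INF u. Re (fourier padic_char \<mu> u))))))"
  by (intro conjI allI impI; elim exE; rule alpha_bar_real alpha_bar_padic; assumption)

end
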